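(* Let $s > \frac12$. Then the Cauchy problem for the modified Kawahara equation \[\partial_t v - \partial_x^5 v + \beta \partial_x^3 v + \gamma \partial_x v - \tfrac{\mu}{3}\partial_x (v^3) = 0,\qquad v(0)=v_0\in H^s(\mathbb T),\] is unconditionally globally well-posed in $H^s(\mathbb T)$; that is, it is globally well-posed and uniqueness of solutions holds in the whole class $C([0,T];H^s(\mathbb T))$ for every $T>0$.
   Context: $\mathbb T=\mathbb R/2\pi\mathbb Z$, $\beta\ge0$, $\gamma\in\mathbb R$, $\mu=\pm1$, and $v$ is real-valued. A solution means a function satisfying the Duhamel formula $v(t)=S(t)v_0+\frac{\mu}{3}\int_0^t S(t-s)\partial_x(v(s)^3)\,ds$, where $S(t)f=\frac1{2\pi}\sum_{n\in\mathbb Z}e^{inx}e^{it(n^5+\beta n^3-\gamma n)}\hat f(n)$. Well-posedness in $H^s$: existence of a solution in a subset $X^s_T\subset C([0,T];H^s)$, uniqueness in $X^s_T$, continuous dependence on data; globally means $T$ arbitrary; unconditionally means one can take $X^s_T=C([0,T];H^s)$. *)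

theory Defs
  imports "HOL-Analysis.Analysis"
begin

text \<open>Functions on the torus T = R/2piZ are represented by their Fourier coefficients
  c :: int => complex, with the normalisation  c n = integral over T of f(x) e^{-inx} dx,
  so that  f(x) = (1/2pi) sum_n c n e^{inx}  (matching the formula for S(t)).\<close>

definition real_valued :: "(int \<Rightarrow> complex) \<Rightarrow> bool" where
  "real_valued c \<longleftrightarrow> (\<forall>n. c (-n) = cnj (c n))"

definition hs_weight :: "real \<Rightarrow> (int \<Rightarrow> complex) \<Rightarrow> int \<Rightarrow> real" where
  "hs_weight s c n = (1 + (real_of_int n)^2) powr s * (cmod (c n))^2"

definition Hs :: "real \<Rightarrow> (int \<Rightarrow> complex) set" where
  "Hs s = {c. real_valued c \<and> hs_weight s c summable_on UNIV}"

definition hs_norm :: "real \<Rightarrow> (int \<Rightarrow> complex) \<Rightarrow> real" where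
  "hs_norm s c = sqrt (\<Sum>\<^sub>\<infinity>n\<in>UNIV. hs_weight s c n)"

text \<open>Fourier coefficients of a product: (fg)^ = (1/2pi) (f^ * g^).\<close>
definition fconv :: "(int \<Rightarrow> complex) \<Rightarrow> (int \<Rightarrow> complex) \<Rightarrow> int \<Rightarrow> complex" where
  "fconv a b n = (1 / (2 * of_real pi)) * (\<Sum>\<^sub>\<infinity>k\<in>UNIV. a k * b (n - k))"

definition fcube :: "(int \<Rightarrow> complex) \<Rightarrow> int \<Rightarrow> complex" where
  "fcube a = fconv a (fconv a a)"

text \<open>Dispersion symbol: S(t) multiplies the n-th coefficient by exp(i t phi(n)).\<close>
definition phase :: "real \<Rightarrow> real \<Rightarrow> int \<Rightarrow> real" where
  "phase \<beta> \<gamma> n = (real_of_int n)^5 + \<beta> * (real_of_int n)^3 - \<gamma> * real_of_int n"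

definition C_Hs :: "real \<Rightarrow> real \<Rightarrow> (real \<Rightarrow> int \<Rightarrow> complex) \<Rightarrow> bool" where
  "C_Hs s T v \<longleftrightarrow> (\<forall>t\<in>{0..T}. v t \<in> Hs s) \<and>
     (\<forall>t\<in>{0..T}. \<forall>\<epsilon>>0. \<exists>\<delta>>0. \<forall>t'\<in>{0..T}. \<bar>t' - t\<bar> < \<delta> \<longrightarrow> hs_norm s (v t' - v t) < \<epsilon>)"

definition duhamel :: "real \<Rightarrow> real \<Rightarrow> real \<Rightarrow> real \<Rightarrow> (int \<Rightarrow> complex)
    \<Rightarrow> (real \<Rightarrow> int \<Rightarrow> complex) \<Rightarrow> bool" where
  "duhamel \<beta> \<gamma> \<mu> T v0 v \<longleftrightarrow> (\<forall>t\<in>{0..T}. \<forall>n. \<exists>I.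
     ((\<lambda>\<tau>. exp (\<i> * complex_of_real ((t - \<tau>) * phase \<beta> \<gamma> n)) * (\<i> * of_int n) * fcube (v \<tau>) n)
        has_integral I) {0..t} \<and>
     v t n = exp (\<i> * complex_of_real (t * phase \<beta> \<gamma> n)) * v0 n + complex_of_real (\<mu> / 3) * I)"

definition mK_solution :: "real \<Rightarrow> real \<Rightarrow> real \<Rightarrow> real \<Rightarrow> real \<Rightarrow> (int \<Rightarrow> complex)
    \<Rightarrow> (real \<Rightarrow> int \<Rightarrow> complex) \<Rightarrow> bool" where
  "mK_solution \<beta> \<gamma> \<mu> s T v0 v \<longleftrightarrow> C_Hs s T v \<and> duhamel \<beta> \<gamma> \<mu> T v0 v"

definition uncond_global_wp :: "real \<Rightarrow> real \<Rightarrow> real \<Rightarrow> real \<Rightarrow> bool" where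
  "uncond_global_wp \<beta> \<gamma> \<mu> s \<longleftrightarrow> (\<forall>T>0.
     (\<forall>v0\<in>Hs s. \<exists>v. mK_solution \<beta> \<gamma> \<mu> s T v0 v) \<and>
     (\<forall>v0\<in>Hs s. \<forall>v w. mK_solution \<beta> \<gamma> \<mu> s T v0 v \<and> mK_solution \<beta> \<gamma> \<mu> s T v0 w
        \<longrightarrow> (\<forall>t\<in>{0..T}. v t = w t)) \<and>
     (\<forall>v0\<in>Hs s. \<forall>\<epsilon>>0. \<exists>\<delta>>0. \<forall>w0\<in>Hs s. \<forall>v w.
        hs_norm s (w0 - v0) < \<delta> \<and> mK_solution \<beta> \<gamma> \<mu> s T v0 v \<and> mK_solution \<beta> \<gamma> \<mu> s T w0 w
        \<longrightarrow> (\<forall>t\<in>{0..T}. hs_norm s (w t - v t) < \<epsilon>)))"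

end

theory Submission
  imports Defs "HOL-Complex_Analysis.Great_Picard" "HOL-Real_Asymp.Real_Asymp"
begin

text \<open>The resonance function of the cubic interaction \<open>n = a + b + d\<close> factors as
  \<open>\<Phi> = (a + b)(b + d)(d + a)(5/2 S + 3 \<beta>)\<close> with \<open>S = a\<^sup>2 + b\<^sup>2 + d\<^sup>2 + n\<^sup>2\<close>, so for
  \<open>\<beta> \<ge> 0\<close> it is at least of size \<open>S\<close> unless it vanishes.  The resonant part of the nonlinearity
  is \<open>i n (3 M - 3 |v\<^sub>n|\<^sup>2) v\<^sub>n\<close> with \<open>M = \<Sum>|v\<^sub>k|\<^sup>2\<close>; the term with \<open>M\<close> is removed by a time
  dependent phase and the other one is Lipschitz in \<open>H\<^sup>s\<close> for \<open>s \<ge> 1/2\<close>.  One differentiation by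
  parts of the nonresonant part with \<open>S > K\<^sup>2\<close> gives boundary terms of size \<open>1/K\<close> and quintic
  terms whose multiplier \<open>n m / \<Phi>\<close>, \<open>m\<close> one of the frequencies, is bounded, so everything is
  Lipschitz in the algebra \<open>H\<^sup>s\<close>.  This yields uniqueness in \<open>C([0,T]; H\<^sup>s)\<close>, Lipschitz dependence
  up to the phase, and strong continuity of merely bounded solutions.

  Existence comes from Galerkin truncations, once their \<open>H\<^sup>s\<close> norm is bounded on \<open>[0,T]\<close>.  The
  mass \<open>M\<close> is conserved, and since \<open>S = (a+b)\<^sup>2 + (b+d)\<^sup>2 + (d+a)\<^sup>2\<close> one of the three factors of
  \<open>\<Phi>\<close> is comparable to \<open>\<surd>S\<close>.  This gains a full derivative: the energy \<open>E = \<parallel>v\<parallel>\<^sup>2\<close> in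
  \<open>H\<^sup>s\<close>, corrected by the boundary term, has derivative at most a constant plus a multiple of the
  product of the squared norms of \<open>v\<close> in \<open>H\<close> of order \<open>s - 1/2\<close> and of its Fourier coefficients
  in \<open>l\<^sup>1\<close>; this product interpolates to \<open>C M E\<close>.  Hence the bound is exponential in time.\<close>

section \<open>Square summable sequences and multilinear estimates\<close>

text \<open>Square summability is encoded by \<open>l2b\<close>, a bound on all finite partial
  norms: every estimate then concerns finite sums and survives coefficientwise limits. The obstacle
  to uniqueness is that \<open>\<i> n G\<close> loses a derivative, so the product rule cannot be
  applied to the infinite cubic sum of a solution that is only in \<open>H^s\<close>.
  Differentiation by parts is therefore done on finite boxes of frequencies. The error
  \<open>G - GL\<close> tends to 0 coefficient by coefficient, uniformly in time, and the factor
  \<open>n\<close> is harmless on a finite set of frequencies; so the box grows first and the finite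
  set afterwards. The boundary terms carry no factor of time, which is why \<open>K\<close> is fixed
  before the time step. In the a priori bound the boundary term is small relative to
  \<open>E\<close> with a factor that involves only the conserved mass, so one \<open>K\<close>
  serves all times. The removed phase rotates coefficient \<open>n\<close> by \<open>n\<close> times
  an angle that depends on the solution. Two solutions with close angles are thus close at low
  frequencies only, and undoing the phase needs uniform smallness of the tails. In raw Fourier
  coefficients the nonlinearity has the factor \<open>c = \<mu> / (12 pi^2)\<close>, from \<mu>/3
  and two convolutions.\<close>

definition l2b :: "(int \<Rightarrow> real) \<Rightarrow> real \<Rightarrow> bool" where
  "l2b f B \<longleftrightarrow> (\<forall>F. finite F \<longrightarrow> L2_set f F \<le> B)"

lemma l2bD: "l2b f B \<Longrightarrow> finite F \<Longrightarrow> L2_set f F \<le> B"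
  by (simp add: l2b_def)

lemma l2b_nonneg: "l2b f B \<Longrightarrow> 0 \<le> B"
  using l2bD[of f B "{}"] by simp

lemma L2_set_mono_abs:
  assumes "\<And>i. i \<in> F \<Longrightarrow> \<bar>f i\<bar> \<le> \<bar>g i\<bar>"
  shows "L2_set f F \<le> L2_set g F"
  unfolding L2_set_def by (intro real_sqrt_le_mono sum_mono) (metis assms abs_le_square_iff)

lemma l2b_mono:
  assumes "l2b g B" "\<And>n. \<bar>f n\<bar> \<le> \<bar>g n\<bar>"
  shows "l2b f B"
  unfolding l2b_def using L2_set_mono_abs[of _ f g] assms by (meson l2bD order_trans)

lemma l2b_weaken: "l2b f B \<Longrightarrow> B \<le> B' \<Longrightarrow> l2b f B'"
  unfolding l2b_def by force

lemma l2b_add: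
  assumes "l2b f A" "l2b g B"
  shows "l2b (\<lambda>n. f n + g n) (A + B)"
  unfolding l2b_def
proof (intro allI impI)
  fix F :: "int set" assume F: "finite F"
  have "L2_set (\<lambda>n. f n + g n) F \<le> L2_set f F + L2_set g F" by (rule L2_set_triangle_ineq)
  also have "\<dots> \<le> A + B" using l2bD[OF assms(1) F] l2bD[OF assms(2) F] by simp
  finally show "L2_set (\<lambda>n. f n + g n) F \<le> A + B" .
qed

lemma l2b_add_le:
  assumes "l2b f A" "l2b g B" "\<And>n. \<bar>h n\<bar> \<le> \<bar>f n\<bar> + \<bar>g n\<bar>"
  shows "l2b h (A + B)"
proof -
  have "l2b (\<lambda>n. \<bar>f n\<bar>) A" "l2b (\<lambda>n. \<bar>g n\<bar>) B" using assms by (auto intro: l2b_mono)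
  from l2b_add[OF this] show ?thesis by (rule l2b_mono) (use assms(3) in fastforce)
qed

lemma l2b_cmult:
  assumes "l2b f B" "0 \<le> c"
  shows "l2b (\<lambda>n. c * f n) (c * B)"
  unfolding l2b_def using assms by (simp add: L2_set_right_distrib[symmetric] l2bD mult_left_mono)

lemma l2b_cmult_le:
  assumes "l2b f B" "0 \<le> c" "\<And>n. \<bar>g n\<bar> \<le> c * \<bar>f n\<bar>"
  shows "l2b g (c * B)"
  by (rule l2b_mono[OF l2b_cmult[OF assms(1,2)]]) (use assms in \<open>simp add: abs_mult\<close>)

text \<open>A form of Fatou's lemma: a bound sees finitely many coefficients at a time, so
  coefficientwise convergence is enough.\<close>

lemma l2b_lim:
  assumes "\<And>n. (\<lambda>k. f k n) \<longlonglongrightarrow> g n" "\<And>k. l2b (f k) B"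
  shows "l2b g B"
  unfolding l2b_def
proof (intro allI impI)
  fix F :: "int set" assume "finite F"
  have "(\<lambda>k. L2_set (f k) F) \<longlonglongrightarrow> L2_set g F"
    unfolding L2_set_def by (intro tendsto_intros assms)
  then show "L2_set g F \<le> B"
    by (rule LIMSEQ_le_const2) (use assms(2) \<open>finite F\<close> in \<open>auto simp: l2b_def\<close>)
qed

lemma l2b_abs_le: "l2b f B \<Longrightarrow> \<bar>f n\<bar> \<le> B"
  using l2bD[of f B "{n}"] by (simp add: L2_set_def)

lemma l2b_sum_sq:
  assumes "l2b f B" "finite F"
  shows "(\<Sum>n\<in>F. (f n)\<^sup>2) \<le> B\<^sup>2"
proof -
  have "sqrt (\<Sum>n\<in>F. (f n)\<^sup>2) \<le> B" using l2bD[OF assms] by (simp add: L2_set_def)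
  then show ?thesis by (rule sqrt_le_D)
qed

lemma l2bI_sq:
  assumes "\<And>F. finite F \<Longrightarrow> (\<Sum>n\<in>F. (f n)\<^sup>2) \<le> B\<^sup>2" "0 \<le> B"
  shows "l2b f B"
  unfolding l2b_def L2_set_def using assms by (auto intro: real_le_lsqrt sum_nonneg)

lemma L2_set_sum_le:
  assumes "finite I"
  shows "L2_set (\<lambda>n. \<Sum>i\<in>I. f i n) F \<le> (\<Sum>i\<in>I. L2_set (f i) F)"
  using assms
proof (induction I rule: finite_induct)
  case (insert x I)
  have "L2_set (\<lambda>n. \<Sum>i\<in>insert x I. f i n) F = L2_set (\<lambda>n. f x n + (\<Sum>i\<in>I. f i n)) F"
    using insert by simp
  also have "\<dots> \<le> L2_set (f x) F + L2_set (\<lambda>n. \<Sum>i\<in>I. f i n) F" by (rule L2_set_triangle_ineq)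
  finally show ?case using insert by simp
qed (simp add: L2_set_def)

lemma sum_prod_le_box:
  fixes f g h :: "int \<Rightarrow> real"
  assumes "finite P"
    and "\<And>F. finite F \<Longrightarrow> sum f F \<le> A" "\<And>F. finite F \<Longrightarrow> sum g F \<le> B" "\<And>F. finite F \<Longrightarrow> sum h F \<le> C"
    and nn: "\<And>n. f n \<ge> 0" "\<And>n. g n \<ge> 0" "\<And>n. h n \<ge> 0"
  shows "(\<Sum>(a,b,d)\<in>P. f a * g b * h d) \<le> A * B * C"
proof -
  define X where "X = fst ` P"
  define Y where "Y = (fst \<circ> snd) ` P"
  define Z where "Z = (snd \<circ> snd) ` P"
  have fin: "finite X" "finite Y" "finite Z" using assms(1) by (auto simp: X_def Y_def Z_def)
  have "P \<subseteq> X \<times> Y \<times> Z"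
  proof
    fix x assume "x \<in> P"
    then show "x \<in> X \<times> Y \<times> Z" unfolding X_def Y_def Z_def
      by (cases x) (auto intro: rev_image_eqI)
  qed
  then have "(\<Sum>(a,b,d)\<in>P. f a * g b * h d) \<le> (\<Sum>(a,b,d)\<in>X\<times>Y\<times>Z. f a * g b * h d)"
    by (intro sum_mono2) (use fin nn in auto)
  also have "\<dots> = sum f X * sum g Y * sum h Z"
    by (simp add: sum.cartesian_product[symmetric] sum_distrib_left[symmetric]
        sum_distrib_right[symmetric] mult.assoc)
  also have "\<dots> \<le> A * B * C"
    by (intro mult_mono assms(2-4) fin sum_nonneg nn mult_nonneg_nonneg)
       (use assms(2)[of "{}"] assms(3)[of "{}"] in auto)
  finally show ?thesis .
qed

text \<open>Cauchy--Schwarz in the form that drives every multilinear estimate below: the kernel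
  only has to be square summable along the fibres \<open>a + b + d = n\<close>, uniformly in \<open>n\<close>.\<close>

definition kernel_bound :: "(int \<Rightarrow> int \<Rightarrow> int \<Rightarrow> real) \<Rightarrow> real \<Rightarrow> bool" where
  "kernel_bound m A \<longleftrightarrow> A \<ge> 0 \<and>
     (\<forall>n G. finite G \<longrightarrow> (\<Sum>(k,j)\<in>G. (m k j (n - k - j))\<^sup>2) \<le> A\<^sup>2)"

lemma kernel_sum_fibre:
  assumes "kernel_bound m A" "finite P" "\<And>a b d. (a,b,d) \<in> P \<Longrightarrow> a + b + d = n"
  shows "(\<Sum>(a,b,d)\<in>P. (m a b d)\<^sup>2) \<le> A\<^sup>2"
proof -
  define G where "G = (\<lambda>(a,b,d). (a,b)) ` P"
  have "(\<Sum>(a,b,d)\<in>P. (m a b d)\<^sup>2) = (\<Sum>(k,j)\<in>G. (m k j (n - k - j))\<^sup>2)"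
    unfolding G_def
    by (subst sum.reindex) (auto simp: inj_on_def intro!: sum.cong dest!: assms(3))
  also have "\<dots> \<le> A\<^sup>2" using assms(1,2) unfolding kernel_bound_def G_def by auto
  finally show ?thesis .
qed

text \<open>Cauchy-Schwarz separates the kernel times \<open>Z\<close> from \<open>F G H\<close>.
  The second factor is a product in independent variables; the first is summed fibre by fibre along
  \<open>a + b + d = n\<close>, where \<open>kernel_bound\<close> applies.\<close>

lemma quad_bound:
  assumes m: "kernel_bound m A" and P: "finite P"
    and F: "l2b F f" and G: "l2b G g" and H: "l2b H h" and Z: "l2b Z z"
  shows "(\<Sum>(a,b,d)\<in>P. \<bar>m a b d\<bar> * \<bar>F a\<bar> * \<bar>G b\<bar> * \<bar>H d\<bar> * \<bar>Z (a+b+d)\<bar>) \<le> A * f * g * h * z"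
proof -
  have nn: "f \<ge> 0" "g \<ge> 0" "h \<ge> 0" "z \<ge> 0" "A \<ge> 0"
    using F G H Z m by (auto simp: l2b_nonneg kernel_bound_def)
  define u where "u = (\<lambda>(a,b,d). m a b d * Z (a+b+d))"
  define v where "v = (\<lambda>(a,b,d). F a * G b * H d)"
  have "(\<Sum>x\<in>P. (v x)\<^sup>2) = (\<Sum>(a,b,d)\<in>P. (F a)\<^sup>2 * (G b)\<^sup>2 * (H d)\<^sup>2)"
    by (rule sum.cong) (auto simp: v_def power_mult_distrib)
  also have "\<dots> \<le> f\<^sup>2 * g\<^sup>2 * h\<^sup>2"
    by (rule sum_prod_le_box[OF P]) (auto intro: l2b_sum_sq F G H)
  finally have "L2_set v P \<le> f * g * h"
    unfolding L2_set_def using nn by (intro real_le_lsqrt) (auto simp: power_mult_distrib sum_nonneg)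
  moreover have "L2_set u P \<le> A * z"
  proof -
    define s where "s = (\<lambda>(a,b,d). a + b + d :: int)"
    have "(\<Sum>x\<in>P. (u x)\<^sup>2) = (\<Sum>n\<in>s ` P. \<Sum>x\<in>{x\<in>P. s x = n}. (u x)\<^sup>2)"
      by (rule sum.image_gen[OF P])
    also have "\<dots> = (\<Sum>n\<in>s ` P. (Z n)\<^sup>2 * (\<Sum>(a,b,d)\<in>{x\<in>P. s x = n}. (m a b d)\<^sup>2))"
      unfolding sum_distrib_left
      by (intro sum.cong refl) (auto simp: u_def s_def power_mult_distrib mult.commute)
    also have "\<dots> \<le> (\<Sum>n\<in>s ` P. (Z n)\<^sup>2 * A\<^sup>2)"
      by (intro sum_mono mult_left_mono kernel_sum_fibre[OF m]) (use P in \<open>auto simp: s_def\<close>)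
    also have "\<dots> \<le> z\<^sup>2 * A\<^sup>2"
      unfolding sum_distrib_right[symmetric] by (intro mult_right_mono l2b_sum_sq Z) (use P in auto)
    finally show ?thesis unfolding L2_set_def using nn
      by (intro real_le_lsqrt) (auto simp: power_mult_distrib sum_nonneg mult.commute)
  qed
  moreover have "(\<Sum>(a,b,d)\<in>P. \<bar>m a b d\<bar> * \<bar>F a\<bar> * \<bar>G b\<bar> * \<bar>H d\<bar> * \<bar>Z (a+b+d)\<bar>) = (\<Sum>x\<in>P. \<bar>u x\<bar> * \<bar>v x\<bar>)"
    by (rule sum.cong) (auto simp: u_def v_def abs_mult)
  moreover have "\<dots> \<le> L2_set u P * L2_set v P" by (rule L2_set_mult_ineq)
  ultimately have "(\<Sum>(a,b,d)\<in>P. \<bar>m a b d\<bar> * \<bar>F a\<bar> * \<bar>G b\<bar> * \<bar>H d\<bar> * \<bar>Z (a+b+d)\<bar>)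
      \<le> L2_set u P * L2_set v P" by simp
  also have "\<dots> \<le> (A * z) * (f * g * h)"
    using \<open>L2_set v P \<le> _\<close> \<open>L2_set u P \<le> _\<close> nn by (intro mult_mono) auto
  finally show ?thesis by (simp add: mult_ac)
qed

text \<open>Duality: testing the trilinear expression against its own restriction to
  \<open>N\<close> turns \<open>quad_bound\<close> into y^2 \<le> (bound) y for its norm y on
  \<open>N\<close>.\<close>

lemma tri_l2b:
  assumes m: "kernel_bound m A" and D: "\<And>n. finite (D n)"
    and F: "l2b F f" and G: "l2b G g" and H: "l2b H h"
  shows "l2b (\<lambda>n. \<Sum>(k,j)\<in>D n. \<bar>m k j (n-k-j)\<bar> * \<bar>F k\<bar> * \<bar>G j\<bar> * \<bar>H (n-k-j)\<bar>) (A*f*g*h)"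
  unfolding l2b_def
proof (intro allI impI)
  fix N :: "int set" assume N: "finite N"
  define Y where "Y = (\<lambda>n. \<Sum>(k,j)\<in>D n. \<bar>m k j (n-k-j)\<bar> * \<bar>F k\<bar> * \<bar>G j\<bar> * \<bar>H (n-k-j)\<bar>)"
  define y where "y = L2_set Y N"
  define Z where "Z n = (if n \<in> N then Y n else 0)" for n
  have Z: "l2b Z y"
  proof (rule l2bI_sq)
    fix M :: "int set" assume M: "finite M"
    have "(\<Sum>n\<in>M. (Z n)\<^sup>2) = (\<Sum>n\<in>M \<inter> N. (Y n)\<^sup>2)"
      by (subst sum.inter_restrict[OF M], rule sum.cong) (auto simp: Z_def)
    also have "\<dots> \<le> (\<Sum>n\<in>N. (Y n)\<^sup>2)" by (rule sum_mono2) (use N in auto)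
    finally show "(\<Sum>n\<in>M. (Z n)\<^sup>2) \<le> y\<^sup>2" by (simp add: y_def L2_set_def sum_nonneg)
  qed (simp add: y_def)
  define P where "P = (\<lambda>(n,k,j). (k,j,n-k-j)) ` (SIGMA n:N. D n)"
  have P: "finite P" unfolding P_def using N D by auto
  have Ynn: "Y n \<ge> 0" for n unfolding Y_def by (intro sum_nonneg) auto
  have "y\<^sup>2 = (\<Sum>n\<in>N. Y n * Y n)"
    by (simp add: y_def L2_set_def sum_nonneg power2_eq_square)
  also have "\<dots> = (\<Sum>n\<in>N. \<Sum>(k,j)\<in>D n. \<bar>m k j (n-k-j)\<bar> * \<bar>F k\<bar> * \<bar>G j\<bar> * \<bar>H (n-k-j)\<bar> * \<bar>Z n\<bar>)"
  proof (intro sum.cong refl)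
    fix n assume "n \<in> N"
    then have "Y n * Y n = Y n * \<bar>Z n\<bar>" by (simp add: Z_def Ynn)
    also have "\<dots> = (\<Sum>(k,j)\<in>D n. \<bar>m k j (n-k-j)\<bar> * \<bar>F k\<bar> * \<bar>G j\<bar> * \<bar>H (n-k-j)\<bar> * \<bar>Z n\<bar>)"
      by (simp add: Y_def sum_distrib_right case_prod_unfold)
    finally show "Y n * Y n = (\<Sum>(k,j)\<in>D n. \<bar>m k j (n-k-j)\<bar> * \<bar>F k\<bar> * \<bar>G j\<bar> * \<bar>H (n-k-j)\<bar> * \<bar>Z n\<bar>)" .
  qed
  also have "\<dots> = (\<Sum>(n,k,j)\<in>(SIGMA n:N. D n). \<bar>m k j (n-k-j)\<bar> * \<bar>F k\<bar> * \<bar>G j\<bar> * \<bar>H (n-k-j)\<bar> * \<bar>Z n\<bar>)"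
    by (subst sum.Sigma) (use N D in \<open>auto simp: case_prod_unfold\<close>)
  also have "\<dots> = (\<Sum>(a,b,d)\<in>P. \<bar>m a b d\<bar> * \<bar>F a\<bar> * \<bar>G b\<bar> * \<bar>H d\<bar> * \<bar>Z (a+b+d)\<bar>)"
    unfolding P_def by (subst sum.reindex) (auto simp: inj_on_def intro!: sum.cong)
  also have "\<dots> \<le> A*f*g*h*y" by (rule quad_bound[OF m P F G H Z])
  finally have "y * y \<le> (A*f*g*h) * y" by (simp add: power2_eq_square)
  moreover have "y \<ge> 0" by (simp add: y_def)
  moreover have "A*f*g*h \<ge> 0" using m F G H by (auto simp: kernel_bound_def l2b_nonneg)
  ultimately have "y \<le> A*f*g*h" by (cases "y = 0") auto
  then show "L2_set (\<lambda>n. \<Sum>(k,j)\<in>D n. \<bar>m k j (n-k-j)\<bar> * \<bar>F k\<bar> * \<bar>G j\<bar> * \<bar>H (n-k-j)\<bar>) N \<le> A*f*g*h"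
    by (simp add: y_def Y_def)
qed

text \<open>Meant for sums along a fibre, where two suitable linear forms determine the point: by
  injectivity the sum is part of a product of two single sums.\<close>

lemma sum_pair_inj:
  fixes h :: "int \<Rightarrow> real"
  assumes "\<And>F. finite F \<Longrightarrow> sum h F \<le> H" "\<And>n. h n \<ge> 0" "finite G" "inj_on (\<lambda>x. (\<alpha> x, \<beta> x)) G"
  shows "(\<Sum>x\<in>G. h (\<alpha> x) * h (\<beta> x)) \<le> H\<^sup>2"
proof -
  have "(\<Sum>x\<in>G. h (\<alpha> x) * h (\<beta> x)) = (\<Sum>(a,b)\<in>(\<lambda>x. (\<alpha> x, \<beta> x)) ` G. h a * h b)"
    by (subst sum.reindex[OF assms(4)]) simp
  also have "\<dots> \<le> (\<Sum>(a,b)\<in>\<alpha> ` G \<times> \<beta> ` G. h a * h b)"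
    by (rule sum_mono2) (use assms in auto)
  also have "\<dots> = sum h (\<alpha> ` G) * sum h (\<beta> ` G)"
    by (simp add: sum.cartesian_product[symmetric] sum_product)
  also have "\<dots> \<le> H * H" using assms(1)[of "{}"]
    by (intro mult_mono assms sum_nonneg) (use assms in auto)
  finally show ?thesis by (simp add: power2_eq_square)
qed

section \<open>Sobolev weights\<close>

definition W :: "real \<Rightarrow> int \<Rightarrow> real" where
  "W s n = (1 + (real_of_int n)\<^sup>2) powr (s/2)"

lemma W_base: "1 + (real_of_int n)\<^sup>2 \<ge> 1" "1 + (real_of_int n)\<^sup>2 > 0"
  by (simp_all add: add_pos_nonneg)

lemma W_pos: "W s n > 0"
  using W_base[of n] by (simp add: W_def)

lemma W_nonneg [simp]: "W s n \<ge> 0"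
  using W_pos[of s n] by simp

lemma W_abs [simp]: "\<bar>W s n\<bar> = W s n"
  by simp

lemma W_mult: "W s n * W r n = W (s + r) n"
  by (simp add: W_def powr_add[symmetric] add_divide_distrib)

lemma W_mono: "s \<le> r \<Longrightarrow> W s n \<le> W r n"
  unfolding W_def using W_base[of n] by (intro powr_mono) auto

lemma W_0 [simp]: "W 0 n = 1"
  using W_base[of n] by (simp add: W_def)

lemma W_ge_1: "s \<ge> 0 \<Longrightarrow> W s n \<ge> 1"
  using W_mono[of 0 s n] by simp

lemma W_sq: "(W s n)\<^sup>2 = (1 + (real_of_int n)\<^sup>2) powr s"
  unfolding power2_eq_square[of "W s n"] W_mult by (simp add: W_def)

lemma W_2: "W 2 n = 1 + (real_of_int n)\<^sup>2"
  using W_base[of n] by (simp add: W_def)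

lemma W_1_ge: "\<bar>real_of_int n\<bar> \<le> W 1 n"
  by (rule power2_le_imp_le) (simp_all add: W_sq W_2 powr_one W_base)

lemma W_inverse: "W (- s) n = 1 / W s n"
  using W_mult[of s n "-s"] W_pos[of s n] by (simp add: field_simps)

lemma hs_weight_W: "hs_weight s c n = (W s n * cmod (c n))\<^sup>2"
  by (simp add: hs_weight_def power_mult_distrib W_sq)

text \<open>The largest of the three frequencies dominates their sum up to a factor 3. This
  substitutes for the Leibniz rule throughout.\<close>

lemma W_add3:
  assumes "s \<ge> 0"
  shows "W s (a + b + d) \<le> 3 powr s * (W s a + W s b + W s d)"
proof -
  have main: "W s (a + b + d) \<le> 3 powr s * W s x"
    if "a\<^sup>2 \<le> x\<^sup>2" "b\<^sup>2 \<le> x\<^sup>2" "d\<^sup>2 \<le> x\<^sup>2" for x :: int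
  proof -
    have "0 \<le> (a - b)\<^sup>2 + (b - d)\<^sup>2 + (d - a)\<^sup>2" by simp
    then have "(a + b + d)\<^sup>2 \<le> 3 * (a\<^sup>2 + b\<^sup>2 + d\<^sup>2)"
      by (simp add: power2_eq_square algebra_simps)
    also have "\<dots> \<le> 9 * x\<^sup>2" using that by simp
    finally have "real_of_int ((a + b + d)\<^sup>2) \<le> real_of_int (9 * x\<^sup>2)"
      by (simp only: of_int_le_iff)
    then have "1 + (real_of_int (a + b + d))\<^sup>2 \<le> 3\<^sup>2 * (1 + (real_of_int x)\<^sup>2)"
      by simp
    then have "W s (a + b + d) \<le> (3\<^sup>2 * (1 + (real_of_int x)\<^sup>2)) powr (s/2)"
      unfolding W_def using assms W_base[of "a+b+d"] by (intro powr_mono2) auto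
    also have "\<dots> = (3\<^sup>2) powr (s/2) * W s x"
      unfolding W_def using W_base[of x] by (subst powr_mult) auto
    also have "(3\<^sup>2::real) powr (s/2) = (3 powr 2) powr (s/2)" by simp
    also have "\<dots> = 3 powr s" by (subst powr_powr) simp
    finally show ?thesis .
  qed
  consider "b\<^sup>2 \<le> a\<^sup>2" "d\<^sup>2 \<le> a\<^sup>2" | "a\<^sup>2 \<le> b\<^sup>2" "d\<^sup>2 \<le> b\<^sup>2" | "a\<^sup>2 \<le> d\<^sup>2" "b\<^sup>2 \<le> d\<^sup>2" by linarith
  then obtain x where x: "x \<in> {a,b,d}" "W s (a+b+d) \<le> 3 powr s * W s x"
    by cases (auto intro: main)
  then have "W s x \<le> W s a + W s b + W s d" using W_pos[of s a] W_pos[of s b] W_pos[of s d] by auto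
  then show ?thesis using x(2) by (meson mult_left_mono order_trans powr_ge_zero)
qed

lemma W_sum_bounded:
  assumes "p > 1"
  obtains C where "C \<ge> 1" "\<And>F. finite F \<Longrightarrow> (\<Sum>n\<in>F. W (-p) n) \<le> C"
proof -
  have sm: "summable (\<lambda>n. real n powr (-p))"
    using assms by (simp add: summable_real_powr_iff)
  define C where "C = 3 + 2 * (\<Sum>n. real n powr (-p))"
  have nn: "(\<Sum>n. real n powr (-p)) \<ge> 0" by (intro suminf_nonneg sm) auto
  have "(\<Sum>n\<in>F. W (-p) n) \<le> C" if F: "finite F" for F
  proof -
    have le: "W (-p) n \<le> real (nat \<bar>n\<bar>) powr (-p)" if "n \<noteq> 0" for n
    proof -
      have "W (-p) n = 1 / W p n" by (rule W_inverse)
      moreover have "\<bar>real_of_int n\<bar> powr p \<le> W p n"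
      proof -
        have "(real_of_int n)\<^sup>2 = \<bar>real_of_int n\<bar> powr 2" using that by simp
        then have "\<bar>real_of_int n\<bar> powr p = ((real_of_int n)\<^sup>2) powr (p/2)"
          by (simp only: powr_powr) simp
        also have "\<dots> \<le> W p n" unfolding W_def using assms by (intro powr_mono2) auto
        finally show ?thesis .
      qed
      moreover have "1 / W p n \<le> 1 / \<bar>real_of_int n\<bar> powr p" if "\<bar>real_of_int n\<bar> powr p \<le> W p n"
        using that \<open>n \<noteq> 0\<close> by (intro divide_left_mono) (auto simp: W_pos)
      ultimately show ?thesis by (simp add: powr_minus_divide)
    qed
    let ?A = "{n\<in>F. n > 0}" let ?B = "{n\<in>F. n < 0}" let ?Z = "{n\<in>F. n = 0}"
    have half: "(\<Sum>n\<in>X. W (-p) n) \<le> (\<Sum>n. real n powr (-p))"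
      if X: "finite X" "0 \<notin> X" "inj_on (\<lambda>n. nat \<bar>n\<bar>) X" for X
    proof -
      have "(\<Sum>n\<in>X. W (-p) n) \<le> (\<Sum>n\<in>X. real (nat \<bar>n\<bar>) powr (-p))"
        by (intro sum_mono le) (use X in auto)
      also have "\<dots> = (\<Sum>k\<in>(\<lambda>n. nat \<bar>n\<bar>) ` X. real k powr (-p))"
        by (subst sum.reindex[OF X(3)]) simp
      also have "\<dots> \<le> (\<Sum>n. real n powr (-p))"
        by (intro sum_le_suminf sm) (use X in auto)
      finally show ?thesis .
    qed
    have "F = ?A \<union> ?B \<union> ?Z" by auto
    then have "(\<Sum>n\<in>F. W (-p) n) = (\<Sum>n\<in>?A \<union> ?B \<union> ?Z. W (-p) n)" by simp
    also have "\<dots> = (\<Sum>n\<in>?A. W (-p) n) + (\<Sum>n\<in>?B. W (-p) n) + (\<Sum>n\<in>?Z. W (-p) n)"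
      using F by (subst sum.union_disjoint; (subst sum.union_disjoint)?) auto
    also have "(\<Sum>n\<in>?A. W (-p) n) \<le> (\<Sum>n. real n powr (-p))"
      by (rule half) (use F in \<open>auto simp: inj_on_def\<close>)
    also have "(\<Sum>n\<in>?B. W (-p) n) \<le> (\<Sum>n. real n powr (-p))"
      by (rule half) (use F in \<open>auto simp: inj_on_def\<close>)
    also have "(\<Sum>n\<in>?Z. W (-p) n) \<le> (\<Sum>n\<in>{0}. W (-p) n)"
      by (rule sum_mono2) auto
    finally show ?thesis by (simp add: C_def W_def)
  qed
  then show ?thesis using that[of C] nn by (simp add: C_def)
qed


section \<open>Square summable kernels\<close>

definition SS :: "int \<Rightarrow> int \<Rightarrow> int \<Rightarrow> int" where
  "SS a b d = a\<^sup>2 + b\<^sup>2 + d\<^sup>2 + (a + b + d)\<^sup>2"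

definition PP :: "int \<Rightarrow> int \<Rightarrow> int \<Rightarrow> int" where
  "PP a b d = (a + b) * (b + d) * (d + a)"

lemma SS_pairs: "SS a b d = (a + b)\<^sup>2 + (b + d)\<^sup>2 + (d + a)\<^sup>2"
  by (simp add: SS_def power2_eq_square algebra_simps)

lemma SS_nonneg: "SS a b d \<ge> 0"
  by (simp add: SS_def)

lemma SS_ge_1: "PP a b d \<noteq> 0 \<Longrightarrow> SS a b d \<ge> 1"
proof -
  assume "PP a b d \<noteq> 0"
  then have "(a + b)\<^sup>2 > 0" by (auto simp: PP_def)
  moreover have "(b + d)\<^sup>2 \<ge> 0" "(d + a)\<^sup>2 \<ge> 0" by simp_all
  ultimately show ?thesis unfolding SS_pairs by linarith
qed

text \<open>This is what makes \<open>H^s\<close> an algebra. By \<open>W_add3\<close> the output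
  weight cancels one input weight, and the two others are square summable because 2s > 1; on a fibre
  any two of the three frequencies fix the third.\<close>

lemma kernel_W:
  assumes "s > 1/2"
  obtains A where "kernel_bound (\<lambda>a b d. W s (a+b+d) / (W s a * W s b * W s d)) A"
proof -
  obtain C where C: "C \<ge> 1" "\<And>F. finite F \<Longrightarrow> (\<Sum>n\<in>F. W (-(2 * s)) n) \<le> C"
    using W_sum_bounded[of "2 * s"] assms by auto
  let ?h = "\<lambda>n. W (-(2 * s)) n"
  let ?K = "3 * (3 powr s)\<^sup>2"
  have pt: "(W s (a+b+d) / (W s a * W s b * W s d))\<^sup>2 \<le> ?K * (?h b * ?h d + ?h a * ?h d + ?h a * ?h b)"
    for a b d
  proof -
    let ?x = "W s a" let ?y = "W s b" let ?z = "W s d"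
    have h: "?h n = 1 / (W s n)\<^sup>2" for n
      by (simp add: W_inverse power2_eq_square W_mult)
    have "(W s (a+b+d))\<^sup>2 \<le> (3 powr s * (?x + ?y + ?z))\<^sup>2"
      using W_add3[of s a b d] assms by (intro power_mono) auto
    also have "\<dots> = (3 powr s)\<^sup>2 * (?x + ?y + ?z)\<^sup>2" by (simp add: power_mult_distrib)
    also have "\<dots> \<le> (3 powr s)\<^sup>2 * (3 * (?x\<^sup>2 + ?y\<^sup>2 + ?z\<^sup>2))"
    proof (intro mult_left_mono)
      have "0 \<le> (?x - ?y)\<^sup>2 + (?y - ?z)\<^sup>2 + (?z - ?x)\<^sup>2" by simp
      then show "(?x + ?y + ?z)\<^sup>2 \<le> 3 * (?x\<^sup>2 + ?y\<^sup>2 + ?z\<^sup>2)"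
        by (simp add: power2_eq_square algebra_simps)
    qed simp
    finally have le: "(W s (a+b+d))\<^sup>2 \<le> ?K * (?x\<^sup>2 + ?y\<^sup>2 + ?z\<^sup>2)" by (simp only: mult_ac)
    have pos: "?x > 0" "?y > 0" "?z > 0" by (simp_all add: W_pos)
    have "(W s (a+b+d) / (?x * ?y * ?z))\<^sup>2 \<le> ?K * (?x\<^sup>2 + ?y\<^sup>2 + ?z\<^sup>2) / (?x * ?y * ?z)\<^sup>2"
      unfolding power_divide by (intro divide_right_mono le) simp
    also have "\<dots> = ?K * (?h b * ?h d + ?h a * ?h d + ?h a * ?h b)"
      unfolding h using pos by (simp add: field_simps)
    finally show ?thesis .
  qed
  have "(\<Sum>(k,j)\<in>G. (W s (k+j+(n-k-j)) / (W s k * W s j * W s (n-k-j)))\<^sup>2) \<le> ?K * 3 * C\<^sup>2"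
    if G: "finite G" for n G
  proof -
    have "(\<Sum>(k,j)\<in>G. (W s (k+j+(n-k-j)) / (W s k * W s j * W s (n-k-j)))\<^sup>2) \<le>
       (\<Sum>x\<in>G. ?K * (?h (snd x) * ?h (n - fst x - snd x) + ?h (fst x) * ?h (n - fst x - snd x) + ?h (fst x) * ?h (snd x)))"
    proof (rule sum_mono, clarify)
      fix k j
      show "(W s (k+j+(n-k-j)) / (W s k * W s j * W s (n-k-j)))\<^sup>2 \<le> ?K * (?h (snd (k,j)) * ?h (n - fst (k,j) - snd (k,j))
          + ?h (fst (k,j)) * ?h (n - fst (k,j) - snd (k,j)) + ?h (fst (k,j)) * ?h (snd (k,j)))"
        using pt[of k j "n-k-j"] by simp
    qed
    also have "\<dots> = ?K * ((\<Sum>x\<in>G. ?h (snd x) * ?h (n - fst x - snd x))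
        + (\<Sum>x\<in>G. ?h (fst x) * ?h (n - fst x - snd x)) + (\<Sum>x\<in>G. ?h (fst x) * ?h (snd x)))"
      by (simp add: sum_distrib_left[symmetric] sum.distrib)
    also have "\<dots> \<le> ?K * (C\<^sup>2 + C\<^sup>2 + C\<^sup>2)"
      by (intro mult_left_mono add_mono sum_pair_inj C(2) G) (auto simp: inj_on_def)
    finally show ?thesis by (simp add: mult_ac)
  qed
  then have "kernel_bound (\<lambda>a b d. W s (a+b+d) / (W s a * W s b * W s d)) (sqrt (?K * 3 * C\<^sup>2))"
    unfolding kernel_bound_def using C(1) by auto
  then show ?thesis using that by blast
qed

text \<open>Since \<open>SS\<close> is the sum of the squares of the three pair sums and
  \<open>PP\<close> their product, \<open>SS / PP^2\<close> is a sum of products of two inverse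
  squares of pair sums. On a fibre a pair sum is \<open>n\<close> minus the remaining frequency, so
  any two of them determine the point. Where \<open>PP = 0\<close> the quotient is 0 by the
  convention for division.\<close>

lemma kernel_PP:
  obtains A where "kernel_bound (\<lambda>a b d. sqrt (SS a b d) / \<bar>PP a b d\<bar>) A"
proof -
  obtain C where C: "C \<ge> 1" "\<And>F. finite F \<Longrightarrow> (\<Sum>n\<in>F. W (-2) n) \<le> C"
    using W_sum_bounded[of 2] by auto
  let ?h = "\<lambda>n::int. 1 / (real_of_int n)\<^sup>2"
  have hC: "sum ?h F \<le> 2 * C" if "finite F" for F
  proof -
    have "sum ?h F \<le> (\<Sum>n\<in>F. 2 * W (-2) n)"
    proof (rule sum_mono)
      fix n :: int
      show "?h n \<le> 2 * W (-2) n"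
      proof (cases "n = 0")
        case False
        then have "(real_of_int n)\<^sup>2 \<ge> 1"
          by (metis of_int_1_le_iff of_int_power int_one_le_iff_zero_less zero_less_power2)
        moreover have "1 / x \<le> 2 / (1 + x)" if "x \<ge> 1" for x :: real
          using that by (simp add: field_simps)
        ultimately show ?thesis using W_inverse[of 2 n] by (simp add: W_2)
      qed simp
    qed
    also have "\<dots> \<le> 2 * C" using C(2)[OF that] by (simp add: sum_distrib_left[symmetric])
    finally show ?thesis .
  qed
  have pt: "(sqrt (SS a b d) / \<bar>PP a b d\<bar>)\<^sup>2 \<le> ?h (b+d) * ?h (d+a) + ?h (a+b) * ?h (d+a) + ?h (a+b) * ?h (b+d)"
    for a b d
  proof (cases "PP a b d = 0")
    case False
    then have nz: "real_of_int (a+b) \<noteq> 0" "real_of_int (b+d) \<noteq> 0" "real_of_int (d+a) \<noteq> 0"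
      unfolding PP_def by (auto simp del: of_int_add)
    have "(sqrt (SS a b d) / \<bar>PP a b d\<bar>)\<^sup>2 = real_of_int (SS a b d) / (real_of_int (PP a b d))\<^sup>2"
      using SS_nonneg[of a b d] by (simp add: power_divide)
    also have "\<dots> = ((real_of_int (a+b))\<^sup>2 + (real_of_int (b+d))\<^sup>2 + (real_of_int (d+a))\<^sup>2)
        / ((real_of_int (a+b))\<^sup>2 * (real_of_int (b+d))\<^sup>2 * (real_of_int (d+a))\<^sup>2)"
      by (simp add: SS_pairs PP_def power_mult_distrib)
    also have "\<dots> = ?h (b+d) * ?h (d+a) + ?h (a+b) * ?h (d+a) + ?h (a+b) * ?h (b+d)"
      using nz by (simp add: field_simps del: of_int_add)
    finally show ?thesis by simp
  qed simp
  have "(\<Sum>(k,j)\<in>G. (sqrt (SS k j (n-k-j)) / \<bar>PP k j (n-k-j)\<bar>)\<^sup>2) \<le> 3 * (2*C)\<^sup>2"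
    if G: "finite G" for n G
  proof -
    have "(\<Sum>(k,j)\<in>G. (sqrt (SS k j (n-k-j)) / \<bar>PP k j (n-k-j)\<bar>)\<^sup>2) \<le>
       (\<Sum>x\<in>G. ?h (n - fst x) * ?h (n - snd x) + ?h (fst x + snd x) * ?h (n - snd x) + ?h (fst x + snd x) * ?h (n - fst x))"
    proof (rule sum_mono, clarify)
      fix k j
      show "(sqrt (SS k j (n-k-j)) / \<bar>PP k j (n-k-j)\<bar>)\<^sup>2 \<le>
        ?h (n - fst (k,j)) * ?h (n - snd (k,j)) + ?h (fst (k,j) + snd (k,j)) * ?h (n - snd (k,j)) + ?h (fst (k,j) + snd (k,j)) * ?h (n - fst (k,j))"
        using pt[of k j "n-k-j"] by (simp add: algebra_simps)
    qed
    also have "\<dots> \<le> (2*C)\<^sup>2 + (2*C)\<^sup>2 + (2*C)\<^sup>2"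
      unfolding sum.distrib
      by (intro add_mono sum_pair_inj[where h = ?h] hC G) (auto simp: inj_on_def)
    finally show ?thesis by simp
  qed
  then have "kernel_bound (\<lambda>a b d. sqrt (SS a b d) / \<bar>PP a b d\<bar>) (sqrt (3 * (2*C)\<^sup>2))"
    unfolding kernel_bound_def using C(1) by auto
  then show ?thesis using that by blast
qed

lemma l1_le:
  assumes "\<And>F. finite F \<Longrightarrow> (\<Sum>n\<in>F. W (-(2 * s)) n) \<le> C"
    and "l2b (\<lambda>n. W s n * f n) B" "finite F"
  shows "(\<Sum>n\<in>F. \<bar>f n\<bar>) \<le> sqrt C * B"
proof -
  have "(\<Sum>n\<in>F. \<bar>f n\<bar>) = (\<Sum>n\<in>F. \<bar>W (-s) n\<bar> * \<bar>W s n * f n\<bar>)"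
    by (rule sum.cong) (auto simp: abs_mult mult.assoc[symmetric] W_mult)
  also have "\<dots> \<le> L2_set (W (-s)) F * L2_set (\<lambda>n. W s n * f n) F"
    by (rule L2_set_mult_ineq)
  also have "\<dots> \<le> sqrt C * B"
  proof (intro mult_mono l2bD[OF assms(2,3)])
    show "L2_set (W (-s)) F \<le> sqrt C"
      using assms(1)[OF assms(3)] by (simp add: L2_set_def power2_eq_square W_mult)
    show "0 \<le> sqrt C" using assms(1)[of "{}"] by simp
  qed simp
  finally show ?thesis .
qed

text \<open>A Riemann sum at scale \<open>L\<close>: integers are grouped into blocks of length
  about \<open>L\<close>, on which the summand is comparable to a weight of the block number. Linear
  growth in \<open>L\<close> is what \<open>interpolation\<close> needs.\<close>

lemma scaled_weight_sum:
  assumes "p > 1"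
  obtains C where "C \<ge> 1"
    "\<And>F L. finite F \<Longrightarrow> L \<ge> 1 \<Longrightarrow> (\<Sum>n\<in>F. 1 / (1 + (W 1 n / L) powr p)) \<le> C * L"
proof -
  obtain C where C: "C \<ge> 1" "\<And>F. finite F \<Longrightarrow> (\<Sum>n\<in>F. W (-p) n) \<le> C"
    using W_sum_bounded[OF assms] by auto
  let ?D = "2 powr (p/2)"
  have D1: "?D \<ge> 1" using assms by (simp add: ge_one_powr_ge_zero)
  have main: "(\<Sum>n\<in>F. 1 / (1 + (W 1 n / L) powr p)) \<le> (4 * ?D * C) * L" if F: "finite F" and L: "L \<ge> 1" for F L
  proof -
    define l where "l = \<lceil>L\<rceil>"
    have l: "l \<ge> 1" "real_of_int l \<ge> L" "real_of_int l \<le> 2 * L"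
      using L unfolding l_def by linarith+
    \<comment> \<open>The number of the block of length \<open>l\<close> that contains the absolute
      value of \<open>n\<close>.\<close>
    define g where "g n = \<bar>n\<bar> div l" for n :: int
    have pt: "1 / (1 + (W 1 n / L) powr p) \<le> ?D * W (-p) (g n)" for n
    proof -
      have g0: "g n \<ge> 0" using l unfolding g_def by (simp add: pos_imp_zdiv_nonneg_iff)
      have "g n * l \<le> \<bar>n\<bar>" unfolding g_def using l
        using div_mult_mod_eq[of "\<bar>n\<bar>" l] pos_mod_sign[of l "\<bar>n\<bar>"] by linarith
      then have "real_of_int (g n) * real_of_int l \<le> \<bar>real_of_int n\<bar>"
        by (metis of_int_abs of_int_le_iff of_int_mult)
      then have "real_of_int (g n) * L \<le> W 1 n"
        using W_1_ge[of n] mult_left_mono[OF l(2), of "real_of_int (g n)"] g0 by linarith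
      then have "real_of_int (g n) \<le> W 1 n / L" using L by (simp add: field_simps)
      then have "real_of_int (g n) powr p \<le> (W 1 n / L) powr p"
        using assms g0 by (intro powr_mono2) auto
      moreover have "W p (g n) \<le> ?D * (1 + real_of_int (g n) powr p)"
      proof (cases "g n = 0")
        case True then show ?thesis using assms D1 by (simp add: W_def)
      next
        case False
        then have "real_of_int (g n) \<ge> 1" using g0 by simp
        then have "1 + (real_of_int (g n))\<^sup>2 \<le> 2 * (real_of_int (g n))\<^sup>2" by simp
        then have "W p (g n) \<le> (2 * (real_of_int (g n))\<^sup>2) powr (p/2)"
          unfolding W_def using assms by (intro powr_mono2) auto
        also have "\<dots> = ?D * ((real_of_int (g n))\<^sup>2) powr (p/2)" by (simp add: powr_mult)
        also have "(real_of_int (g n))\<^sup>2 = real_of_int (g n) powr 2"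
          using \<open>real_of_int (g n) \<ge> 1\<close> by simp
        also have "(real_of_int (g n) powr 2) powr (p/2) = real_of_int (g n) powr p"
          by (subst powr_powr) simp
        finally show ?thesis by (smt (verit) D1 mult_left_mono)
      qed
      ultimately have "W p (g n) \<le> ?D * (1 + (W 1 n / L) powr p)"
        using D1 by (smt (verit) mult_left_mono)
      moreover have "1 + (W 1 n / L) powr p > 0" by (simp add: add_pos_nonneg)
      ultimately show ?thesis using W_pos[of p "g n"] by (simp add: W_inverse field_simps)
    qed
    \<comment> \<open>One block of length \<open>l\<close> for each sign.\<close>
    have card: "card {n\<in>F. g n = m} \<le> 2 * nat l" for m
    proof -
      have "{n\<in>F. g n = m} \<subseteq> {m*l..<m*l+l} \<union> {-(m*l+l)<..-(m*l)}"
      proof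
        fix n assume "n \<in> {n\<in>F. g n = m}"
        then have "\<bar>n\<bar> div l = m" by (simp add: g_def)
        then have "\<bar>n\<bar> = m * l + \<bar>n\<bar> mod l" by (metis div_mult_mod_eq)
        moreover have "0 \<le> \<bar>n\<bar> mod l" "\<bar>n\<bar> mod l < l" using l by auto
        ultimately show "n \<in> {m*l..<m*l+l} \<union> {-(m*l+l)<..-(m*l)}" by (auto simp: abs_if split: if_splits)
      qed
      then have "card {n\<in>F. g n = m} \<le> card ({m*l..<m*l+l} \<union> {-(m*l+l)<..-(m*l)})"
        by (intro card_mono) auto
      also have "\<dots> \<le> card {m*l..<m*l+l} + card {-(m*l+l)<..-(m*l)}" by (rule card_Un_le)
      finally show ?thesis using l by simp
    qed
    have "(\<Sum>n\<in>F. 1 / (1 + (W 1 n / L) powr p)) \<le> (\<Sum>n\<in>F. ?D * W (-p) (g n))"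
      by (intro sum_mono pt)
    also have "\<dots> = (\<Sum>m\<in>g ` F. \<Sum>n\<in>{n\<in>F. g n = m}. ?D * W (-p) (g n))"
      by (rule sum.image_gen[OF F])
    also have "\<dots> = (\<Sum>m\<in>g ` F. real (card {n\<in>F. g n = m}) * (?D * W (-p) m))"
      by (intro sum.cong refl) simp
    also have "\<dots> \<le> (\<Sum>m\<in>g ` F. real (2 * nat l) * (?D * W (-p) m))"
    proof (intro sum_mono mult_right_mono)
      fix m
      show "real (card {n\<in>F. g n = m}) \<le> real (2 * nat l)" using card[of m] by (simp only: of_nat_le_iff)
      show "0 \<le> ?D * W (-p) m" using D1 by (intro mult_nonneg_nonneg) auto
    qed
    also have "\<dots> = real (2 * nat l) * ?D * (\<Sum>m\<in>g ` F. W (-p) m)"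
      by (subst sum_distrib_left) (simp add: mult_ac)
    also have "\<dots> \<le> (4 * L) * ?D * C"
      by (intro mult_mono C) (use l F L C in \<open>auto intro: sum_nonneg\<close>)
    finally show ?thesis by (simp add: mult_ac)
  qed
  show ?thesis
    by (rule that[OF _ main]) (use D1 C(1) in \<open>auto intro!: mult_ge1_I[of "4::real"] mult_ge1_I\<close>)
qed

section \<open>Trilinear operators on $H^s$\<close>

text \<open>The third frequency is determined by \<open>n\<close>, so \<open>D n\<close> lists pairs
  only. Finite domains allow termwise differentiation; three separate arguments allow one factor to
  be replaced by its derivative or by a difference.\<close>

definition tri :: "(int \<Rightarrow> (int \<times> int) set) \<Rightarrow> (int \<Rightarrow> int \<Rightarrow> int \<Rightarrow> complex)
    \<Rightarrow> (int \<Rightarrow> complex) \<Rightarrow> (int \<Rightarrow> complex) \<Rightarrow> (int \<Rightarrow> complex) \<Rightarrow> int \<Rightarrow> complex" where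
  "tri D M x y z n = (\<Sum>(k,j)\<in>D n. M k j (n-k-j) * x k * y j * z (n-k-j))"

abbreviation hs_b :: "real \<Rightarrow> (int \<Rightarrow> complex) \<Rightarrow> real \<Rightarrow> bool" where
  "hs_b s x B \<equiv> l2b (\<lambda>n. W s n * cmod (x n)) B"

lemma hs_b_le: "hs_b s x B \<Longrightarrow> W s n * cmod (x n) \<le> B"
  using l2b_abs_le[of "\<lambda>n. W s n * cmod (x n)" B n] by simp

lemma hs_b_cmod_le: "s \<ge> 0 \<Longrightarrow> hs_b s x B \<Longrightarrow> cmod (x n) \<le> B"
  using hs_b_le[of s x B n] mult_right_mono[OF W_ge_1[of s n], of "cmod (x n)"] by simp

lemma hs_b_mono: "hs_b s y B \<Longrightarrow> (\<And>n. cmod (x n) \<le> cmod (y n)) \<Longrightarrow> hs_b s x B"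
  by (rule l2b_mono, assumption) (simp add: abs_mult mult_left_mono)

lemma hs_b_add:
  assumes "hs_b s x A" "hs_b s y B" "\<And>n. cmod (z n) \<le> cmod (x n) + cmod (y n)"
  shows "hs_b s z (A + B)"
  by (rule l2b_add_le[OF assms(1,2)])
     (use assms(3) in \<open>simp add: abs_mult distrib_left[symmetric] mult_left_mono\<close>)

lemma hs_b_cmult:
  assumes "hs_b s x B" "0 \<le> c" "\<And>n. cmod (y n) \<le> c * cmod (x n)"
  shows "hs_b s y (c * B)"
  by (rule l2b_cmult_le[OF assms(1,2)])
     (use assms(3) in \<open>simp add: abs_mult mult.left_commute[of c] mult_left_mono\<close>)

lemma hs_b_triangle: "hs_b s x A \<Longrightarrow> hs_b s y B \<Longrightarrow> hs_b s (\<lambda>n. x n + y n) (A + B)"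
  by (rule hs_b_add) (auto intro: norm_triangle_ineq)

lemma hs_b_diff: "hs_b s x A \<Longrightarrow> hs_b s y B \<Longrightarrow> hs_b s (\<lambda>n. x n - y n) (A + B)"
  by (rule hs_b_add) (auto intro: norm_triangle_ineq4)

lemma hs_b_zero: "hs_b s (\<lambda>n. 0) 0"
  by (rule l2bI_sq) auto

lemma hs_b_lim:
  assumes "\<And>n. (\<lambda>k. x k n) \<longlonglongrightarrow> y n" "\<And>k. hs_b s (x k) B"
  shows "hs_b s y B"
  by (rule l2b_lim[where f = "\<lambda>k n. W s n * cmod (x k n)"]) (auto intro!: tendsto_intros assms)

text \<open>Only the supremum of the multiplier enters, and the bound does not see the domain
  \<open>D\<close>. This makes all later estimates uniform in the size of the box.\<close>

lemma tri_est:
  assumes m: "kernel_bound (\<lambda>a b d. W s (a+b+d) / (W s a * W s b * W s d)) A"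
    and D: "\<And>n. finite (D n)"
    and M: "\<And>n k j. (k,j) \<in> D n \<Longrightarrow> cmod (M k j (n-k-j)) \<le> \<mu>" "\<mu> \<ge> 0"
    and "hs_b s x X" "hs_b s y Y" "hs_b s z Z"
  shows "hs_b s (tri D M x y z) (\<mu> * (A * X * Y * Z))"
proof -
  let ?f = "\<lambda>x n. W s n * cmod (x n)"
  have b: "l2b (\<lambda>n. \<Sum>(k,j)\<in>D n. \<bar>W s (k+j+(n-k-j)) / (W s k * W s j * W s (n-k-j))\<bar>
      * \<bar>?f x k\<bar> * \<bar>?f y j\<bar> * \<bar>?f z (n-k-j)\<bar>) (A * X * Y * Z)"
    by (rule tri_l2b[OF m D]) fact+
  show ?thesis
  proof (rule l2b_cmult_le[OF b M(2)])
    fix n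
    have "cmod (tri D M x y z n) \<le> (\<Sum>(k,j)\<in>D n. \<mu> * (cmod (x k) * cmod (y j) * cmod (z (n-k-j))))"
      unfolding tri_def
    proof (rule sum_norm_le, clarify)
      fix k j assume "(k,j) \<in> D n"
      from M(1)[OF this]
      have "cmod (M k j (n-k-j)) * (cmod (x k) * cmod (y j) * cmod (z (n-k-j)))
          \<le> \<mu> * (cmod (x k) * cmod (y j) * cmod (z (n-k-j)))" by (intro mult_right_mono) auto
      then show "cmod (M k j (n-k-j) * x k * y j * z (n-k-j)) \<le> \<mu> * (cmod (x k) * cmod (y j) * cmod (z (n-k-j)))"
        by (simp add: norm_mult mult.assoc)
    qed
    then have "W s n * cmod (tri D M x y z n)
        \<le> W s n * (\<Sum>(k,j)\<in>D n. \<mu> * (cmod (x k) * cmod (y j) * cmod (z (n-k-j))))"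
      by (rule mult_left_mono) simp
    also have "\<dots> = \<mu> * (\<Sum>(k,j)\<in>D n. \<bar>W s (k+j+(n-k-j)) / (W s k * W s j * W s (n-k-j))\<bar>
      * \<bar>?f x k\<bar> * \<bar>?f y j\<bar> * \<bar>?f z (n-k-j)\<bar>)"
      unfolding sum_distrib_left
    proof (rule sum.cong[OF refl], clarify)
      fix k j
      have "W s k \<noteq> 0" "W s j \<noteq> 0" "W s (n-k-j) \<noteq> 0"
        using W_pos[of s k] W_pos[of s j] W_pos[of s "n-k-j"] by simp_all
      then show "W s n * (\<mu> * (cmod (x k) * cmod (y j) * cmod (z (n-k-j)))) =
        \<mu> * (\<bar>W s (k+j+(n-k-j)) / (W s k * W s j * W s (n-k-j))\<bar> * \<bar>?f x k\<bar> * \<bar>?f y j\<bar> * \<bar>?f z (n-k-j)\<bar>)"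
        by (simp add: abs_mult field_simps)
    qed
    finally show "\<bar>?f (tri D M x y z) n\<bar> \<le> \<mu> * \<bar>\<Sum>(k,j)\<in>D n. \<bar>W s (k+j+(n-k-j)) / (W s k * W s j * W s (n-k-j))\<bar>
      * \<bar>?f x k\<bar> * \<bar>?f y j\<bar> * \<bar>?f z (n-k-j)\<bar>\<bar>"
      by (subst (2) abs_of_nonneg) (auto intro!: sum_nonneg)
  qed
qed

lemma tri_diff:
  "tri D M x y z n - tri D M x' y' z' n =
   tri D M (\<lambda>n. x n - x' n) y z n + tri D M x' (\<lambda>n. y n - y' n) z n + tri D M x' y' (\<lambda>n. z n - z' n) n"
  unfolding tri_def sum_subtractf[symmetric] sum.distrib[symmetric]
  by (rule sum.cong) (auto simp: algebra_simps)

lemma tri_diff_est: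
  assumes m: "kernel_bound (\<lambda>a b d. W s (a+b+d) / (W s a * W s b * W s d)) A"
    and D: "\<And>n. finite (D n)"
    and M: "\<And>n k j. (k,j) \<in> D n \<Longrightarrow> cmod (M k j (n-k-j)) \<le> \<mu>" "\<mu> \<ge> 0"
    and x: "hs_b s x X" "hs_b s x' X" "hs_b s (\<lambda>n. x n - x' n) X'"
    and y: "hs_b s y Y" "hs_b s y' Y" "hs_b s (\<lambda>n. y n - y' n) Y'"
    and z: "hs_b s z Z" "hs_b s z' Z" "hs_b s (\<lambda>n. z n - z' n) Z'"
  shows "hs_b s (\<lambda>n. tri D M x y z n - tri D M x' y' z' n) (\<mu> * (A * X' * Y * Z) + \<mu> * (A * X * Y' * Z) + \<mu> * (A * X * Y * Z'))"
proof -
  note E = tri_est[where D = D and M = M, OF m D M]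
  show ?thesis unfolding tri_diff by (intro hs_b_triangle E x y z)
qed

lemma has_vector_derivative_cis:
  "((\<lambda>t. cis (- (t * \<phi>))) has_vector_derivative (- \<i> * of_real \<phi> * cis (- (t * \<phi>)))) (at t within S)"
proof -
  have "((\<lambda>z. exp (- \<i> * of_real \<phi> * z)) has_field_derivative (exp (- \<i> * of_real \<phi> * of_real t) * (- \<i> * of_real \<phi>))) (at (of_real t))"
    by (auto intro!: derivative_eq_intros)
  from has_vector_derivative_real_field[OF this, of S]
  show ?thesis by (simp add: cis_conv_exp mult_ac)
qed

lemma has_vector_derivative_term:
  assumes "(x has_vector_derivative x') (at t within S)"
    "(y has_vector_derivative y') (at t within S)" "(z has_vector_derivative z') (at t within S)"
  shows "((\<lambda>t. C * cis (- (t * \<phi>)) * x t * y t * z t :: complex) has_vector_derivative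
    (C * (- \<i> * of_real \<phi>) * cis (- (t * \<phi>)) * x t * y t * z t
     + C * cis (- (t * \<phi>)) * x' * y t * z t + C * cis (- (t * \<phi>)) * x t * y' * z t
     + C * cis (- (t * \<phi>)) * x t * y t * z')) (at t within S)"
proof -
  have "((\<lambda>t. C * cis (- (t * \<phi>))) has_vector_derivative (C * (- \<i> * of_real \<phi> * cis (- (t * \<phi>))))) (at t within S)"
    by (rule has_vector_derivative_mult_right[OF has_vector_derivative_cis])
  from has_vector_derivative_mult[OF has_vector_derivative_mult[OF has_vector_derivative_mult[OF this assms(1)] assms(2)] assms(3)]
  show ?thesis by (rule has_vector_derivative_eq_rhs) (simp add: algebra_simps)
qed

lemma tri_has_vector_derivative:
  assumes "finite (D n)" "\<And>n. ((\<lambda>t. x t n) has_vector_derivative x' n) (at t within S)"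
  shows "((\<lambda>t. tri D (\<lambda>a b d. C a b d * cis (- (t * \<phi> a b d))) (x t) (x t) (x t) n) has_vector_derivative
    (tri D (\<lambda>a b d. C a b d * (- \<i> * of_real (\<phi> a b d)) * cis (- (t * \<phi> a b d))) (x t) (x t) (x t) n
     + tri D (\<lambda>a b d. C a b d * cis (- (t * \<phi> a b d))) x' (x t) (x t) n
     + tri D (\<lambda>a b d. C a b d * cis (- (t * \<phi> a b d))) (x t) x' (x t) n
     + tri D (\<lambda>a b d. C a b d * cis (- (t * \<phi> a b d))) (x t) (x t) x' n)) (at t within S)"
  unfolding tri_def sum.distrib[symmetric] case_prod_unfold
  by (rule has_vector_derivative_sum, rule has_vector_derivative_term) (rule assms)+

text \<open>The scalar mean value theorem is applied to the inner product of \<open>f t\<close> with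
  the fixed vector \<open>f b - f a\<close>; Cauchy-Schwarz then cancels one power of its norm. No
  integrability of the derivative is involved.\<close>

lemma l2_mean_value:
  fixes f :: "real \<Rightarrow> int \<Rightarrow> complex"
  assumes "finite F" "a \<le> b"
    and der: "\<And>n t. n \<in> F \<Longrightarrow> t \<in> {a..b} \<Longrightarrow> ((\<lambda>t. f t n) has_vector_derivative f' t n) (at t within {a..b})"
    and B: "\<And>t. t \<in> {a..b} \<Longrightarrow> L2_set (\<lambda>n. w n * cmod (f' t n)) F \<le> B"
  shows "L2_set (\<lambda>n. w n * cmod (f b n - f a n)) F \<le> (b - a) * B"
proof -
  define d where "d n = f b n - f a n" for n
  define D where "D = L2_set (\<lambda>n. w n * cmod (d n)) F"
  define g where "g t = (\<Sum>n\<in>F. (w n)\<^sup>2 * Re (cnj (d n) * f t n))" for t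
  define g' where "g' t = (\<Sum>n\<in>F. (w n)\<^sup>2 * Re (cnj (d n) * f' t n))" for t
  have "(g has_derivative (\<lambda>h. h * g' t)) (at t within {a..b})" if t: "a \<le> t" "t \<le> b" for t
  proof -
    have "(g has_vector_derivative g' t) (at t within {a..b})"
      unfolding g_def[abs_def] g'_def
      by (rule has_vector_derivative_sum, rule has_vector_derivative_mult_right,
          rule bounded_linear.has_vector_derivative[OF bounded_linear_Re],
          rule has_vector_derivative_mult_right, rule der) (use t in auto)
    then show ?thesis unfolding has_vector_derivative_def by simp
  qed
  from mvt_very_simple[OF \<open>a \<le> b\<close> this] obtain t where t: "t \<in> {a..b}" "g b - g a = (b - a) * g' t"
    by auto
  have "g b - g a = (\<Sum>n\<in>F. (w n * cmod (d n))\<^sup>2)"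
    unfolding g_def sum_subtractf[symmetric]
  proof (rule sum.cong[OF refl])
    fix n assume "n \<in> F"
    have "Re (cnj (d n) * f b n) - Re (cnj (d n) * f a n) = Re (cnj (d n) * d n)"
      by (simp add: d_def algebra_simps)
    also have "\<dots> = (cmod (d n))\<^sup>2" by (simp add: cmod_power2) (simp add: power2_eq_square)
    finally show "(w n)\<^sup>2 * Re (cnj (d n) * f b n) - (w n)\<^sup>2 * Re (cnj (d n) * f a n) = (w n * cmod (d n))\<^sup>2"
      by (simp add: power_mult_distrib right_diff_distrib[symmetric])
  qed
  also have "\<dots> = D\<^sup>2" by (simp add: D_def L2_set_def sum_nonneg)
  finally have D2: "D\<^sup>2 = (b - a) * g' t" using t by simp
  have "g' t \<le> (\<Sum>n\<in>F. \<bar>w n * cmod (d n)\<bar> * \<bar>w n * cmod (f' t n)\<bar>)"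
    unfolding g'_def
  proof (rule sum_mono)
    fix n
    have "Re (cnj (d n) * f' t n) \<le> cmod (d n) * cmod (f' t n)"
      using complex_Re_le_cmod[of "cnj (d n) * f' t n"] by (simp add: norm_mult)
    then have "(w n)\<^sup>2 * Re (cnj (d n) * f' t n) \<le> (w n)\<^sup>2 * (cmod (d n) * cmod (f' t n))"
      by (rule mult_left_mono) simp
    also have "\<dots> = \<bar>w n * cmod (d n)\<bar> * \<bar>w n * cmod (f' t n)\<bar>"
      by (simp add: abs_mult power2_eq_square mult_ac)
    finally show "(w n)\<^sup>2 * Re (cnj (d n) * f' t n) \<le> \<bar>w n * cmod (d n)\<bar> * \<bar>w n * cmod (f' t n)\<bar>" .
  qed
  also have "\<dots> \<le> D * L2_set (\<lambda>n. w n * cmod (f' t n)) F" unfolding D_def by (rule L2_set_mult_ineq)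
  also have "\<dots> \<le> D * B" by (intro mult_left_mono B t) (simp add: D_def)
  finally have "D * D \<le> (b - a) * (D * B)"
    using D2 \<open>a \<le> b\<close> by (simp add: power2_eq_square mult_left_mono)
  then have "D * D \<le> ((b - a) * B) * D" by (simp add: mult_ac)
  moreover have "D \<ge> 0" "B \<ge> 0"
    using order_trans[OF L2_set_nonneg B[OF t(1)]] by (auto simp: D_def)
  ultimately have "D \<le> (b - a) * B" using \<open>a \<le> b\<close> by (cases "D = 0") auto
  then show ?thesis by (simp add: D_def d_def)
qed


text \<open>\<open>c\<close> stands for \<mu>/3 times the two factors 1/(2 pi) of the convolutions,
  hence \<mu> is \<open>12 * pi\<^sup>2 * c\<close> below. \<open>A\<close> is the constant supplied
  by \<open>kernel_W\<close>.\<close>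

locale mkaw =
  fixes \<beta> \<gamma> c s A :: real
  assumes beta: "\<beta> \<ge> 0" and s: "s > 1/2"
    and ker: "kernel_bound (\<lambda>a b d. W s (a+b+d) / (W s a * W s b * W s d)) A"
begin

lemma A_nonneg: "A \<ge> 0"
  using ker by (simp add: kernel_bound_def)

lemma cmod_le: "hs_b s x B \<Longrightarrow> cmod (x n) \<le> B"
  using hs_b_cmod_le[of s x B n] s by simp

section \<open>The resonance function and the multipliers divided by it\<close>

definition Phi :: "int \<Rightarrow> int \<Rightarrow> int \<Rightarrow> real" where
  "Phi a b d = phase \<beta> \<gamma> (a+b+d) - phase \<beta> \<gamma> a - phase \<beta> \<gamma> b - phase \<beta> \<gamma> d"

lemma Phi_factor: "Phi a b d = real_of_int (PP a b d) * (5/2 * real_of_int (SS a b d) + 3 * \<beta>)"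
proof -
  have "(x+y+z)^5 + \<beta> * (x+y+z)^3 - \<gamma> * (x+y+z) - (x^5 + \<beta> * x^3 - \<gamma> * x)
      - (y^5 + \<beta> * y^3 - \<gamma> * y) - (z^5 + \<beta> * z^3 - \<gamma> * z)
    = (x+y)*(y+z)*(z+x) * (5/2 * (x\<^sup>2 + y\<^sup>2 + z\<^sup>2 + (x+y+z)\<^sup>2) + 3 * \<beta>)" for x y z :: real
    by (simp add: field_simps power2_eq_square power3_eq_cube eval_nat_numeral)
  from this[of "real_of_int a" "real_of_int b" "real_of_int d"]
  show ?thesis by (simp add: Phi_def phase_def PP_def SS_def)
qed

lemma Phi_lower: "5/2 * real_of_int (SS a b d) * \<bar>real_of_int (PP a b d)\<bar> \<le> \<bar>Phi a b d\<bar>"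
proof -
  have "\<bar>Phi a b d\<bar> = \<bar>real_of_int (PP a b d)\<bar> * (5/2 * real_of_int (SS a b d) + 3 * \<beta>)"
    unfolding Phi_factor abs_mult using beta SS_nonneg[of a b d] by simp
  also have "\<dots> \<ge> \<bar>real_of_int (PP a b d)\<bar> * (5/2 * real_of_int (SS a b d))"
    using beta by (intro mult_left_mono) auto
  finally show ?thesis by (simp add: mult_ac)
qed

lemma Phi_ge_SS:
  assumes "PP a b d \<noteq> 0"
  shows "real_of_int (SS a b d) \<le> \<bar>Phi a b d\<bar>" "\<bar>Phi a b d\<bar> > 0"
proof -
  have "\<bar>PP a b d\<bar> \<ge> 1" using assms by linarith
  then have p: "\<bar>real_of_int (PP a b d)\<bar> \<ge> 1" by linarith
  have S: "real_of_int (SS a b d) \<ge> 1" using SS_ge_1[OF assms] by simp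
  have "real_of_int (SS a b d) * 1 \<le> 5/2 * real_of_int (SS a b d) * \<bar>real_of_int (PP a b d)\<bar>"
    using S p by (intro mult_mono) auto
  then show "real_of_int (SS a b d) \<le> \<bar>Phi a b d\<bar>" using Phi_lower[of a b d] by simp
  then show "\<bar>Phi a b d\<bar> > 0" using S by linarith
qed

lemma SS_ge_squares:
  "a\<^sup>2 \<le> SS a b d" "b\<^sup>2 \<le> SS a b d" "d\<^sup>2 \<le> SS a b d" "(a+b+d)\<^sup>2 \<le> SS a b d"
  by (simp_all add: SS_def)

lemma abs_le_sqrt_SS:
  "m\<^sup>2 \<le> SS a b d \<Longrightarrow> \<bar>real_of_int m\<bar> \<le> sqrt (SS a b d)"
  by (rule real_le_rsqrt) (metis of_int_le_iff of_int_power power2_abs)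

text \<open>Each of the two frequencies is at most the root of \<open>SS\<close>, and
  \<open>SS\<close> is at most the resonance function: one division pays for the derivative in the
  nonlinearity and for the one produced by the product rule.\<close>

lemma multiplier_le_1:
  assumes "PP a b d \<noteq> 0" "m\<^sup>2 \<le> SS a b d"
  shows "\<bar>real_of_int (a+b+d) * real_of_int m / Phi a b d\<bar> \<le> 1"
proof -
  have "\<bar>real_of_int (a+b+d)\<bar> * \<bar>real_of_int m\<bar> \<le> sqrt (SS a b d) * sqrt (SS a b d)"
    by (intro mult_mono abs_le_sqrt_SS SS_ge_squares assms) (auto simp: SS_nonneg)
  also have "\<dots> \<le> \<bar>Phi a b d\<bar>" using Phi_ge_SS(1)[OF assms(1)] SS_nonneg[of a b d] by simp
  finally show ?thesis using Phi_ge_SS(2)[OF assms(1)] by (simp add: abs_mult)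
qed

text \<open>Only one derivative has to be paid here, so half of \<open>SS\<close> is left over and
  supplies the factor 1/K.\<close>

lemma multiplier_small:
  assumes "PP a b d \<noteq> 0" "real_of_int (SS a b d) > K\<^sup>2" "K > 0"
  shows "\<bar>real_of_int (a+b+d) / Phi a b d\<bar> \<le> 1 / K"
proof -
  have K: "K \<le> sqrt (SS a b d)" using assms by (intro real_le_rsqrt) auto
  have "\<bar>real_of_int (a+b+d)\<bar> * K \<le> sqrt (SS a b d) * sqrt (SS a b d)"
    using K assms by (intro mult_mono abs_le_sqrt_SS SS_ge_squares) (auto simp: SS_nonneg)
  also have "\<dots> \<le> \<bar>Phi a b d\<bar>" using Phi_ge_SS(1)[OF assms(1)] SS_nonneg[of a b d] by simp
  finally show ?thesis using Phi_ge_SS(2)[OF assms(1)] assms by (simp add: field_simps)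
qed

section \<open>Truncated nonlinearity and gauged solutions\<close>

definition box :: "nat \<Rightarrow> (int \<times> int) set" where
  "box L = {- int L..int L} \<times> {- int L..int L}"

definition Dall :: "nat \<Rightarrow> int \<Rightarrow> (int \<times> int) set" where
  "Dall L n = {(k,j) \<in> box L. PP k j (n-k-j) \<noteq> 0}"

definition Dlo :: "nat \<Rightarrow> real \<Rightarrow> int \<Rightarrow> (int \<times> int) set" where
  "Dlo L K n = {(k,j) \<in> Dall L n. real_of_int (SS k j (n-k-j)) \<le> K\<^sup>2}"

definition Dhi :: "nat \<Rightarrow> real \<Rightarrow> int \<Rightarrow> (int \<times> int) set" where
  "Dhi L K n = {(k,j) \<in> Dall L n. real_of_int (SS k j (n-k-j)) > K\<^sup>2}"

lemma finite_box [simp]: "finite (box L)" by (simp add: box_def)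
lemma finite_Dall [simp]: "finite (Dall L n)"
  by (rule finite_subset[OF _ finite_box[of L]]) (auto simp: Dall_def)
lemma finite_Dlo [simp]: "finite (Dlo L K n)"
  by (rule finite_subset[OF _ finite_Dall[of L n]]) (auto simp: Dlo_def)
lemma finite_Dhi [simp]: "finite (Dhi L K n)"
  by (rule finite_subset[OF _ finite_Dall[of L n]]) (auto simp: Dhi_def)

definition osc :: "real \<Rightarrow> int \<Rightarrow> int \<Rightarrow> int \<Rightarrow> complex" where
  "osc t a b d = cis (- (t * Phi a b d))"

lemma norm_osc [simp]: "cmod (osc t a b d) = 1" by (simp add: osc_def)

text \<open>The subtracted cubic term is what the overlaps of the three resonant families leave over
  once the mass term is gauged away; \<open>resonant_sum\<close> does the count.\<close>

definition GL :: "nat \<Rightarrow> real \<Rightarrow> (int \<Rightarrow> complex) \<Rightarrow> int \<Rightarrow> complex" where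
  "GL L t x n = of_real c * (tri (Dall L) (osc t) x x x n - 3 * of_real ((cmod (x n))\<^sup>2) * x n)"

text \<open>\<open>u\<close> solves the equation obtained from the modified Kawahara equation after removing the linear
  flow and the phase \<open>exp(i n \<theta>(t))\<close>, \<open>\<theta>' = 3 c \<Sum>|u\<^sub>k|\<^sup>2\<close>, that the resonances with
  \<open>PP = 0\<close> produce; \<open>i n G\<close> is the time derivative.\<close>

definition gsol :: "real \<Rightarrow> real \<Rightarrow> (real \<Rightarrow> int \<Rightarrow> complex) \<Rightarrow> (real \<Rightarrow> int \<Rightarrow> complex) \<Rightarrow> bool" where
  "gsol T R u G \<longleftrightarrow> (\<forall>t\<in>{0..T}. hs_b s (u t) R) \<and>
    (\<forall>n. \<forall>t\<in>{0..T}. ((\<lambda>t. u t n) has_vector_derivative (\<i> * of_int n * G t n)) (at t within {0..T})) \<and>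
    (\<forall>n. \<forall>e>0. \<exists>L0. \<forall>L\<ge>L0. \<forall>t\<in>{0..T}. cmod (G t n - GL L t (u t) n) \<le> e)"

lemma cubic_diff:
  fixes a b :: complex
  assumes "cmod a \<le> r" "cmod b \<le> r"
  shows "cmod (of_real ((cmod a)\<^sup>2) * a - of_real ((cmod b)\<^sup>2) * b) \<le> 3 * r\<^sup>2 * cmod (a - b)"
proof -
  have r: "0 \<le> r" using order_trans[OF norm_ge_zero assms(1)] .
  have eq: "of_real ((cmod a)\<^sup>2) * a - of_real ((cmod b)\<^sup>2) * b
    = (a - b) * cnj a * a + b * (cnj a - cnj b) * a + b * cnj b * (a - b)"
    unfolding complex_norm_square by (simp add: algebra_simps)
  have 1: "cmod ((a - b) * cnj a * a) \<le> cmod (a - b) * (r * r)"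
    unfolding norm_mult mult.assoc by (intro mult_left_mono mult_mono) (use assms r in auto)
  have 2: "cmod (b * (cnj a - cnj b) * a) \<le> cmod (a - b) * (r * r)"
  proof -
    have "cmod (b * (cnj a - cnj b) * a) = cmod (a - b) * (cmod b * cmod a)"
      by (simp add: norm_mult complex_cnj_diff[symmetric] del: complex_cnj_diff)
    also have "\<dots> \<le> cmod (a - b) * (r * r)"
      by (intro mult_left_mono mult_mono) (use assms r in auto)
    finally show ?thesis .
  qed
  have 3: "cmod (b * cnj b * (a - b)) \<le> cmod (a - b) * (r * r)"
  proof -
    have "cmod (b * cnj b * (a - b)) = cmod (a - b) * (cmod b * cmod b)"
      by (simp add: norm_mult)
    also have "\<dots> \<le> cmod (a - b) * (r * r)"
      by (intro mult_left_mono mult_mono) (use assms r in auto)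
    finally show ?thesis .
  qed
  show ?thesis unfolding eq
    using norm_triangle_le[OF add_mono[OF norm_triangle_le[OF add_mono[OF 1 2]] 3]]
    by (simp add: power2_eq_square mult_ac)
qed

lemma GL_diff:
  assumes "hs_b s x R" "hs_b s y R" "hs_b s (\<lambda>n. x n - y n) b"
  shows "hs_b s (\<lambda>n. GL L t x n - GL L t y n) (\<bar>c\<bar> * (3 * A + 9) * R\<^sup>2 * b)"
proof -
  have R: "R \<ge> 0" using assms(1) by (rule l2b_nonneg)
  have 1: "hs_b s (\<lambda>n. tri (Dall L) (osc t) x x x n - tri (Dall L) (osc t) y y y n)
    (1 * (A * b * R * R) + 1 * (A * R * b * R) + 1 * (A * R * R * b))"
    by (rule tri_diff_est[OF ker]) (use assms in auto)
  have 2: "hs_b s (\<lambda>n. 3 * (of_real ((cmod (x n))\<^sup>2) * x n - of_real ((cmod (y n))\<^sup>2) * y n)) (9 * R\<^sup>2 * b)"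
  proof (rule hs_b_cmult[OF assms(3)])
    fix n
    show "cmod (3 * (of_real ((cmod (x n))\<^sup>2) * x n - of_real ((cmod (y n))\<^sup>2) * y n)) \<le> 9 * R\<^sup>2 * cmod (x n - y n)"
      using cubic_diff[OF cmod_le[OF assms(1)] cmod_le[OF assms(2)], of n n]
      by (simp only: norm_mult[of 3] norm_numeral)
  qed simp
  have "hs_b s (\<lambda>n. GL L t x n - GL L t y n) (\<bar>c\<bar> * ((1 * (A * b * R * R) + 1 * (A * R * b * R) + 1 * (A * R * R * b)) + 9 * R\<^sup>2 * b))"
  proof (rule hs_b_cmult[OF hs_b_diff[OF 1 2]])
    fix n
    have "GL L t x n - GL L t y n = of_real c * ((tri (Dall L) (osc t) x x x n - tri (Dall L) (osc t) y y y n)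
      - 3 * (of_real ((cmod (x n))\<^sup>2) * x n - of_real ((cmod (y n))\<^sup>2) * y n))"
      by (simp add: GL_def algebra_simps)
    then show "cmod (GL L t x n - GL L t y n) \<le> \<bar>c\<bar> * cmod ((tri (Dall L) (osc t) x x x n - tri (Dall L) (osc t) y y y n)
      - 3 * (of_real ((cmod (x n))\<^sup>2) * x n - of_real ((cmod (y n))\<^sup>2) * y n))"
      by (simp only: norm_mult norm_of_real)
  qed simp
  then show ?thesis by (rule l2b_weaken) (simp add: algebra_simps power2_eq_square)
qed

lemma GL_zero: "GL L t (\<lambda>n. 0) n = 0"
  by (simp add: GL_def tri_def case_prod_unfold)

text \<open>The zero solution is a comparison partner: bounds for a single solution become special
  cases of the difference estimates.\<close>

lemma gsol_zero: "gsol T 0 (\<lambda>t n. 0) (\<lambda>t n. 0)"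
  unfolding gsol_def GL_zero using hs_b_zero by auto

lemma gsol_mono: "gsol T R u G \<Longrightarrow> R \<le> R' \<Longrightarrow> gsol T R' u G"
  unfolding gsol_def using l2b_weaken by blast

lemma gsol_bound: "gsol T R u G \<Longrightarrow> t \<in> {0..T} \<Longrightarrow> hs_b s (u t) R"
  by (simp add: gsol_def)

lemma gsol_lim:
  assumes "gsol T R u G" "t \<in> {0..T}"
  shows "(\<lambda>L. GL L t (u t) n) \<longlonglongrightarrow> G t n"
proof (rule LIMSEQ_I)
  fix r :: real assume "r > 0"
  then obtain L0 where "\<forall>L\<ge>L0. \<forall>t\<in>{0..T}. cmod (G t n - GL L t (u t) n) \<le> r/2"
    using assms(1) unfolding gsol_def by (meson half_gt_zero)
  then have "norm (GL L t (u t) n - G t n) < r" if "L \<ge> L0" for L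
    using assms(2) that \<open>r > 0\<close> by (force simp: norm_minus_commute)
  then show "\<exists>no. \<forall>L\<ge>no. norm (GL L t (u t) n - G t n) < r" by blast
qed

text \<open>The constant in \<open>GL_diff\<close> does not involve \<open>L\<close>, so the
  estimate passes to the limit. Without the factor \<open>n\<close>, \<open>G\<close> is as regular
  as \<open>u\<close>.\<close>

lemma gsol_G_diff:
  assumes "gsol T R u G" "gsol T R w H" "t \<in> {0..T}" "hs_b s (\<lambda>n. u t n - w t n) b"
  shows "hs_b s (\<lambda>n. G t n - H t n) (\<bar>c\<bar> * (3 * A + 9) * R\<^sup>2 * b)"
  by (rule hs_b_lim[OF tendsto_diff[OF gsol_lim[OF assms(1,3)] gsol_lim[OF assms(2,3)]]])
     (intro GL_diff gsol_bound[OF assms(1,3)] gsol_bound[OF assms(2,3)] assms(4))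

lemma gsol_G_bound:
  assumes "gsol T R u G" "t \<in> {0..T}"
  shows "hs_b s (G t) (\<bar>c\<bar> * (3 * A + 9) * R^3)"
proof -
  have R: "R \<ge> 0" using l2b_nonneg[OF gsol_bound[OF assms]] .
  have "hs_b s (\<lambda>n. G t n - 0) (\<bar>c\<bar> * (3 * A + 9) * R\<^sup>2 * R)"
    by (rule gsol_G_diff[OF assms(1) gsol_mono[OF gsol_zero R] assms(2)])
       (use gsol_bound[OF assms] in simp)
  then show ?thesis by (simp add: power2_eq_square power3_eq_cube mult_ac)
qed


section \<open>The normal form\<close>

text \<open>The sign is such that differentiating the oscillation in \<open>coef * osc\<close>
  yields minus the high nonresonant part of \<open>\<i> n GL\<close>.\<close>

definition coef :: "int \<Rightarrow> int \<Rightarrow> int \<Rightarrow> complex" where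
  "coef a b d = of_real (c * real_of_int (a+b+d) / Phi a b d)"

definition BL :: "nat \<Rightarrow> real \<Rightarrow> real \<Rightarrow> (int \<Rightarrow> complex) \<Rightarrow> int \<Rightarrow> complex" where
  "BL L K t x n = tri (Dhi L K) (\<lambda>a b d. coef a b d * osc t a b d) x x x n"

text \<open>\<open>g\<close> stands for the nonlinearity \<open>G\<close>. The factor
  \<open>\<i> m\<close> that turns it into the time derivative of coefficient \<open>m\<close> is
  placed in the multiplier, where division by \<open>Phi\<close> compensates it; the last three
  lines are therefore the quintic terms.\<close>

definition YL :: "nat \<Rightarrow> real \<Rightarrow> real \<Rightarrow> (int \<Rightarrow> complex) \<Rightarrow> (int \<Rightarrow> complex) \<Rightarrow> int \<Rightarrow> complex" where
  "YL L K t x g n = tri (Dlo L K) (\<lambda>a b d. \<i> * of_real (c * real_of_int (a+b+d)) * osc t a b d) x x x n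
    - 3 * \<i> * of_real (c * real_of_int n) * (of_real ((cmod (x n))\<^sup>2) * x n)
    + tri (Dhi L K) (\<lambda>a b d. coef a b d * osc t a b d * (\<i> * of_int a)) g x x n
    + tri (Dhi L K) (\<lambda>a b d. coef a b d * osc t a b d * (\<i> * of_int b)) x g x n
    + tri (Dhi L K) (\<lambda>a b d. coef a b d * osc t a b d * (\<i> * of_int d)) x x g n"

text \<open>Differentiation by parts: the time derivative of \<open>u + BL\<close> no longer contains the high
  nonresonant part of the nonlinearity.\<close>

lemma normal_form_derivative:
  assumes u: "gsol T R u G" and t: "t \<in> {0..T}"
  shows "((\<lambda>t. u t n + BL L K t (u t) n) has_vector_derivative
    (\<i> * of_int n * (G t n - GL L t (u t) n) + YL L K t (u t) (G t) n)) (at t within {0..T})"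
proof -
  have du: "((\<lambda>t. u t n) has_vector_derivative (\<i> * of_int n * G t n)) (at t within {0..T})" for n
    using u t by (simp add: gsol_def)
  let ?x = "u t" let ?o = "osc t"
  let ?x' = "\<lambda>n. \<i> * of_int n * G t n"
  let ?D = "Dhi L K"
  have "((\<lambda>t. BL L K t (u t) n) has_vector_derivative
     (tri ?D (\<lambda>a b d. coef a b d * (- \<i> * of_real (Phi a b d)) * ?o a b d) ?x ?x ?x n
     + tri ?D (\<lambda>a b d. coef a b d * ?o a b d) ?x' ?x ?x n
     + tri ?D (\<lambda>a b d. coef a b d * ?o a b d) ?x ?x' ?x n
     + tri ?D (\<lambda>a b d. coef a b d * ?o a b d) ?x ?x ?x' n)) (at t within {0..T})"
    unfolding BL_def osc_def by (rule tri_has_vector_derivative) (auto intro: du)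
  from has_vector_derivative_add[OF du this]
  show ?thesis
  proof (rule has_vector_derivative_eq_rhs)
    have 0: "tri ?D (\<lambda>a b d. coef a b d * (- \<i> * of_real (Phi a b d)) * ?o a b d) ?x ?x ?x n
        = - \<i> * of_real (c * real_of_int n) * tri ?D ?o ?x ?x ?x n"
      unfolding tri_def sum_distrib_left
    proof (rule sum.cong[OF refl], clarify)
      fix k j assume "(k,j) \<in> ?D n"
      then have "PP k j (n-k-j) \<noteq> 0" by (auto simp: Dhi_def Dall_def)
      then have "Phi k j (n-k-j) \<noteq> 0" using Phi_ge_SS(2) by fastforce
      then have "coef k j (n-k-j) * (- \<i> * of_real (Phi k j (n-k-j))) = - \<i> * of_real (c * real_of_int n)"
        by (simp add: coef_def)
      then show "coef k j (n-k-j) * (- \<i> * of_real (Phi k j (n-k-j))) * ?o k j (n-k-j) * ?x k * ?x j * ?x (n-k-j)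
          = - \<i> * of_real (c * real_of_int n) * (?o k j (n-k-j) * ?x k * ?x j * ?x (n-k-j))"
        by (simp only: mult.assoc[symmetric])
    qed
    have 1: "tri ?D (\<lambda>a b d. coef a b d * ?o a b d) ?x' ?x ?x n
      = tri ?D (\<lambda>a b d. coef a b d * ?o a b d * (\<i> * of_int a)) (G t) ?x ?x n"
      unfolding tri_def by (rule sum.cong) (auto simp: mult_ac)
    have 2: "tri ?D (\<lambda>a b d. coef a b d * ?o a b d) ?x ?x' ?x n
      = tri ?D (\<lambda>a b d. coef a b d * ?o a b d * (\<i> * of_int b)) ?x (G t) ?x n"
      unfolding tri_def by (rule sum.cong) (auto simp: mult_ac)
    have 3: "tri ?D (\<lambda>a b d. coef a b d * ?o a b d) ?x ?x ?x' n
      = tri ?D (\<lambda>a b d. coef a b d * ?o a b d * (\<i> * of_int d)) ?x ?x (G t) n"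
      unfolding tri_def by (rule sum.cong) (auto simp: mult_ac)
    have 4: "tri (Dlo L K) (\<lambda>a b d. \<i> * of_real (c * real_of_int (a+b+d)) * ?o a b d) ?x ?x ?x n
      = \<i> * of_real (c * real_of_int n) * tri (Dlo L K) ?o ?x ?x ?x n"
      unfolding tri_def sum_distrib_left by (rule sum.cong) (auto simp: mult_ac)
    have split: "Dall L n = Dlo L K n \<union> Dhi L K n" "Dlo L K n \<inter> Dhi L K n = {}"
      by (auto simp: Dlo_def Dhi_def)
    have 5: "tri (Dall L) ?o ?x ?x ?x n = tri (Dlo L K) ?o ?x ?x ?x n + tri ?D ?o ?x ?x ?x n"
      unfolding tri_def split(1) by (rule sum.union_disjoint) (use split(2) in auto)
    show "\<i> * of_int n * G t n + (tri ?D (\<lambda>a b d. coef a b d * (- \<i> * of_real (Phi a b d)) * ?o a b d) ?x ?x ?x n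
     + tri ?D (\<lambda>a b d. coef a b d * ?o a b d) ?x' ?x ?x n
     + tri ?D (\<lambda>a b d. coef a b d * ?o a b d) ?x ?x' ?x n
     + tri ?D (\<lambda>a b d. coef a b d * ?o a b d) ?x ?x ?x' n)
     = \<i> * of_int n * (G t n - GL L t ?x n) + YL L K t ?x (G t) n"
      unfolding 0 1 2 3 YL_def 4 GL_def 5 by (simp add: algebra_simps)
  qed
qed

lemma coef_small:
  assumes "(k,j) \<in> Dhi L K n" "K > 0"
  shows "cmod (coef k j (n-k-j) * osc t k j (n-k-j)) \<le> \<bar>c\<bar> / K"
proof -
  have "\<bar>real_of_int (k+j+(n-k-j)) / Phi k j (n-k-j)\<bar> \<le> 1 / K"
    by (rule multiplier_small) (use assms in \<open>auto simp: Dhi_def Dall_def\<close>)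
  from mult_left_mono[OF this abs_ge_zero[of c]]
  show ?thesis by (simp add: coef_def norm_mult norm_divide abs_mult abs_divide)
qed

lemma coef_le:
  assumes "(k,j) \<in> Dhi L K n" "m\<^sup>2 \<le> SS k j (n-k-j)"
  shows "cmod (coef k j (n-k-j) * osc t k j (n-k-j) * (\<i> * of_int m)) \<le> \<bar>c\<bar>"
proof -
  have "\<bar>real_of_int (k+j+(n-k-j)) * real_of_int m / Phi k j (n-k-j)\<bar> \<le> 1"
    by (rule multiplier_le_1) (use assms in \<open>auto simp: Dhi_def Dall_def\<close>)
  from mult_left_mono[OF this abs_ge_zero[of c]]
  show ?thesis by (simp add: coef_def norm_mult norm_divide abs_mult abs_divide mult_ac)
qed

lemma BL_diff:
  assumes "hs_b s x R" "hs_b s y R" "hs_b s (\<lambda>n. x n - y n) b" "K > 0"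
  shows "hs_b s (\<lambda>n. BL L K t x n - BL L K t y n) (3 * \<bar>c\<bar> * A * R\<^sup>2 / K * b)"
proof -
  have "hs_b s (\<lambda>n. BL L K t x n - BL L K t y n)
    (\<bar>c\<bar> / K * (A * b * R * R) + \<bar>c\<bar> / K * (A * R * b * R) + \<bar>c\<bar> / K * (A * R * R * b))"
    unfolding BL_def
    by (rule tri_diff_est[OF ker]) (use assms in \<open>auto intro: coef_small\<close>)
  then show ?thesis by (rule l2b_weaken) (simp add: algebra_simps power2_eq_square)
qed

text \<open>The three summands belong to the low frequencies, to the resonant cubic term and to the
  quintic terms; the 9 in the last is three positions of \<open>G\<close> times three
  differences.\<close>

definition lip_const :: "real \<Rightarrow> real \<Rightarrow> real" where
  "lip_const K R = 3 * \<bar>c\<bar> * K * A * R\<^sup>2 + 9 * \<bar>c\<bar> * R\<^sup>2 + 9 * c\<^sup>2 * A * (3 * A + 9) * R^4"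

lemma lip_const_nonneg: "K \<ge> 0 \<Longrightarrow> lip_const K R \<ge> 0"
  unfolding lip_const_def using A_nonneg by (intro add_nonneg_nonneg mult_nonneg_nonneg) auto

text \<open>The factor \<open>n\<close> costs nothing: a single coefficient is at most R / W s n,
  and the square of that weight dominates \<open>n\<close> because 2s \<ge> 1.\<close>

lemma resonant_diff:
  assumes "hs_b s x R" "hs_b s y R" "hs_b s (\<lambda>n. x n - y n) b"
  shows "hs_b s (\<lambda>n. 3 * \<i> * of_real (c * real_of_int n) * (of_real ((cmod (x n))\<^sup>2) * x n)
    - 3 * \<i> * of_real (c * real_of_int n) * (of_real ((cmod (y n))\<^sup>2) * y n)) (9 * \<bar>c\<bar> * R\<^sup>2 * b)"
proof (rule hs_b_cmult[OF assms(3)])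
  fix n
  have R: "R \<ge> 0" using assms(1) by (rule l2b_nonneg)
  define r where "r = R / W s n"
  have r: "cmod (x n) \<le> r" "cmod (y n) \<le> r"
    using hs_b_le[OF assms(1), of n] hs_b_le[OF assms(2), of n] W_pos[of s n]
    by (simp_all add: r_def field_simps)
  have "\<bar>real_of_int n\<bar> \<le> W 1 n" by (rule W_1_ge)
  also have "\<dots> \<le> W (s + s) n" using s by (intro W_mono) simp
  also have "\<dots> = (W s n)\<^sup>2" by (simp add: W_mult power2_eq_square)
  finally have "\<bar>real_of_int n\<bar> * r\<^sup>2 \<le> (W s n)\<^sup>2 * r\<^sup>2" by (rule mult_right_mono) simp
  also have "\<dots> = R\<^sup>2" using W_pos[of s n] by (simp add: r_def power_divide)
  finally have nr: "\<bar>real_of_int n\<bar> * r\<^sup>2 \<le> R\<^sup>2" .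
  let ?d = "of_real ((cmod (x n))\<^sup>2) * x n - of_real ((cmod (y n))\<^sup>2) * y n"
  have "cmod (3 * \<i> * of_real (c * real_of_int n) * ?d) = 3 * \<bar>c\<bar> * \<bar>real_of_int n\<bar> * cmod ?d"
    by (simp only: norm_mult norm_of_real abs_mult norm_numeral norm_ii mult_1_right)
  also have "\<dots> \<le> 3 * \<bar>c\<bar> * \<bar>real_of_int n\<bar> * (3 * r\<^sup>2 * cmod (x n - y n))"
    by (intro mult_left_mono cubic_diff r) auto
  also have "\<dots> = 9 * \<bar>c\<bar> * (\<bar>real_of_int n\<bar> * r\<^sup>2) * cmod (x n - y n)" by simp
  also have "\<dots> \<le> 9 * \<bar>c\<bar> * R\<^sup>2 * cmod (x n - y n)"
    by (intro mult_right_mono mult_left_mono nr) auto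
  finally show "cmod (3 * \<i> * of_real (c * real_of_int n) * (of_real ((cmod (x n))\<^sup>2) * x n)
    - 3 * \<i> * of_real (c * real_of_int n) * (of_real ((cmod (y n))\<^sup>2) * y n)) \<le> 9 * \<bar>c\<bar> * R\<^sup>2 * cmod (x n - y n)"
    by (simp only: right_diff_distrib)
qed simp

lemma YL_diff:
  assumes x: "hs_b s x R" "hs_b s y R" "hs_b s (\<lambda>n. x n - y n) b"
    and g: "hs_b s g (\<bar>c\<bar> * (3 * A + 9) * R^3)" "hs_b s h (\<bar>c\<bar> * (3 * A + 9) * R^3)"
      "hs_b s (\<lambda>n. g n - h n) (\<bar>c\<bar> * (3 * A + 9) * R\<^sup>2 * b)"
    and K: "K > 0"
  shows "hs_b s (\<lambda>n. YL L K t x g n - YL L K t y h n) (lip_const K R * b)"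
proof -
  let ?q = "\<bar>c\<bar> * (3 * A + 9)"
  let ?M = "\<lambda>m a b d. coef a b d * osc t a b d * (\<i> * of_int m)"
  have lo: "cmod (\<i> * of_real (c * real_of_int (k+j+(n-k-j))) * osc t k j (n-k-j)) \<le> \<bar>c\<bar> * K"
    if "(k,j) \<in> Dlo L K n" for k j n
  proof -
    have "\<bar>real_of_int (k+j+(n-k-j))\<bar> \<le> sqrt (SS k j (n-k-j))"
      by (intro abs_le_sqrt_SS SS_ge_squares)
    also have "\<dots> \<le> K" using that K by (intro real_le_lsqrt) (auto simp: Dlo_def)
    finally show ?thesis by (simp add: norm_mult abs_mult mult_left_mono)
  qed
  let ?lo = "\<lambda>x. tri (Dlo L K) (\<lambda>a b d. \<i> * of_real (c * real_of_int (a+b+d)) * osc t a b d) x x x"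
  let ?res = "\<lambda>x n. 3 * \<i> * of_real (c * real_of_int n) * (of_real ((cmod (x n))\<^sup>2) * x n)"
  let ?h1 = "\<lambda>g x. tri (Dhi L K) (\<lambda>a b d. ?M a a b d) g x x"
  let ?h2 = "\<lambda>g x. tri (Dhi L K) (\<lambda>a b d. ?M b a b d) x g x"
  let ?h3 = "\<lambda>g x. tri (Dhi L K) (\<lambda>a b d. ?M d a b d) x x g"
  have 0: "hs_b s (\<lambda>n. ?lo x n - ?lo y n)
      (\<bar>c\<bar> * K * (A * b * R * R) + \<bar>c\<bar> * K * (A * R * b * R) + \<bar>c\<bar> * K * (A * R * R * b))"
    by (rule tri_diff_est[OF ker], simp, rule lo, assumption, use K in simp) (rule x)+
  have 1: "hs_b s (\<lambda>n. ?h1 g x n - ?h1 h y n)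
      (\<bar>c\<bar> * (A * (?q * R\<^sup>2 * b) * R * R) + \<bar>c\<bar> * (A * (?q * R^3) * b * R) + \<bar>c\<bar> * (A * (?q * R^3) * R * b))"
    by (rule tri_diff_est[OF ker]) (use x g in \<open>auto intro!: coef_le SS_ge_squares\<close>)
  have 2: "hs_b s (\<lambda>n. ?h2 g x n - ?h2 h y n)
      (\<bar>c\<bar> * (A * b * (?q * R^3) * R) + \<bar>c\<bar> * (A * R * (?q * R\<^sup>2 * b) * R) + \<bar>c\<bar> * (A * R * (?q * R^3) * b))"
    by (rule tri_diff_est[OF ker]) (use x g in \<open>auto intro!: coef_le SS_ge_squares\<close>)
  have 3: "hs_b s (\<lambda>n. ?h3 g x n - ?h3 h y n)
      (\<bar>c\<bar> * (A * b * R * (?q * R^3)) + \<bar>c\<bar> * (A * R * b * (?q * R^3)) + \<bar>c\<bar> * (A * R * R * (?q * R\<^sup>2 * b)))"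
    by (rule tri_diff_est[OF ker], simp, rule coef_le, assumption, rule SS_ge_squares, simp) (rule x g)+
  note all = hs_b_triangle[OF hs_b_triangle[OF hs_b_triangle[OF hs_b_diff[OF 0 resonant_diff[OF x]] 1] 2] 3]
  have eq: "YL L K t x g n - YL L K t y h n = ?lo x n - ?lo y n - (?res x n - ?res y n)
      + (?h1 g x n - ?h1 h y n) + (?h2 g x n - ?h2 h y n) + (?h3 g x n - ?h3 h y n)" for n
    unfolding YL_def by (simp only: algebra_simps)
  have "c\<^sup>2 = \<bar>c\<bar> * \<bar>c\<bar>" by (simp add: power2_eq_square)
  then show ?thesis unfolding eq
    by (intro l2b_weaken[OF all])
       (simp add: lip_const_def algebra_simps power2_eq_square power3_eq_cube eval_nat_numeral)
qed

text \<open>The normal form is differentiated for a fixed box and a fixed finite set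
  \<open>F\<close>; all its constants are independent of both. The 6 is 3 from
  \<open>BL_diff\<close> at each of the two end points, and these boundary terms have no small
  factor of time.\<close>

lemma core_estimate:
  assumes u: "gsol T R u G" and w: "gsol T R w H" and tt: "0 \<le> t0" "t0 \<le> t1" "t1 \<le> T"
    and b: "\<And>t. t \<in> {t0..t1} \<Longrightarrow> hs_b s (\<lambda>n. u t n - w t n) b" and K: "K > 0"
  shows "hs_b s (\<lambda>n. (u t1 n - w t1 n) - (u t0 n - w t0 n))
    (6 * \<bar>c\<bar> * A * R\<^sup>2 / K * b + (t1 - t0) * lip_const K R * b)"
  unfolding l2b_def
proof (intro allI impI)
  fix F :: "int set" assume F: "finite F"
  let ?B = "6 * \<bar>c\<bar> * A * R\<^sup>2 / K * b + (t1 - t0) * lip_const K R * b"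
  \<comment> \<open>On \<open>F\<close> the loss of the factor \<open>n\<close> is this constant. It
    enters only multiplied by the truncation error, which the choice of \<epsilon> makes
    negligible.\<close>
  define S where "S = L2_set (\<lambda>n. W s n * \<bar>real_of_int n\<bar>) F"
  have S: "S \<ge> 0" by (simp add: S_def)
  show "L2_set (\<lambda>n. W s n * cmod ((u t1 n - w t1 n) - (u t0 n - w t0 n))) F \<le> ?B"
  proof (rule field_le_epsilon)
    fix e :: real assume e: "e > 0"
    define \<epsilon> where "\<epsilon> = e / (2 * (t1 - t0 + 1) * (S + 1))"
    have \<epsilon>: "\<epsilon> > 0" "(t1 - t0) * (2 * \<epsilon> * S) \<le> e"
    proof -
      show "\<epsilon> > 0" using e S tt by (auto simp: \<epsilon>_def intro!: divide_pos_pos mult_pos_pos)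
      have p: "t1 - t0 + 1 > 0" "S + 1 > 0" using tt S by auto
      have "x * (2 * (e / (2 * p * q)) * y) = e * (x / p * (y / q))" if "p > 0" "q > 0" for x y p q :: real
        using that by (simp add: field_simps)
      from this[OF p] have "(t1 - t0) * (2 * \<epsilon> * S) = e * ((t1 - t0) / (t1 - t0 + 1) * (S / (S + 1)))"
        unfolding \<epsilon>_def .
      also have "\<dots> \<le> e * (1 * 1)"
        using e p tt S by (intro mult_left_mono mult_mono) (auto simp: field_simps)
      finally show "(t1 - t0) * (2 * \<epsilon> * S) \<le> e" by simp
    qed
    \<comment> \<open>One box serves all frequencies of \<open>F\<close> and all times, because the
      convergence in \<open>gsol\<close> is uniform in time for each coefficient.\<close>
    have "\<exists>L0. \<forall>n\<in>F. \<forall>L\<ge>L0. \<forall>t\<in>{0..T}. cmod (G t n - GL L t (u t) n) \<le> \<epsilon> \<and> cmod (H t n - GL L t (w t) n) \<le> \<epsilon>"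
      using F
    proof (induction F rule: finite_induct)
      case (insert m F)
      then obtain L0 where L0: "\<forall>n\<in>F. \<forall>L\<ge>L0. \<forall>t\<in>{0..T}. cmod (G t n - GL L t (u t) n) \<le> \<epsilon> \<and> cmod (H t n - GL L t (w t) n) \<le> \<epsilon>" by blast
      obtain L1 where L1: "\<forall>L\<ge>L1. \<forall>t\<in>{0..T}. cmod (G t m - GL L t (u t) m) \<le> \<epsilon>"
        using u \<epsilon>(1) unfolding gsol_def by blast
      obtain L2 where L2: "\<forall>L\<ge>L2. \<forall>t\<in>{0..T}. cmod (H t m - GL L t (w t) m) \<le> \<epsilon>"
        using w \<epsilon>(1) unfolding gsol_def by blast
      show ?case by (rule exI[of _ "max L0 (max L1 L2)"]) (use L0 L1 L2 in auto)
    qed simp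
    then obtain L where L: "\<And>n t. n \<in> F \<Longrightarrow> t \<in> {0..T} \<Longrightarrow> cmod (G t n - GL L t (u t) n) \<le> \<epsilon>"
      "\<And>n t. n \<in> F \<Longrightarrow> t \<in> {0..T} \<Longrightarrow> cmod (H t n - GL L t (w t) n) \<le> \<epsilon>" by (meson order_refl)
    define f where "f t n = (u t n + BL L K t (u t) n) - (w t n + BL L K t (w t) n)" for t n
    define f1 where "f1 t n = \<i> * of_int n * ((G t n - GL L t (u t) n) - (H t n - GL L t (w t) n))" for t n
    define f2 where "f2 t n = YL L K t (u t) (G t) n - YL L K t (w t) (H t) n" for t n
    have in_T: "t \<in> {0..T}" if "t \<in> {t0..t1}" for t using that tt by auto
    have der: "((\<lambda>t. f t n) has_vector_derivative (f1 t n + f2 t n)) (at t within {t0..t1})"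
      if "t \<in> {t0..t1}" for t n
    proof -
      have "((\<lambda>t. f t n) has_vector_derivative
        ((\<i> * of_int n * (G t n - GL L t (u t) n) + YL L K t (u t) (G t) n)
        - (\<i> * of_int n * (H t n - GL L t (w t) n) + YL L K t (w t) (H t) n))) (at t within {0..T})"
        unfolding f_def
        by (intro has_vector_derivative_diff normal_form_derivative[OF u] normal_form_derivative[OF w] in_T that)
      then have "((\<lambda>t. f t n) has_vector_derivative (f1 t n + f2 t n)) (at t within {0..T})"
        by (rule has_vector_derivative_eq_rhs) (simp add: f1_def f2_def algebra_simps)
      then show ?thesis by (rule has_vector_derivative_within_subset) (use tt in auto)
    qed
    have f1: "L2_set (\<lambda>n. W s n * cmod (f1 t n)) F \<le> 2 * \<epsilon> * S" if t: "t \<in> {t0..t1}" for t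
    proof -
      have "L2_set (\<lambda>n. W s n * cmod (f1 t n)) F \<le> L2_set (\<lambda>n. 2 * \<epsilon> * (W s n * \<bar>real_of_int n\<bar>)) F"
      proof (rule L2_set_mono)
        fix n assume n: "n \<in> F"
        have "cmod ((G t n - GL L t (u t) n) - (H t n - GL L t (w t) n)) \<le> \<epsilon> + \<epsilon>"
          by (rule order_trans[OF norm_triangle_ineq4]) (intro add_mono L n in_T t)
        then have "cmod (f1 t n) \<le> \<bar>real_of_int n\<bar> * (2 * \<epsilon>)"
          unfolding f1_def norm_mult by (simp add: mult_left_mono)
        from mult_left_mono[OF this W_nonneg[of s n]]
        show "W s n * cmod (f1 t n) \<le> 2 * \<epsilon> * (W s n * \<bar>real_of_int n\<bar>)" by (simp add: mult_ac)
      qed simp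
      also have "\<dots> = 2 * \<epsilon> * S" unfolding S_def using \<epsilon>(1) by (subst L2_set_right_distrib) auto
      finally show ?thesis .
    qed
    have f2: "L2_set (\<lambda>n. W s n * cmod (f2 t n)) F \<le> lip_const K R * b" if t: "t \<in> {t0..t1}" for t
      unfolding f2_def
      by (intro l2bD[OF YL_diff F] gsol_bound[OF u] gsol_bound[OF w] gsol_G_bound[OF u] gsol_G_bound[OF w]
          gsol_G_diff[OF u w] in_T b t K)
    have "L2_set (\<lambda>n. W s n * cmod (f1 t n + f2 t n)) F \<le> 2 * \<epsilon> * S + lip_const K R * b" if t: "t \<in> {t0..t1}" for t
    proof -
      have "L2_set (\<lambda>n. W s n * cmod (f1 t n + f2 t n)) F \<le> L2_set (\<lambda>n. W s n * cmod (f1 t n) + W s n * cmod (f2 t n)) F"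
        by (rule L2_set_mono) (auto simp: distrib_left[symmetric] intro!: mult_left_mono norm_triangle_ineq)
      also have "\<dots> \<le> L2_set (\<lambda>n. W s n * cmod (f1 t n)) F + L2_set (\<lambda>n. W s n * cmod (f2 t n)) F"
        by (rule L2_set_triangle_ineq)
      finally show ?thesis using f1[OF t] f2[OF t] by linarith
    qed
    from l2_mean_value[OF F tt(2) der this]
    have 1: "L2_set (\<lambda>n. W s n * cmod (f t1 n - f t0 n)) F \<le> (t1 - t0) * (2 * \<epsilon> * S + lip_const K R * b)"
      by blast
    let ?d = "\<lambda>t n. BL L K t (u t) n - BL L K t (w t) n"
    have 2: "L2_set (\<lambda>n. W s n * cmod (?d t n)) F \<le> 3 * \<bar>c\<bar> * A * R\<^sup>2 / K * b" if "t \<in> {t0..t1}" for t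
      by (intro l2bD[OF BL_diff F] gsol_bound[OF u] gsol_bound[OF w] in_T b that K)
    have "L2_set (\<lambda>n. W s n * cmod ((u t1 n - w t1 n) - (u t0 n - w t0 n))) F
      \<le> L2_set (\<lambda>n. (W s n * cmod (f t1 n - f t0 n) + W s n * cmod (?d t1 n)) + W s n * cmod (?d t0 n)) F"
    proof (rule L2_set_mono)
      fix n
      have "(u t1 n - w t1 n) - (u t0 n - w t0 n) = (f t1 n - f t0 n) - ?d t1 n + ?d t0 n"
        by (simp add: f_def)
      then have "cmod ((u t1 n - w t1 n) - (u t0 n - w t0 n)) \<le> (cmod (f t1 n - f t0 n) + cmod (?d t1 n)) + cmod (?d t0 n)"
        by (metis add_mono_thms_linordered_semiring(3) norm_triangle_ineq norm_triangle_ineq4 order_trans)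
      from mult_left_mono[OF this W_nonneg[of s n]]
      show "W s n * cmod ((u t1 n - w t1 n) - (u t0 n - w t0 n))
        \<le> (W s n * cmod (f t1 n - f t0 n) + W s n * cmod (?d t1 n)) + W s n * cmod (?d t0 n)"
        by (simp only: distrib_left)
    qed simp
    also have "\<dots> \<le> L2_set (\<lambda>n. W s n * cmod (f t1 n - f t0 n)) F + L2_set (\<lambda>n. W s n * cmod (?d t1 n)) F
        + L2_set (\<lambda>n. W s n * cmod (?d t0 n)) F"
      by (intro order_trans[OF L2_set_triangle_ineq] add_right_mono L2_set_triangle_ineq)
    also have "\<dots> \<le> (t1 - t0) * (2 * \<epsilon> * S + lip_const K R * b) + 3 * \<bar>c\<bar> * A * R\<^sup>2 / K * b + 3 * \<bar>c\<bar> * A * R\<^sup>2 / K * b"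
      by (intro add_mono 1 2) (use tt in auto)
    also have "\<dots> = ?B + (t1 - t0) * (2 * \<epsilon> * S)" by (simp add: algebra_simps)
    also have "\<dots> \<le> ?B + e" using \<epsilon>(2) by simp
    finally show "L2_set (\<lambda>n. W s n * cmod ((u t1 n - w t1 n) - (u t0 n - w t0 n))) F \<le> ?B + e" .
  qed
qed


section \<open>Continuity in time and Lipschitz dependence for gauged solutions\<close>

lemma gsol_continuous:
  assumes u: "gsol T R u G" and e: "e > 0"
  obtains \<delta> where "\<delta> > 0"
    "\<And>t t'. t \<in> {0..T} \<Longrightarrow> t' \<in> {0..T} \<Longrightarrow> \<bar>t' - t\<bar> < \<delta> \<Longrightarrow> hs_b s (\<lambda>n. u t' n - u t n) e"
proof (cases "T \<ge> 0")
  case False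
  then show ?thesis using that[of 1] by auto
next
  case True
  then have R: "R \<ge> 0" using l2b_nonneg[OF gsol_bound[OF u, of 0]] by simp
  \<comment> \<open>This \<open>K\<close> brings the boundary terms below \<open>e / 2\<close>; the
    time step, which may depend on \<open>K\<close>, handles the rest.\<close>
  define K where "K = 12 * \<bar>c\<bar> * A * R\<^sup>2 * R / e + 1"
  have K: "K > 0" unfolding K_def using A_nonneg R e by (intro add_nonneg_pos divide_nonneg_pos mult_nonneg_nonneg) auto
  have K2: "6 * \<bar>c\<bar> * A * R\<^sup>2 / K * R \<le> e / 2"
  proof -
    have "12 * \<bar>c\<bar> * A * R\<^sup>2 * R \<le> e * K" unfolding K_def using e by (simp add: field_simps)
    then show ?thesis using K by (simp add: field_simps)
  qed
  have kp: "lip_const K R * R \<ge> 0" using lip_const_nonneg[of K R] K R by simp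
  define \<delta> where "\<delta> = e / (2 * (lip_const K R * R + 1))"
  have \<delta>: "\<delta> > 0" unfolding \<delta>_def using e kp by (intro divide_pos_pos) auto
  have ord: "hs_b s (\<lambda>n. u t1 n - u t0 n) e" if "t0 \<in> {0..T}" "t1 \<in> {0..T}" "t0 \<le> t1" "t1 - t0 \<le> \<delta>" for t0 t1
  proof -
    \<comment> \<open>Comparison with the zero solution: the difference in
      \<open>core_estimate\<close> is then the increment of \<open>u\<close> itself, and the a
      priori size of the difference is \<open>R\<close>.\<close>
    have 1: "hs_b s (\<lambda>n. (u t1 n - 0) - (u t0 n - 0)) (6 * \<bar>c\<bar> * A * R\<^sup>2 / K * R + (t1 - t0) * lip_const K R * R)"
      by (rule core_estimate[OF u gsol_mono[OF gsol_zero R]])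
         (use that K gsol_bound[OF u] in auto)
    have "(t1 - t0) * lip_const K R * R \<le> \<delta> * (lip_const K R * R)"
      using that kp by (simp add: mult.assoc mult_right_mono)
    also have "\<dots> \<le> \<delta> * (lip_const K R * R + 1)" using \<delta> by (intro mult_left_mono) auto
    also have "\<dots> = e / 2" unfolding \<delta>_def using kp by (simp add: field_simps)
    finally have "6 * \<bar>c\<bar> * A * R\<^sup>2 / K * R + (t1 - t0) * lip_const K R * R \<le> e" using K2 by linarith
    from l2b_weaken[OF 1 this] show ?thesis by simp
  qed
  show ?thesis
  proof (rule that[OF \<delta>])
    fix t t' assume t: "t \<in> {0..T}" "t' \<in> {0..T}" "\<bar>t' - t\<bar> < \<delta>"
    show "hs_b s (\<lambda>n. u t' n - u t n) e"
    proof (cases "t \<le> t'")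
      case True then show ?thesis using t by (intro ord) auto
    next
      case False
      then have "hs_b s (\<lambda>n. u t n - u t' n) e" using t by (intro ord) auto
      then show ?thesis by (rule hs_b_mono) (simp add: norm_minus_commute)
    qed
  qed
qed


text \<open>A bound b on the whole time interval improves to b/2 + d, whose fixed point is 2d.
  Iterating from the trivial bound by \<open>R\<close> and passing to the limit avoids taking a
  supremum of the norm over time.\<close>

lemma gsol_small_step:
  assumes u: "gsol T R u G" and w: "gsol T R w H" and t0: "t0 \<in> {0..T}" "hs_b s (\<lambda>n. u t0 n - w t0 n) d"
    and t: "t \<in> {0..T}" "t0 \<le> t" "t \<le> t0 + \<delta>"
    and K: "K > 0" "6 * \<bar>c\<bar> * A * R\<^sup>2 / K \<le> 1/4" "\<delta> * lip_const K R \<le> 1/4"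
  shows "hs_b s (\<lambda>n. u t n - w t n) (2 * d)"
proof -
  have d: "d \<ge> 0" using t0(2) by (rule l2b_nonneg)
  have kp: "lip_const K R \<ge> 0" using lip_const_nonneg[of K R] K by simp
  have quarter: "p + q \<le> x / 2" if "p \<le> 1/4 * x" "q \<le> 1/4 * x" for p q x :: real
    using that by simp
  have it: "hs_b s (\<lambda>n. u \<tau> n - w \<tau> n) (2 * d + (2 * R) * (1/2)^k)" if "\<tau> \<in> {t0..t}" for \<tau> k
    using that
  proof (induction k arbitrary: \<tau>)
    case 0
    have "\<tau> \<in> {0..T}" using 0 t0 t by auto
    from hs_b_diff[OF gsol_bound[OF u this] gsol_bound[OF w this]]
    show ?case by (rule l2b_weaken) (use d in simp)
  next
    case (Suc k)
    define b where "b = 2 * d + (2 * R) * (1/2)^k"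
    have IH: "hs_b s (\<lambda>n. u x n - w x n) b" if "x \<in> {t0..t}" for x
      unfolding b_def by (rule Suc.IH[OF that])
    have b0: "b \<ge> 0" using IH[OF Suc.prems] by (rule l2b_nonneg)
    have core: "hs_b s (\<lambda>n. (u \<tau> n - w \<tau> n) - (u t0 n - w t0 n)) (6 * \<bar>c\<bar> * A * R\<^sup>2 / K * b + (\<tau> - t0) * lip_const K R * b)"
      by (rule core_estimate[OF u w _ _ _ IH K(1)]) (use Suc.prems t0(1) t in auto)
    have "6 * \<bar>c\<bar> * A * R\<^sup>2 / K * b \<le> 1/4 * b" by (rule mult_right_mono[OF K(2) b0])
    moreover have "(\<tau> - t0) * lip_const K R * b \<le> 1/4 * b"
    proof (rule mult_right_mono[OF _ b0])
      have "(\<tau> - t0) * lip_const K R \<le> \<delta> * lip_const K R"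
        by (rule mult_right_mono[OF _ kp]) (use Suc.prems t in auto)
      then show "(\<tau> - t0) * lip_const K R \<le> 1/4" using K(3) by linarith
    qed
    ultimately have "hs_b s (\<lambda>n. (u \<tau> n - w \<tau> n) - (u t0 n - w t0 n)) (b / 2)"
      by (intro l2b_weaken[OF core] quarter)
    from hs_b_triangle[OF this t0(2)]
    have "hs_b s (\<lambda>n. u \<tau> n - w \<tau> n) (b / 2 + d)" by simp
    then show ?case by (rule l2b_weaken) (simp add: b_def)
  qed
  show ?thesis unfolding l2b_def
  proof (intro allI impI)
    fix F :: "int set" assume F: "finite F"
    have "(\<lambda>k. 2 * d + (2 * R) * (1/2)^k) \<longlonglongrightarrow> 2 * d + (2 * R) * 0"
      by (intro tendsto_intros LIMSEQ_power_zero) simp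
    moreover have "L2_set (\<lambda>n. W s n * cmod (u t n - w t n)) F \<le> 2 * d + (2 * R) * (1/2)^k" for k
      by (rule l2bD[OF it F]) (use t in auto)
    ultimately show "L2_set (\<lambda>n. W s n * cmod (u t n - w t n)) F \<le> 2 * d"
      by (intro LIMSEQ_le_const[where X = "\<lambda>k. 2 * d + (2 * R) * (1/2)^k"]) auto
  qed
qed

text \<open>The admissible time step depends on \<open>R\<close> only, so a number of steps fixed in
  advance covers [0,T], and each of them at most doubles the distance.\<close>

lemma gsol_lipschitz:
  fixes R T :: real
  obtains \<Lambda> where "\<Lambda> \<ge> 1"
    "\<And>u G w H d t. gsol T R u G \<Longrightarrow> gsol T R w H \<Longrightarrow> hs_b s (\<lambda>n. u 0 n - w 0 n) d \<Longrightarrow> t \<in> {0..T}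
      \<Longrightarrow> hs_b s (\<lambda>n. u t n - w t n) (\<Lambda> * d)"
proof -
  define K where "K = 24 * \<bar>c\<bar> * A * R\<^sup>2 + 1"
  have K: "K > 0" unfolding K_def using A_nonneg by (intro add_nonneg_pos mult_nonneg_nonneg) auto
  have K4: "6 * \<bar>c\<bar> * A * R\<^sup>2 / K \<le> 1/4"
  proof -
    have "6 * \<bar>c\<bar> * A * R\<^sup>2 \<le> 1/4 * K" by (simp add: K_def)
    then show ?thesis using K by (simp only: divide_le_eq if_True)
  qed
  have kp: "lip_const K R \<ge> 0" using lip_const_nonneg[of K R] K by simp
  define \<delta> where "\<delta> = 1 / (4 * (lip_const K R + 1))"
  have \<delta>: "\<delta> > 0" unfolding \<delta>_def using kp by simp
  have \<delta>k: "\<delta> * lip_const K R \<le> 1/4" unfolding \<delta>_def using kp by (simp add: field_simps)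
  obtain N where N: "T \<le> real N * \<delta>" using reals_Archimedean3[OF \<delta>] less_imp_le by blast
  have iter: "hs_b s (\<lambda>n. u t n - w t n) (2^k * d)"
    if u: "gsol T R u G" and w: "gsol T R w H" and 0: "hs_b s (\<lambda>n. u 0 n - w 0 n) d"
      and t: "t \<in> {0..T}" "t \<le> real k * \<delta>" for u G w H d t k
    using t
  proof (induction k arbitrary: t)
    case 0
    then have "t = 0" by simp
    with 0 that(3) show ?case by simp
  next
    case (Suc k)
    define t0 where "t0 = min t (real k * \<delta>)"
    have "t \<le> real k * \<delta> + \<delta>" using Suc.prems(2) by (simp add: algebra_simps)
    moreover have "0 \<le> real k * \<delta>" using \<delta> by simp
    ultimately have t0: "t0 \<in> {0..T}" "t0 \<le> t" "t \<le> t0 + \<delta>" "t0 \<le> real k * \<delta>"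
      using Suc.prems(1) \<delta> by (auto simp: t0_def)
    from gsol_small_step[OF u w t0(1) Suc.IH[OF t0(1,4)] Suc.prems(1) t0(2,3) K K4 \<delta>k]
    show ?case by (simp add: mult.assoc)
  qed
  show ?thesis
  proof (rule that[of "2^N"])
    show "hs_b s (\<lambda>n. u t n - w t n) (2^N * d)"
      if "gsol T R u G" "gsol T R w H" "hs_b s (\<lambda>n. u 0 n - w 0 n) d" "t \<in> {0..T}" for u G w H d t
      by (rule iter[OF that]) (use that(4) N in auto)
  qed simp
qed

end

section \<open>Sums over all frequencies\<close>

lemma hs_b_imp_norm:
  assumes "hs_b s x B"
  shows "hs_weight s x summable_on UNIV" "hs_norm s x \<le> B"
proof -
  have B: "B \<ge> 0" using assms by (rule l2b_nonneg)
  have le: "sum (hs_weight s x) F \<le> B\<^sup>2" if "finite F" for F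
    using l2b_sum_sq[OF assms that] by (simp add: hs_weight_W)
  show sm: "hs_weight s x summable_on UNIV"
    by (rule nonneg_bdd_above_summable_on) (auto simp: hs_weight_W intro!: bdd_aboveI2[where M = "B\<^sup>2"] le[unfolded hs_weight_W])
  have "infsum (hs_weight s x) UNIV \<le> B\<^sup>2" by (rule infsum_le_finite_sums[OF sm]) (use le in auto)
  then show "hs_norm s x \<le> B" unfolding hs_norm_def using B by (intro real_le_lsqrt) (auto intro: infsum_nonneg simp: hs_weight_W)
qed

lemma summable_imp_hs_b:
  assumes "hs_weight s x summable_on UNIV"
  shows "hs_b s x (hs_norm s x)"
proof (rule l2bI_sq)
  have nn: "infsum (hs_weight s x) UNIV \<ge> 0" by (rule infsum_nonneg) (simp add: hs_weight_W)
  show "0 \<le> hs_norm s x" by (simp add: hs_norm_def nn)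
  fix F :: "int set" assume "finite F"
  then have "sum (hs_weight s x) F \<le> infsum (hs_weight s x) UNIV"
    by (intro finite_sum_le_infsum assms) (auto simp: hs_weight_W)
  moreover have "(hs_norm s x)\<^sup>2 = infsum (hs_weight s x) UNIV" using nn by (simp add: hs_norm_def)
  moreover have "(\<Sum>n\<in>F. (W s n * cmod (x n))\<^sup>2) = sum (hs_weight s x) F"
    by (rule sum.cong) (auto simp: hs_weight_W)
  ultimately show "(\<Sum>n\<in>F. (W s n * cmod (x n))\<^sup>2) \<le> (hs_norm s x)\<^sup>2" by simp
qed

lemma Hs_hs_b: "x \<in> Hs s \<Longrightarrow> hs_b s x (hs_norm s x)"
  by (rule summable_imp_hs_b) (simp add: Hs_def)

lemma hs_b_tail:
  assumes "hs_b s x B" "e > 0"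
  obtains L where "\<And>F. finite F \<Longrightarrow> F \<inter> {- int L..int L} = {} \<Longrightarrow> L2_set (\<lambda>n. W s n * cmod (x n)) F \<le> e"
proof -
  let ?f = "hs_weight s x"
  have sm: "?f summable_on UNIV" by (rule hs_b_imp_norm[OF assms(1)])
  have "(sum ?f \<longlongrightarrow> infsum ?f UNIV) (finite_subsets_at_top UNIV)"
    using has_sum_infsum[OF sm] by (simp add: has_sum_def)
  from tendstoD[OF this, of "e\<^sup>2"] assms(2)
  obtain X where X: "finite X" "\<And>Y. finite Y \<Longrightarrow> X \<subseteq> Y \<Longrightarrow> dist (sum ?f Y) (infsum ?f UNIV) < e\<^sup>2"
    by (auto simp: eventually_finite_subsets_at_top)
  define L where "L = nat (Max (insert 0 (abs ` X)))"
  have "X \<subseteq> {- int L..int L}"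
  proof
    fix n assume "n \<in> X"
    then have "\<bar>n\<bar> \<le> Max (insert 0 (abs ` X))" using X(1) by (intro Max_ge) auto
    then show "n \<in> {- int L..int L}" unfolding L_def by auto
  qed
  show ?thesis
  proof (rule that)
    fix F :: "int set" assume F: "finite F" "F \<inter> {- int L..int L} = {}"
    then have "F \<inter> X = {}" using \<open>X \<subseteq> _\<close> by auto
    have "sum ?f (F \<union> X) \<le> infsum ?f UNIV"
      by (intro finite_sum_le_infsum sm) (use F X in \<open>auto simp: hs_weight_W\<close>)
    moreover have "infsum ?f UNIV - e\<^sup>2 < sum ?f X" using X(2)[of X] X(1) by (auto simp: dist_real_def)
    moreover have "sum ?f (F \<union> X) = sum ?f F + sum ?f X"
      by (rule sum.union_disjoint) (use F X \<open>F \<inter> X = {}\<close> in auto)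
    ultimately have "sum ?f F \<le> e\<^sup>2" by linarith
    then show "L2_set (\<lambda>n. W s n * cmod (x n)) F \<le> e"
      unfolding L2_set_def using assms(2) by (intro real_le_lsqrt) (auto simp: hs_weight_W intro: sum_nonneg)
  qed
qed

text \<open>The factors \<open>\<rho>\<close> are differences of two phases, under control only at
  low frequencies; beyond \<open>L\<close> the trivial bound 2 is paid with the tail.\<close>

lemma phase_perturbation:
  assumes x: "hs_b s x B"
    and tail: "\<And>F. finite F \<Longrightarrow> F \<inter> {- int L..int L} = {} \<Longrightarrow> L2_set (\<lambda>n. W s n * cmod (x n)) F \<le> e"
    and \<rho>: "\<And>n. cmod (\<rho> n) \<le> 2" "\<And>n. n \<in> {- int L..int L} \<Longrightarrow> cmod (\<rho> n) \<le> \<kappa>" "\<kappa> \<ge> 0"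
  shows "hs_b s (\<lambda>n. \<rho> n * x n) (\<kappa> * B + 2 * e)"
  unfolding l2b_def
proof (intro allI impI)
  fix F :: "int set" assume F: "finite F"
  let ?I = "{- int L..int L}"
  define a where "a n = (if n \<in> ?I then \<kappa> * (W s n * cmod (x n)) else 0)" for n
  define b where "b n = (if n \<in> ?I then 0 else 2 * (W s n * cmod (x n)))" for n
  have "L2_set (\<lambda>n. W s n * cmod (\<rho> n * x n)) F \<le> L2_set (\<lambda>n. a n + b n) F"
  proof (rule L2_set_mono)
    fix n
    have "cmod (\<rho> n) * (W s n * cmod (x n)) \<le> (if n \<in> ?I then \<kappa> else 2) * (W s n * cmod (x n))"
      by (intro mult_right_mono) (use \<rho> in auto)
    then show "W s n * cmod (\<rho> n * x n) \<le> a n + b n"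
      by (auto simp: a_def b_def norm_mult mult_ac)
  qed simp
  also have "\<dots> \<le> L2_set a F + L2_set b F" by (rule L2_set_triangle_ineq)
  also have "L2_set a F \<le> L2_set (\<lambda>n. \<kappa> * (W s n * cmod (x n))) F"
    by (rule L2_set_mono) (use \<rho>(3) in \<open>auto simp: a_def\<close>)
  also have "\<dots> = \<kappa> * L2_set (\<lambda>n. W s n * cmod (x n)) F" using \<rho>(3) by (simp add: L2_set_right_distrib)
  also have "\<dots> \<le> \<kappa> * B" by (intro mult_left_mono l2bD[OF x F] \<rho>)
  also have "L2_set b F = L2_set b (F - ?I)"
    unfolding L2_set_def by (rule arg_cong[where f = sqrt], rule sum.mono_neutral_right) (use F in \<open>auto simp: b_def\<close>)
  also have "\<dots> = L2_set (\<lambda>n. 2 * (W s n * cmod (x n))) (F - ?I)"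
    by (rule L2_set_cong) (auto simp: b_def)
  also have "\<dots> = 2 * L2_set (\<lambda>n. W s n * cmod (x n)) (F - ?I)" by (simp add: L2_set_right_distrib)
  also have "\<dots> \<le> 2 * e" using tail[of "F - ?I"] F by auto
  finally show "L2_set (\<lambda>n. W s n * cmod (\<rho> n * x n)) F \<le> \<kappa> * B + 2 * e" by simp
qed

definition cub :: "(int \<Rightarrow> int \<Rightarrow> int \<Rightarrow> complex) \<Rightarrow> (int \<Rightarrow> complex) \<Rightarrow> int \<Rightarrow> (int \<times> int) \<Rightarrow> complex" where
  "cub M x n = (\<lambda>(k,j). M k j (n-k-j) * x k * x j * x (n-k-j))"

abbreviation cub1 :: "(int \<Rightarrow> complex) \<Rightarrow> int \<Rightarrow> int \<times> int \<Rightarrow> complex" where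
  "cub1 \<equiv> cub (\<lambda>_ _ _. 1)"

lemma tri_cub: "tri D M x x x n = sum (cub M x n) (D n)"
  by (simp add: tri_def cub_def)

section \<open>Absolute convergence of the cubic sums\<close>

context mkaw
begin

text \<open>Half of the excess of \<open>s\<close> over 1/2. Since 2 (s - gap) > 1, the coefficients
  are summable even with the weight \<open>W gap\<close>, which gives tails a decay rate.\<close>

definition gap :: real where "gap = (s - 1/2) / 2"

lemma gap_pos: "gap > 0" using s by (simp add: gap_def)

lemma l1_ex: "\<exists>C\<ge>1. \<forall>x B F. hs_b s x B \<longrightarrow> finite F \<longrightarrow> (\<Sum>n\<in>F. W gap n * cmod (x n)) \<le> C * B"
proof -
  have "2 * (s - gap) > 1" using s by (simp add: gap_def field_simps)
  from W_sum_bounded[OF this] obtain C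
    where C: "C \<ge> 1" "\<And>F. finite F \<Longrightarrow> (\<Sum>n\<in>F. W (-(2 * (s - gap))) n) \<le> C" by auto
  show ?thesis
  proof (intro exI[of _ "sqrt C"] conjI allI impI)
    show "1 \<le> sqrt C" using C(1) by simp
    fix x :: "int \<Rightarrow> complex" and B and F :: "int set"
    assume x: "hs_b s x B" and F: "finite F"
    have "l2b (\<lambda>n. W (s - gap) n * (W gap n * cmod (x n))) B"
      using x by (simp add: mult.assoc[symmetric] W_mult)
    from l1_le[OF C(2) this F] show "(\<Sum>n\<in>F. W gap n * cmod (x n)) \<le> sqrt C * B"
      by (simp add: abs_mult)
  qed
qed

definition l1_const :: real where
  "l1_const = (SOME C. C \<ge> 1 \<and> (\<forall>x B F. hs_b s x B \<longrightarrow> finite F \<longrightarrow> (\<Sum>n\<in>F. W gap n * cmod (x n)) \<le> C * B))"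

lemma l1_const: "l1_const \<ge> 1" "hs_b s x B \<Longrightarrow> finite F \<Longrightarrow> (\<Sum>n\<in>F. W gap n * cmod (x n)) \<le> l1_const * B"
  using someI_ex[OF l1_ex] unfolding l1_const_def[symmetric] by blast+

lemma l1_b: 
  assumes "hs_b s x B" "finite F"
  shows "(\<Sum>n\<in>F. cmod (x n)) \<le> l1_const * B"
proof -
  have "(\<Sum>n\<in>F. cmod (x n)) \<le> (\<Sum>n\<in>F. W gap n * cmod (x n))"
  proof (rule sum_mono)
    fix n show "cmod (x n) \<le> W gap n * cmod (x n)"
      using mult_right_mono[OF W_ge_1[of gap n] norm_ge_zero[of "x n"]] gap_pos by simp
  qed
  also have "\<dots> \<le> l1_const * B" by (rule l1_const(2)[OF assms])
  finally show ?thesis .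
qed

text \<open>The factor 2 accounts for the two ways to leave a box: through \<open>k\<close> or
  through \<open>j\<close>.\<close>

definition tail_rate :: "nat \<Rightarrow> real" where "tail_rate L = 2 * (real L + 1) powr (- gap)"

lemma tail_rate_lim: "tail_rate \<longlonglongrightarrow> 0"
  unfolding tail_rate_def using gap_pos by real_asymp


lemma pair_sum_le:
  fixes f g h :: "int \<Rightarrow> real"
  assumes "finite P"
    and "\<And>F. finite F \<Longrightarrow> sum f F \<le> X" "\<And>F. finite F \<Longrightarrow> sum g F \<le> Y" "\<And>F. finite F \<Longrightarrow> sum h F \<le> Z"
    and "\<And>n. f n \<ge> 0" "\<And>n. g n \<ge> 0" "\<And>n. h n \<ge> 0"
  shows "(\<Sum>(k,j)\<in>P. f k * g j * h (n-k-j)) \<le> X * Y * Z"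
proof -
  let ?P = "(\<lambda>(k,j). (k,j,n-k-j)) ` P"
  have "(\<Sum>(k,j)\<in>P. f k * g j * h (n-k-j)) = (\<Sum>(a,b,d)\<in>?P. f a * g b * h d)"
    by (subst sum.reindex) (auto simp: inj_on_def intro!: sum.cong)
  also have "\<dots> \<le> X * Y * Z" by (rule sum_prod_le_box) (use assms in auto)
  finally show ?thesis .
qed

lemma cub_norm_le:
  assumes "\<And>a b d. cmod (M a b d) \<le> 1"
  shows "cmod (cub M x n (k,j)) \<le> cmod (x k) * cmod (x j) * cmod (x (n-k-j))"
  unfolding cub_def norm_mult prod.case
  by (intro mult_right_mono) (use assms[of k j "n-k-j"] in \<open>auto intro: mult_left_le_one_le\<close>)

lemma cub_sum_le:
  assumes x: "hs_b s x R" and M: "\<And>a b d. cmod (M a b d) \<le> 1" and P: "finite P"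
  shows "(\<Sum>p\<in>P. cmod (cub M x n p)) \<le> (l1_const * R)^3"
proof -
  have "(\<Sum>p\<in>P. cmod (cub M x n p)) \<le> (\<Sum>(k,j)\<in>P. cmod (x k) * cmod (x j) * cmod (x (n-k-j)))"
    by (rule sum_mono) (use cub_norm_le[where M = M, OF M] in auto)
  also have "\<dots> \<le> (l1_const * R) * (l1_const * R) * (l1_const * R)"
    by (rule pair_sum_le[OF P]) (auto intro: l1_b[OF x])
  finally show ?thesis by (simp add: power3_eq_cube)
qed

lemma W_gap_ge:
  assumes "k \<notin> {- int L..int L}"
  shows "1 \<le> (real L + 1) powr (- gap) * W gap k"
proof -
  have "\<bar>k\<bar> \<ge> int L + 1" using assms by auto
  then have "real L + 1 \<le> \<bar>real_of_int k\<bar>" by linarith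
  then have "(real L + 1)\<^sup>2 \<le> \<bar>real_of_int k\<bar>\<^sup>2" by (intro power_mono) auto
  then have "((real L + 1)\<^sup>2) powr (gap/2) \<le> W gap k"
    unfolding W_def using gap_pos by (intro powr_mono2) auto
  moreover have e: "((real L + 1)\<^sup>2) powr (gap/2) = (real L + 1) powr gap"
    using powr_powr[of "real L + 1" 2 "gap/2"] by simp
  ultimately have "(real L + 1) powr gap \<le> W gap k" by (simp only: e)
  from mult_left_mono[OF this powr_ge_zero[of "real L + 1" "- gap"]]
  show ?thesis by (simp add: powr_add[symmetric])
qed

text \<open>Outside the box \<open>k\<close> or \<open>j\<close> exceeds \<open>L\<close>, and its
  weight \<open>W gap\<close> pays for the decay. The bound depends on \<open>R\<close> alone and is
  thus uniform in \<open>n\<close>, in the multiplier and later in time.\<close>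

lemma cub_tail_le:
  assumes x: "hs_b s x R" and M: "\<And>a b d. cmod (M a b d) \<le> 1" and P: "finite P" "P \<inter> box L = {}"
  shows "(\<Sum>p\<in>P. cmod (cub M x n p)) \<le> tail_rate L * (l1_const * R)^3"
proof -
  let ?l = "(real L + 1) powr (- gap)"
  let ?f = "\<lambda>k. W gap k * cmod (x k)" and ?g = "\<lambda>k. cmod (x k)"
  have "(\<Sum>p\<in>P. cmod (cub M x n p)) \<le> (\<Sum>(k,j)\<in>P. ?l * (?f k * ?g j * ?g (n-k-j) + ?g k * ?f j * ?g (n-k-j)))"
  proof (rule sum_mono, clarify)
    fix k j assume "(k,j) \<in> P"
    then have "k \<notin> {- int L..int L} \<or> j \<notin> {- int L..int L}" using P(2) by (auto simp: box_def)
    then have "1 \<le> ?l * W gap k + ?l * W gap j"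
    proof
      assume "k \<notin> {- int L..int L}"
      then show ?thesis by (intro add_increasing2 mult_nonneg_nonneg W_gap_ge) auto
    next
      assume "j \<notin> {- int L..int L}"
      then show ?thesis by (intro add_increasing mult_nonneg_nonneg W_gap_ge) auto
    qed
    from mult_right_mono[OF this, of "?g k * ?g j * ?g (n-k-j)"]
    have "?g k * ?g j * ?g (n-k-j) \<le> ?l * (?f k * ?g j * ?g (n-k-j) + ?g k * ?f j * ?g (n-k-j))"
      by (simp add: algebra_simps)
    with cub_norm_le[where M = M, OF M]
    show "cmod (cub M x n (k,j)) \<le> ?l * (?f k * ?g j * ?g (n-k-j) + ?g k * ?f j * ?g (n-k-j))"
      by (rule order_trans)
  qed
  also have "\<dots> = ?l * ((\<Sum>(k,j)\<in>P. ?f k * ?g j * ?g (n-k-j)) + (\<Sum>(k,j)\<in>P. ?g k * ?f j * ?g (n-k-j)))"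
    by (simp add: sum_distrib_left[symmetric] sum.distrib[symmetric] case_prod_unfold)
  also have "\<dots> \<le> ?l * ((l1_const * R) * (l1_const * R) * (l1_const * R) + (l1_const * R) * (l1_const * R) * (l1_const * R))"
    by (intro mult_left_mono add_mono pair_sum_le[OF P(1)]) (auto intro: l1_b[OF x] l1_const(2)[OF x])
  finally show ?thesis by (simp add: tail_rate_def power3_eq_cube mult_ac)
qed

lemma cub_abs_summable:
  assumes "hs_b s x R" "\<And>a b d. cmod (M a b d) \<le> 1"
  shows "(\<lambda>p. cmod (cub M x n p)) summable_on Z"
  unfolding abs_summable_iff_bdd_above
  by (rule bdd_aboveI2[where M = "(l1_const * R)^3"]) (use cub_sum_le[OF assms] in auto)

lemma cub_summable:
  assumes "hs_b s x R" "\<And>a b d. cmod (M a b d) \<le> 1"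
  shows "cub M x n summable_on Z"
  by (rule abs_summable_summable[OF cub_abs_summable[OF assms]])

lemma cub_infsum_tail:
  assumes "hs_b s x R" "\<And>a b d. cmod (M a b d) \<le> 1"
  shows "cmod (infsum (cub M x n) Z - sum (cub M x n) (Z \<inter> box L)) \<le> tail_rate L * (l1_const * R)^3"
proof -
  note sm = cub_summable[OF assms]
  have "infsum (cub M x n) Z = infsum (cub M x n) ((Z \<inter> box L) \<union> (Z - box L))"
    by (rule arg_cong[where f = "infsum _"]) auto
  also have "\<dots> = infsum (cub M x n) (Z \<inter> box L) + infsum (cub M x n) (Z - box L)"
    by (rule infsum_Un_disjoint[OF sm sm]) auto
  finally have "infsum (cub M x n) Z - sum (cub M x n) (Z \<inter> box L) = infsum (cub M x n) (Z - box L)"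
    by simp
  moreover have "cmod (infsum (cub M x n) (Z - box L)) \<le> infsum (\<lambda>p. cmod (cub M x n p)) (Z - box L)"
    by (rule norm_infsum_bound[OF cub_abs_summable[OF assms]])
  moreover have "\<dots> \<le> tail_rate L * (l1_const * R)^3"
    by (rule infsum_le_finite_sums[OF cub_abs_summable[OF assms]])
       (rule cub_tail_le[OF assms], auto)
  ultimately show ?thesis by simp
qed

text \<open>Absolute summability over pairs merges the iterated sums of the two
  convolutions.\<close>

lemma fcube_eq_infsum:
  assumes x: "hs_b s x R"
  shows "fcube x n = of_real (1 / (4 * pi\<^sup>2)) * infsum (cub1 x n) UNIV"
proof -
  let ?f = "cub1 x n"
  have sm: "?f summable_on UNIV \<times> UNIV" using cub_summable[OF x, of "\<lambda>_ _ _. 1"] by simp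
  have "fcube x n = (1 / (2 * of_real pi)) * (\<Sum>\<^sub>\<infinity>k. x k * ((1 / (2 * of_real pi)) * (\<Sum>\<^sub>\<infinity>j. x j * x (n-k-j))))"
    by (simp add: fcube_def fconv_def)
  also have "(\<lambda>k. x k * ((1 / (2 * of_real pi)) * (\<Sum>\<^sub>\<infinity>j. x j * x (n-k-j))))
     = (\<lambda>k. (1 / (2 * of_real pi)) * (\<Sum>\<^sub>\<infinity>j. ?f (k,j)))"
    by (simp add: cub_def mult.assoc infsum_cmult_right' mult.left_commute)
  also have "(\<Sum>\<^sub>\<infinity>k. (1 / (2 * of_real pi)) * (\<Sum>\<^sub>\<infinity>j. ?f (k,j))) = (1 / (2 * of_real pi)) * (\<Sum>\<^sub>\<infinity>k. \<Sum>\<^sub>\<infinity>j. ?f (k,j))"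
    by (rule infsum_cmult_right')
  also have "(\<Sum>\<^sub>\<infinity>k. \<Sum>\<^sub>\<infinity>j. ?f (k,j)) = infsum ?f (UNIV \<times> UNIV)"
    by (rule infsum_Sigma_banach[OF sm])
  finally show ?thesis by (simp add: power2_eq_square)
qed

definition mass :: "(int \<Rightarrow> complex) \<Rightarrow> real" where
  "mass x = (\<Sum>\<^sub>\<infinity>k. (cmod (x k))\<^sup>2)"

lemma sq_sum_le:
  assumes "hs_b s x R" "finite F"
  shows "(\<Sum>k\<in>F. (cmod (x k))\<^sup>2) \<le> R\<^sup>2"
proof -
  have "l2b (\<lambda>n. cmod (x n)) R"
  proof (rule l2b_mono[OF assms(1)])
    fix n show "\<bar>cmod (x n)\<bar> \<le> \<bar>W s n * cmod (x n)\<bar>"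
      using mult_right_mono[OF W_ge_1[of s n] norm_ge_zero[of "x n"]] s by simp
  qed
  from l2b_sum_sq[OF this assms(2)] show ?thesis .
qed

lemma sq_summable:
  assumes "hs_b s x R"
  shows "(\<lambda>k. (cmod (x k))\<^sup>2) summable_on Z"
  by (rule nonneg_bdd_above_summable_on) (auto intro!: bdd_aboveI2[where M = "R\<^sup>2"] sq_sum_le[OF assms])

lemma mass_tail:
  assumes "hs_b s x R"
  shows "\<bar>mass x - (\<Sum>k\<in>{- int L..int L}. (cmod (x k))\<^sup>2)\<bar> \<le> tail_rate L * (l1_const * R * R)"
proof -
  let ?f = "\<lambda>k. (cmod (x k))\<^sup>2" let ?I = "{- int L..int L}"
  note sm = sq_summable[OF assms]
  have R: "R \<ge> 0" using assms by (rule l2b_nonneg)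
  have "mass x = infsum ?f (?I \<union> (UNIV - ?I))" unfolding mass_def by (rule arg_cong[where f = "infsum _"]) auto
  also have "\<dots> = infsum ?f ?I + infsum ?f (UNIV - ?I)" by (rule infsum_Un_disjoint[OF sm sm]) auto
  finally have eq: "mass x - sum ?f ?I = infsum ?f (UNIV - ?I)" by simp
  let ?l = "(real L + 1) powr (- gap)"
  have "infsum ?f (UNIV - ?I) \<le> ?l * (l1_const * R * R)"
  proof (rule infsum_le_finite_sums[OF sm])
    fix F assume F: "finite F" "F \<subseteq> UNIV - ?I"
    have "sum ?f F \<le> (\<Sum>k\<in>F. ?l * R * (W gap k * cmod (x k)))"
    proof (rule sum_mono)
      fix k assume "k \<in> F"
      then have 1: "1 \<le> ?l * W gap k" using F(2) by (intro W_gap_ge) auto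
      have "cmod (x k) * cmod (x k) \<le> (?l * W gap k * R) * cmod (x k)"
      proof (rule mult_right_mono)
        have "cmod (x k) \<le> R" by (rule cmod_le[OF assms])
        also have "\<dots> \<le> ?l * W gap k * R" using mult_right_mono[OF 1 R] by simp
        finally show "cmod (x k) \<le> ?l * W gap k * R" .
      qed simp
      then show "?f k \<le> ?l * R * (W gap k * cmod (x k))" by (simp add: power2_eq_square mult_ac)
    qed
    also have "\<dots> = ?l * R * (\<Sum>k\<in>F. W gap k * cmod (x k))" by (simp add: sum_distrib_left)
    also have "\<dots> \<le> ?l * R * (l1_const * R)" by (intro mult_left_mono l1_const(2)[OF assms F(1)]) (use R in auto)
    finally show "sum ?f F \<le> ?l * (l1_const * R * R)" by (simp add: mult_ac)
  qed
  moreover have "infsum ?f (UNIV - ?I) \<ge> 0" by (rule infsum_nonneg) auto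
  moreover have "?l * (l1_const * R * R) \<le> tail_rate L * (l1_const * R * R)"
    unfolding tail_rate_def using l1_const(1) R by (intro mult_right_mono) auto
  ultimately show ?thesis unfolding eq by simp
qed

section \<open>Resonant pairs and continuity of the cubic sum\<close>

definition NR :: "int \<Rightarrow> (int \<times> int) set" where
  "NR n = {(k,j). PP k j (n-k-j) \<noteq> 0}"

lemma NR_box: "NR n \<inter> box L = Dall L n"
  by (auto simp: NR_def Dall_def)

text \<open>The pairs with \<open>PP = 0\<close> form three lines: two of the three frequencies
  cancel and the third equals \<open>n\<close>. As \<open>x\<close> is real valued, each line sums
  to the mass times \<open>x n\<close>; the pairs counted more than once account for the three
  copies of |x_n|^2.\<close>

lemma resonant_sum:
  assumes x: "hs_b s x R" and re: "real_valued x" and n: "n \<noteq> 0"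
  shows "infsum (cub1 x n) UNIV
    = infsum (cub1 x n) (NR n) + (3 * of_real (mass x) - 3 * of_real ((cmod (x n))\<^sup>2)) * x n"
proof -
  let ?f = "cub1 x n"
  have xm: "x (- k) = cnj (x k)" for k using re by (simp add: real_valued_def)
  have xx: "x k * x (- k) = of_real ((cmod (x k))\<^sup>2)" for k unfolding xm by (rule complex_norm_square[symmetric])
  have M: "((\<lambda>k. of_real ((cmod (x k))\<^sup>2) :: complex) has_sum of_real (mass x)) UNIV"
    unfolding mass_def by (rule has_sum_of_real[OF has_sum_infsum[OF sq_summable[OF x]]])
  have less: "((\<lambda>k. of_real ((cmod (x k))\<^sup>2) :: complex) has_sum (of_real (mass x) - (\<Sum>k\<in>B. of_real ((cmod (x k))\<^sup>2)))) (UNIV - B)"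
    if "finite B" for B
    by (rule has_sum_Diff[OF M has_sum_finite[OF that]]) auto
  \<comment> \<open>Disjoint versions of the three lines. Their common points are (n,-n), (-n,n) and
    (n,n), distinct since \<open>n\<close> is nonzero; \<open>L2\<close> drops one point and
    \<open>L3\<close> two.\<close>
  define L1 where "L1 = range (\<lambda>k::int. (k, - k))"
  define L2 where "L2 = (\<lambda>j. (n, j)) ` (UNIV - {- n})"
  define L3 where "L3 = (\<lambda>k. (k, n)) ` (UNIV - {n, - n})"
  have res: "- NR n = L1 \<union> L2 \<union> L3"
    using n by (auto simp: NR_def L1_def L2_def L3_def PP_def image_iff)
  have 1: "(?f has_sum (of_real (mass x) * x n)) L1"
    unfolding L1_def
  proof (subst has_sum_reindex)
    show "inj (\<lambda>k::int. (k, - k))" by (auto simp: inj_on_def)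
    have "?f \<circ> (\<lambda>k. (k, - k)) = (\<lambda>k. of_real ((cmod (x k))\<^sup>2) * x n)"
    proof (rule ext)
      fix k
      have "(?f \<circ> (\<lambda>k. (k, - k))) k = (x k * x (- k)) * x n" by (simp add: cub_def)
      then show "(?f \<circ> (\<lambda>k. (k, - k))) k = of_real ((cmod (x k))\<^sup>2) * x n" by (simp only: xx)
    qed
    then show "(?f \<circ> (\<lambda>k. (k, - k)) has_sum (of_real (mass x) * x n)) UNIV"
      using has_sum_cmult_left[OF M, of "x n"] by simp
  qed
  have 2: "(?f has_sum ((of_real (mass x) - of_real ((cmod (x n))\<^sup>2)) * x n)) L2"
    unfolding L2_def
  proof (subst has_sum_reindex)
    show "inj_on (\<lambda>j::int. (n, j)) (UNIV - {- n})" by (auto simp: inj_on_def)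
    have "?f \<circ> (\<lambda>j. (n, j)) = (\<lambda>k. of_real ((cmod (x k))\<^sup>2) * x n)"
    proof (rule ext)
      fix k
      have "(?f \<circ> (\<lambda>j. (n, j))) k = (x k * x (- k)) * x n" by (simp add: cub_def mult_ac)
      then show "(?f \<circ> (\<lambda>j. (n, j))) k = of_real ((cmod (x k))\<^sup>2) * x n" by (simp only: xx)
    qed
    then show "(?f \<circ> (\<lambda>j. (n, j)) has_sum ((of_real (mass x) - of_real ((cmod (x n))\<^sup>2)) * x n)) (UNIV - {- n})"
      using has_sum_cmult_left[OF less[of "{- n}"], of "x n"] by (simp add: xm)
  qed
  have 3: "(?f has_sum ((of_real (mass x) - 2 * of_real ((cmod (x n))\<^sup>2)) * x n)) L3"
    unfolding L3_def
  proof (subst has_sum_reindex)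
    show "inj_on (\<lambda>k::int. (k, n)) (UNIV - {n, - n})" by (auto simp: inj_on_def)
    have "?f \<circ> (\<lambda>k. (k, n)) = (\<lambda>k. of_real ((cmod (x k))\<^sup>2) * x n)"
    proof (rule ext)
      fix k
      have "n - k - n = - k" by simp
      then have "(?f \<circ> (\<lambda>k. (k, n))) k = (x k * x (- k)) * x n" by (simp add: cub_def mult_ac)
      then show "(?f \<circ> (\<lambda>k. (k, n))) k = of_real ((cmod (x k))\<^sup>2) * x n" by (simp only: xx)
    qed
    moreover have "(\<Sum>k\<in>{n, - n}. of_real ((cmod (x k))\<^sup>2) :: complex) = 2 * of_real ((cmod (x n))\<^sup>2)"
      using n by (simp add: xm)
    ultimately show "(?f \<circ> (\<lambda>k. (k, n)) has_sum ((of_real (mass x) - 2 * of_real ((cmod (x n))\<^sup>2)) * x n)) (UNIV - {n, - n})"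
      using has_sum_cmult_left[OF less[of "{n, - n}"], of "x n"] by simp
  qed
  have d: "L1 \<inter> L2 = {}" "(L1 \<union> L2) \<inter> L3 = {}"
    using n by (auto simp: L1_def L2_def L3_def)
  have "(?f has_sum (of_real (mass x) * x n + (of_real (mass x) - of_real ((cmod (x n))\<^sup>2)) * x n
    + (of_real (mass x) - 2 * of_real ((cmod (x n))\<^sup>2)) * x n)) (- NR n)"
    unfolding res by (rule has_sum_Un_disjoint[OF has_sum_Un_disjoint[OF 1 2 d(1)] 3 d(2)])
  from has_sum_Un_disjoint[OF has_sum_infsum[OF cub_summable[OF x, of "\<lambda>_ _ _. 1" n "NR n"]] this]
  have "(?f has_sum (infsum ?f (NR n) + (of_real (mass x) * x n + (of_real (mass x) - of_real ((cmod (x n))\<^sup>2)) * x n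
    + (of_real (mass x) - 2 * of_real ((cmod (x n))\<^sup>2)) * x n))) UNIV"
    by simp
  then show ?thesis by (subst infsumI) (auto simp: algebra_simps)
qed

text \<open>Finite box sums converge uniformly in time because the tail bound involves only
  \<open>R\<close>. Continuity of each single coefficient is enough.\<close>

lemma continuous_infsum_cub:
  assumes x: "\<And>t. t \<in> S \<Longrightarrow> hs_b s (x t) R" and c: "\<And>n. continuous_on S (\<lambda>t. x t n)"
  shows "continuous_on S (\<lambda>t. infsum (cub1 (x t) n) UNIV)"
proof (rule uniform_limit_theorem[where F = sequentially])
  show "\<forall>\<^sub>F L in sequentially. continuous_on S (\<lambda>t. sum (cub1 (x t) n) (box L))"
    by (intro always_eventually allI continuous_on_sum)
       (auto simp: cub_def intro!: continuous_intros c)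
  show "uniform_limit S (\<lambda>L t. sum (cub1 (x t) n) (box L)) (\<lambda>t. infsum (cub1 (x t) n) UNIV) sequentially"
  proof (rule uniform_limitI)
    fix e :: real assume e: "e > 0"
    have "(\<lambda>L. tail_rate L * (l1_const * R)^3) \<longlonglongrightarrow> 0 * (l1_const * R)^3" by (intro tendsto_intros tail_rate_lim)
    then have "\<forall>\<^sub>F L in sequentially. tail_rate L * (l1_const * R)^3 < e" using e by (auto dest: order_tendstoD)
    then show "\<forall>\<^sub>F L in sequentially. \<forall>t\<in>S. dist (sum (cub1 (x t) n) (box L)) (infsum (cub1 (x t) n) UNIV) < e"
    proof (rule eventually_mono, intro ballI)
      fix L t assume L: "tail_rate L * (l1_const * R)^3 < e" and t: "t \<in> S"
      have "cmod (infsum (cub1 (x t) n) UNIV - sum (cub1 (x t) n) (UNIV \<inter> box L)) \<le> tail_rate L * (l1_const * R)^3"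
        by (rule cub_infsum_tail[OF x[OF t]]) simp
      then show "dist (sum (cub1 (x t) n) (box L)) (infsum (cub1 (x t) n) UNIV) < e"
        using L by (simp add: dist_norm norm_minus_commute)
    qed
  qed
qed simp

lemma continuous_mass:
  assumes x: "\<And>t. t \<in> S \<Longrightarrow> hs_b s (x t) R" and c: "\<And>n. continuous_on S (\<lambda>t. x t n)"
  shows "continuous_on S (\<lambda>t. mass (x t))"
proof (rule uniform_limit_theorem[where F = sequentially])
  show "\<forall>\<^sub>F L in sequentially. continuous_on S (\<lambda>t. \<Sum>k\<in>{- int L..int L}. (cmod (x t k))\<^sup>2)"
    by (intro always_eventually allI continuous_intros c)
  show "uniform_limit S (\<lambda>L t. \<Sum>k\<in>{- int L..int L}. (cmod (x t k))\<^sup>2) (\<lambda>t. mass (x t)) sequentially"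
  proof (rule uniform_limitI)
    fix e :: real assume e: "e > 0"
    have "(\<lambda>L. tail_rate L * (l1_const * R * R)) \<longlonglongrightarrow> 0 * (l1_const * R * R)" by (intro tendsto_intros tail_rate_lim)
    then have "\<forall>\<^sub>F L in sequentially. tail_rate L * (l1_const * R * R) < e" using e by (auto dest: order_tendstoD)
    then show "\<forall>\<^sub>F L in sequentially. \<forall>t\<in>S. dist (\<Sum>k\<in>{- int L..int L}. (cmod (x t k))\<^sup>2) (mass (x t)) < e"
    proof (rule eventually_mono, intro ballI)
      fix L t assume "tail_rate L * (l1_const * R * R) < e" "t \<in> S"
      then show "dist (\<Sum>k\<in>{- int L..int L}. (cmod (x t k))\<^sup>2) (mass (x t)) < e"
        using mass_tail[OF x[of t], of L] by (simp add: dist_real_def abs_minus_commute)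
    qed
  qed
qed simp

end

section \<open>The gauge transformation\<close>

lemma cmod_cis_diff_le: "cmod (cis a - cis b) \<le> \<bar>a - b\<bar>"
proof -
  have arg: "2 * ((a - b) / 2) = a - b" by simp
  have "(cmod (cis a - cis b))\<^sup>2 = (cos a - cos b)\<^sup>2 + (sin a - sin b)\<^sup>2"
    by (simp add: cmod_power2)
  also have "\<dots> = 2 - 2 * (cos a * cos b + sin a * sin b)"
    using sin_cos_squared_add[of a] sin_cos_squared_add[of b]
    by (simp add: power2_eq_square algebra_simps)
  also have "\<dots> = 2 - 2 * cos (2 * ((a - b) / 2))" by (simp only: arg cos_diff)
  also have "\<dots> = 4 * (sin ((a - b) / 2))\<^sup>2" by (simp only: cos_double_sin) simp
  also have "\<dots> \<le> 4 * ((a - b) / 2)\<^sup>2"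
    using abs_sin_x_le_abs_x[of "(a - b) / 2"] by (intro mult_left_mono) (auto simp only: abs_le_square_iff)
  also have "\<dots> = \<bar>a - b\<bar>\<^sup>2" by (simp add: power_divide)
  finally show ?thesis by (rule power2_le_imp_le) simp
qed

context mkaw
begin

definition gauge_angle :: "(real \<Rightarrow> int \<Rightarrow> complex) \<Rightarrow> real \<Rightarrow> real" where
  "gauge_angle v t = 3 * c * integral {0..t} (\<lambda>\<tau>. mass (v \<tau>))"

definition total_phase :: "(real \<Rightarrow> int \<Rightarrow> complex) \<Rightarrow> real \<Rightarrow> int \<Rightarrow> real" where
  "total_phase v t n = t * phase \<beta> \<gamma> n + real_of_int n * gauge_angle v t"

definition gauge :: "(real \<Rightarrow> int \<Rightarrow> complex) \<Rightarrow> real \<Rightarrow> int \<Rightarrow> complex" where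
  "gauge v t n = cis (- total_phase v t n) * v t n"

lemma gauge_inverse: "v t n = cis (total_phase v t n) * gauge v t n"
  by (simp add: gauge_def cis_mult mult.assoc[symmetric])

lemma norm_gauge [simp]: "cmod (gauge v t n) = cmod (v t n)"
  by (simp add: gauge_def norm_mult)

text \<open>Bounded in \<open>H^s\<close>, but with no continuity in time: this is all that the
  limit of the Galerkin solutions is known to satisfy at first.\<close>

definition wsol :: "real \<Rightarrow> real \<Rightarrow> (int \<Rightarrow> complex) \<Rightarrow> (real \<Rightarrow> int \<Rightarrow> complex) \<Rightarrow> bool" where
  "wsol T R v0 v \<longleftrightarrow> (\<forall>t\<in>{0..T}. real_valued (v t) \<and> hs_b s (v t) R) \<and> duhamel \<beta> \<gamma> (12 * pi\<^sup>2 * c) T v0 v"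

text \<open>Removing the linear flow makes the Duhamel integrand independent of the end point. A
  bootstrap follows: an indefinite integral is continuous, so the coefficients of \<open>v\<close>
  are, hence so is the integrand, which makes the integral differentiable.\<close>

lemma wsol_interaction:
  assumes v: "wsol T R v0 v" and T: "T \<ge> 0"
  defines "h \<equiv> \<lambda>n \<tau>. cis (- (\<tau> * phase \<beta> \<gamma> n)) * (\<i> * of_int n * of_real c) * infsum (cub1 (v \<tau>) n) UNIV"
  shows "\<And>n. continuous_on {0..T} (\<lambda>t. v t n)" "\<And>n. continuous_on {0..T} (h n)"
    "\<And>n t. t \<in> {0..T} \<Longrightarrow> cis (- (t * phase \<beta> \<gamma> n)) * v t n = v0 n + integral {0..t} (h n)"
proof -
  have b: "hs_b s (v t) R" if "t \<in> {0..T}" for t using v that by (simp add: wsol_def)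
  have hF: "h n \<tau> = of_real (12 * pi\<^sup>2 * c / 3) * (cis (- (\<tau> * phase \<beta> \<gamma> n)) * (\<i> * of_int n) * fcube (v \<tau>) n)"
    if "\<tau> \<in> {0..T}" for n \<tau>
    unfolding fcube_eq_infsum[OF b[OF that]] h_def by (simp add: field_simps)
  have I: "(h n has_integral (cis (- (t * phase \<beta> \<gamma> n)) * v t n - v0 n)) {0..t}" if t: "t \<in> {0..T}" for n t
  proof -
    let ?p = "phase \<beta> \<gamma> n"
    from v t obtain I where I: "((\<lambda>\<tau>. exp (\<i> * complex_of_real ((t - \<tau>) * ?p)) * (\<i> * of_int n) * fcube (v \<tau>) n) has_integral I) {0..t}"
      and vI: "v t n = exp (\<i> * complex_of_real (t * ?p)) * v0 n + complex_of_real (12 * pi\<^sup>2 * c / 3) * I"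
      unfolding wsol_def duhamel_def by blast
    have ex: "exp (\<i> * complex_of_real x) = cis x" for x by (simp add: cis_conv_exp)
    let ?C = "cis (- (t * ?p)) * of_real (12 * pi\<^sup>2 * c / 3)"
    have "((\<lambda>\<tau>. ?C * (cis ((t - \<tau>) * ?p) * (\<i> * of_int n) * fcube (v \<tau>) n)) has_integral (?C * I)) {0..t}"
      by (rule has_integral_mult_right) (use I in \<open>simp only: ex\<close>)
    then have "(h n has_integral (?C * I)) {0..t}"
    proof (rule has_integral_eq[rotated])
      fix \<tau> assume "\<tau> \<in> {0..t}"
      then have "\<tau> \<in> {0..T}" using t by auto
      have "cis (- (t * ?p)) * cis ((t - \<tau>) * ?p) = cis (- (\<tau> * ?p))"
        by (simp add: cis_mult algebra_simps)
      moreover have "?C * (cis ((t - \<tau>) * ?p) * (\<i> * of_int n) * fcube (v \<tau>) n)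
        = of_real (12 * pi\<^sup>2 * c / 3) * ((cis (- (t * ?p)) * cis ((t - \<tau>) * ?p)) * (\<i> * of_int n) * fcube (v \<tau>) n)"
        by (simp only: mult_ac)
      ultimately have "?C * (cis ((t - \<tau>) * ?p) * (\<i> * of_int n) * fcube (v \<tau>) n)
        = of_real (12 * pi\<^sup>2 * c / 3) * (cis (- (\<tau> * ?p)) * (\<i> * of_int n) * fcube (v \<tau>) n)"
        by simp
      then show "?C * (cis ((t - \<tau>) * ?p) * (\<i> * of_int n) * fcube (v \<tau>) n) = h n \<tau>"
        by (simp only: hF[OF \<open>\<tau> \<in> {0..T}\<close>])
    qed
    moreover have "cis (- (t * ?p)) * v t n - v0 n = ?C * I"
      unfolding vI ex by (simp add: distrib_left mult.assoc[symmetric] cis_mult)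
    ultimately show ?thesis by simp
  qed
  show eq: "cis (- (t * phase \<beta> \<gamma> n)) * v t n = v0 n + integral {0..t} (h n)" if "t \<in> {0..T}" for n t
    using integral_unique[OF I[OF that]] by simp
  have int: "h n integrable_on {0..T}" for n using I[of T n] T by (auto simp: integrable_on_def)
  show cv: "continuous_on {0..T} (\<lambda>t. v t n)" for n
  proof -
    have "continuous_on {0..T} (\<lambda>t. cis (t * phase \<beta> \<gamma> n) * (v0 n + integral {0..t} (h n)))"
      by (intro continuous_intros indefinite_integral_continuous_1 int)
    then show ?thesis
    proof (rule continuous_on_eq)
      fix t assume "t \<in> {0..T}"
      from eq[OF this, of n, symmetric]
      show "cis (t * phase \<beta> \<gamma> n) * (v0 n + integral {0..t} (h n)) = v t n"
        by (simp add: mult.assoc[symmetric] cis_mult)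
    qed
  qed
  show "continuous_on {0..T} (h n)" for n
    unfolding h_def by (intro continuous_intros continuous_infsum_cub[where R = R] b cv)
qed

lemma continuous_gth:
  assumes "wsol T R v0 v" "T \<ge> 0"
  shows "\<And>t. t \<in> {0..T} \<Longrightarrow> (gauge_angle v has_vector_derivative (3 * c * mass (v t))) (at t within {0..T})"
    "continuous_on {0..T} (gauge_angle v)" "continuous_on {0..T} (\<lambda>t. mass (v t))"
proof -
  show m: "continuous_on {0..T} (\<lambda>t. mass (v t))"
    by (rule continuous_mass[where R = R]) (use assms wsol_interaction(1)[OF assms] in \<open>auto simp: wsol_def\<close>)
  show d: "(gauge_angle v has_vector_derivative (3 * c * mass (v t))) (at t within {0..T})" if "t \<in> {0..T}" for t
    unfolding gauge_angle_def[abs_def]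
    by (intro has_vector_derivative_mult_right integral_has_vector_derivative m that)
  show "continuous_on {0..T} (gauge_angle v)"
    unfolding continuous_on_eq_continuous_within using d has_vector_derivative_continuous by blast
qed

text \<open>The derivative of the gauge angle is three times \<open>c\<close> times the mass, which
  cancels the mass term of \<open>resonant_sum\<close>. The other phases combine into the
  oscillation \<open>osc\<close>.\<close>

lemma gauge_gsol:
  assumes v: "wsol T R v0 v" and T: "T \<ge> 0"
  obtains G where "gsol T R (gauge v) G"
proof -
  have b: "hs_b s (v t) R" and re: "real_valued (v t)" if "t \<in> {0..T}" for t
    using v that by (simp_all add: wsol_def)
  have bg: "hs_b s (gauge v t) R" if "t \<in> {0..T}" for t using b[OF that] by simp
  define G where "G t n = of_real c * (infsum (cub (osc t) (gauge v t) n) (NR n)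
    - 3 * of_real ((cmod (gauge v t n))\<^sup>2) * gauge v t n)" for t n
  have der: "((\<lambda>t. gauge v t n) has_vector_derivative (\<i> * of_int n * G t n)) (at t within {0..T})"
    if t: "t \<in> {0..T}" for n t
  proof -
    let ?p = "phase \<beta> \<gamma> n"
    define h where "h = (\<lambda>\<tau>. cis (- (\<tau> * ?p)) * (\<i> * of_int n * of_real c) * infsum (cub1 (v \<tau>) n) UNIV)"
    note wi = wsol_interaction[OF v T]
    have ch: "continuous_on {0..T} h" unfolding h_def by (rule wi(2))
    define q where "q t = v0 n + integral {0..t} h" for t
    have q: "q t = cis (- (t * ?p)) * v t n" if "t \<in> {0..T}" for t
      unfolding q_def h_def by (rule wi(3)[OF that, symmetric])
    have dq: "(q has_vector_derivative (0 + h t)) (at t within {0..T})"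
      unfolding q_def[abs_def]
      by (intro has_vector_derivative_add has_vector_derivative_const integral_has_vector_derivative ch t)
    have dc: "((\<lambda>t. cis (- (real_of_int n * gauge_angle v t))) has_vector_derivative
        (3 * c * mass (v t)) *\<^sub>R (- \<i> * of_real (real_of_int n) * cis (- (gauge_angle v t * real_of_int n)))) (at t within {0..T})"
    proof -
      have "(((\<lambda>x. cis (- (x * real_of_int n))) \<circ> gauge_angle v) has_vector_derivative
        (3 * c * mass (v t)) *\<^sub>R (- \<i> * of_real (real_of_int n) * cis (- (gauge_angle v t * real_of_int n)))) (at t within {0..T})"
        by (rule vector_diff_chain_within[OF continuous_gth(1)[OF v T t] has_vector_derivative_cis])
      then show ?thesis by (simp add: o_def mult.commute)
    qed
    let ?e = "cis (- (real_of_int n * gauge_angle v t))"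
    have "((\<lambda>t. cis (- (real_of_int n * gauge_angle v t)) * q t) has_vector_derivative
        (?e * (0 + h t) + ((3 * c * mass (v t)) *\<^sub>R (- \<i> * of_real (real_of_int n) * cis (- (gauge_angle v t * real_of_int n)))) * q t))
        (at t within {0..T})"
      by (rule has_vector_derivative_mult[OF dc dq])
    then have "((\<lambda>t. gauge v t n) has_vector_derivative
        (?e * (0 + h t) + ((3 * c * mass (v t)) *\<^sub>R (- \<i> * of_real (real_of_int n) * cis (- (gauge_angle v t * real_of_int n)))) * q t))
        (at t within {0..T})"
    proof (rule has_vector_derivative_transform[OF t, rotated])
      fix \<tau> assume "\<tau> \<in> {0..T}"
      then show "gauge v \<tau> n = cis (- (real_of_int n * gauge_angle v \<tau>)) * q \<tau>"
        by (simp add: q gauge_def total_phase_def cis_mult mult.assoc[symmetric] add.commute)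
    qed
    then show ?thesis
    proof (rule has_vector_derivative_eq_rhs)
      have g: "gauge v t n = ?e * cis (- (t * ?p)) * v t n"
        by (simp add: gauge_def total_phase_def cis_mult add.commute)
      have osc: "infsum (cub (osc t) (gauge v t) n) (NR n) = ?e * cis (- (t * ?p)) * infsum (cub1 (v t) n) (NR n)"
      proof -
        have "cub (osc t) (gauge v t) n = (\<lambda>p. ?e * cis (- (t * ?p)) * cub1 (v t) n p)"
        proof (rule ext, clarify)
          fix k j
          let ?l = "n - k - j"
          \<comment> \<open>The gauge part of the phase is linear in the frequency and k + j + l =
            n, so it cancels among the four phases and only \<open>Phi\<close> remains.\<close>
          have "- (t * Phi k j ?l) - total_phase v t k - total_phase v t j - total_phase v t ?l = - total_phase v t n"
            by (simp add: Phi_def total_phase_def algebra_simps)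
          then have "osc t k j ?l * cis (- total_phase v t k) * cis (- total_phase v t j) * cis (- total_phase v t ?l) = cis (- total_phase v t n)"
            by (simp add: osc_def cis_mult)
          then have "cub (osc t) (gauge v t) n (k,j) = cis (- total_phase v t n) * (v t k * v t j * v t ?l)"
            by (simp add: cub_def gauge_def mult_ac) 
          also have "cis (- total_phase v t n) = ?e * cis (- (t * ?p))" by (simp add: total_phase_def cis_mult add.commute)
          finally show "cub (osc t) (gauge v t) n (k,j) = ?e * cis (- (t * ?p)) * cub1 (v t) n (k,j)"
            by (simp add: cub_def)
        qed
        then show ?thesis by (simp add: infsum_cmult_right')
      qed
      \<comment> \<open>\<open>resonant_sum\<close> excludes frequency 0, where the derivative in
        the nonlinearity vanishes anyway.\<close>
      have "infsum (cub1 (v t) n) UNIV * of_int n =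
        (infsum (cub1 (v t) n) (NR n) + (3 * of_real (mass (v t)) - 3 * of_real ((cmod (v t n))\<^sup>2)) * v t n) * of_int n"
        using resonant_sum[OF b[OF t] re[OF t], of n] by (cases "n = 0") auto
      then have h: "h t = \<i> * of_real c * cis (- (t * ?p)) * ((infsum (cub1 (v t) n) (NR n)
          + (3 * of_real (mass (v t)) - 3 * of_real ((cmod (v t n))\<^sup>2)) * v t n) * of_int n)"
      proof -
        assume eq: "infsum (cub1 (v t) n) UNIV * of_int n =
          (infsum (cub1 (v t) n) (NR n) + (3 * of_real (mass (v t)) - 3 * of_real ((cmod (v t n))\<^sup>2)) * v t n) * of_int n"
        have "h t = \<i> * of_real c * cis (- (t * ?p)) * (infsum (cub1 (v t) n) UNIV * of_int n)"
          by (simp only: h_def mult_ac)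
        then show ?thesis by (simp only: eq)
      qed
      show "?e * (0 + h t) + ((3 * c * mass (v t)) *\<^sub>R (- \<i> * of_real (real_of_int n) * cis (- (gauge_angle v t * real_of_int n)))) * q t
        = \<i> * of_int n * G t n"
        unfolding G_def osc q[OF t] h norm_gauge unfolding g
        by (simp add: scaleR_conv_of_real mult.commute[of "gauge_angle v t"] algebra_simps)
    qed
  qed
  have "gsol T R (gauge v) G"
    unfolding gsol_def
  proof (intro conjI ballI allI impI)
    fix n and e :: real assume e: "e > 0"
    have "(\<lambda>L. \<bar>c\<bar> * (tail_rate L * (l1_const * R)^3)) \<longlonglongrightarrow> \<bar>c\<bar> * (0 * (l1_const * R)^3)" by (intro tendsto_intros tail_rate_lim)
    then have "\<forall>\<^sub>F L in sequentially. \<bar>c\<bar> * (tail_rate L * (l1_const * R)^3) < e" using e by (auto dest: order_tendstoD)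
    then obtain L0 where L0: "\<And>L. L \<ge> L0 \<Longrightarrow> \<bar>c\<bar> * (tail_rate L * (l1_const * R)^3) < e"
      by (auto simp: eventually_sequentially)
    show "\<exists>L0. \<forall>L\<ge>L0. \<forall>t\<in>{0..T}. cmod (G t n - GL L t (gauge v t) n) \<le> e"
    proof (intro exI[of _ L0] allI impI ballI)
      fix L t assume L: "L \<ge> L0" and t: "t \<in> {0..T}"
      have "G t n - GL L t (gauge v t) n = of_real c * (infsum (cub (osc t) (gauge v t) n) (NR n)
          - sum (cub (osc t) (gauge v t) n) (NR n \<inter> box L))"
        unfolding G_def GL_def tri_cub NR_box by (simp add: algebra_simps)
      then have "cmod (G t n - GL L t (gauge v t) n) = \<bar>c\<bar> * cmod (infsum (cub (osc t) (gauge v t) n) (NR n)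
          - sum (cub (osc t) (gauge v t) n) (NR n \<inter> box L))" by (simp add: norm_mult)
      also have "\<dots> \<le> \<bar>c\<bar> * (tail_rate L * (l1_const * R)^3)"
        by (intro mult_left_mono cub_infsum_tail bg t) auto
      also have "\<dots> \<le> e" using L0[OF L] by simp
      finally show "cmod (G t n - GL L t (gauge v t) n) \<le> e" .
    qed
  qed (auto intro: bg der simp del: norm_gauge)
  then show ?thesis by (rule that)
qed

lemma gauge_initial:
  assumes v: "wsol T R v0 v" and T: "T \<ge> 0"
  shows "gauge v 0 n = v0 n"
  using wsol_interaction(3)[OF v T, of 0 n] T by (simp add: gauge_def total_phase_def gauge_angle_def)

text \<open>The phases are continuous for each frequency but not uniformly in \<open>n\<close>. Low
  frequencies use their continuity, high ones the smallness of the tail of \<open>u t\<close> at the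
  fixed time.\<close>

lemma C_Hs_phase:
  assumes u: "\<And>t. t \<in> {0..T} \<Longrightarrow> hs_b s (u t) R"
    and uc: "\<And>e. e > 0 \<Longrightarrow> \<exists>\<delta>>0. \<forall>t\<in>{0..T}. \<forall>t'\<in>{0..T}. \<bar>t' - t\<bar> < \<delta> \<longrightarrow> hs_b s (\<lambda>n. u t' n - u t n) e"
    and \<psi>: "\<And>n. continuous_on {0..T} (\<lambda>t. \<psi> t n)"
    and v: "\<And>t n. t \<in> {0..T} \<Longrightarrow> v t n = cis (\<psi> t n) * u t n" "\<And>t. t \<in> {0..T} \<Longrightarrow> real_valued (v t)"
  shows "C_Hs s T v"
  unfolding C_Hs_def
proof (intro conjI ballI allI impI)
  fix t assume t: "t \<in> {0..T}"
  have "hs_b s (v t) R" by (rule hs_b_mono[OF u[OF t]]) (simp add: v(1)[OF t] norm_mult)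
  then show "v t \<in> Hs s" using v(2)[OF t] hs_b_imp_norm(1) by (simp add: Hs_def)
next
  fix t e :: real assume t: "t \<in> {0..T}" and e: "e > 0"
  have R: "R \<ge> 0" using u[OF t] by (rule l2b_nonneg)
  obtain \<delta>1 where \<delta>1: "\<delta>1 > 0" "\<And>t'. t' \<in> {0..T} \<Longrightarrow> \<bar>t' - t\<bar> < \<delta>1 \<Longrightarrow> hs_b s (\<lambda>n. u t' n - u t n) (e/4)"
    using uc[of "e/4"] e t by auto
  obtain L where L: "\<And>F. finite F \<Longrightarrow> F \<inter> {- int L..int L} = {} \<Longrightarrow> L2_set (\<lambda>n. W s n * cmod (u t n)) F \<le> e/8"
    using hs_b_tail[OF u[OF t], of "e/8"] e by auto
  define \<kappa> where "\<kappa> = e / (4 * (R + 1))"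
  have \<kappa>: "\<kappa> > 0" "\<kappa> * R \<le> e/4"
    using e R by (auto simp: \<kappa>_def field_simps intro!: divide_pos_pos)
  have "\<forall>\<^sub>F t' in at t within {0..T}. \<forall>n\<in>{- int L..int L}. dist (cis (\<psi> t' n)) (cis (\<psi> t n)) < \<kappa>"
  proof (rule eventually_ball_finite)
    show "\<forall>n\<in>{- int L..int L}. \<forall>\<^sub>F t' in at t within {0..T}. dist (cis (\<psi> t' n)) (cis (\<psi> t n)) < \<kappa>"
    proof
      fix n
      have "continuous_on {0..T} (\<lambda>t. cis (\<psi> t n))" by (intro continuous_intros \<psi>)
      then have "((\<lambda>t. cis (\<psi> t n)) \<longlongrightarrow> cis (\<psi> t n)) (at t within {0..T})" using t by (simp add: continuous_on_def)
      then show "\<forall>\<^sub>F t' in at t within {0..T}. dist (cis (\<psi> t' n)) (cis (\<psi> t n)) < \<kappa>" using \<kappa>(1) by (rule tendstoD)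
    qed
  qed simp
  then obtain \<delta>2 where \<delta>2: "\<delta>2 > 0"
    "\<And>t' n. t' \<in> {0..T} \<Longrightarrow> t' \<noteq> t \<Longrightarrow> dist t' t < \<delta>2 \<Longrightarrow> n \<in> {- int L..int L} \<Longrightarrow> dist (cis (\<psi> t' n)) (cis (\<psi> t n)) < \<kappa>"
    unfolding eventually_at by blast
  show "\<exists>\<delta>>0. \<forall>t'\<in>{0..T}. \<bar>t' - t\<bar> < \<delta> \<longrightarrow> hs_norm s (v t' - v t) < e"
  proof (intro exI[of _ "min \<delta>1 \<delta>2"] conjI ballI impI)
    show "0 < min \<delta>1 \<delta>2" using \<delta>1 \<delta>2 by simp
    fix t' assume t': "t' \<in> {0..T}" "\<bar>t' - t\<bar> < min \<delta>1 \<delta>2"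
    have 1: "hs_b s (\<lambda>n. u t' n - u t n) (e/4)" using t' by (intro \<delta>1) auto
    have 2: "hs_b s (\<lambda>n. (cis (\<psi> t' n) - cis (\<psi> t n)) * u t n) (\<kappa> * R + 2 * (e/8))"
    proof (rule phase_perturbation[OF u[OF t] L])
      show "cmod (cis (\<psi> t' n) - cis (\<psi> t n)) \<le> 2" for n
        using norm_triangle_ineq4[of "cis (\<psi> t' n)" "cis (\<psi> t n)"] by simp
      show "cmod (cis (\<psi> t' n) - cis (\<psi> t n)) \<le> \<kappa>" if "n \<in> {- int L..int L}" for n
        using \<delta>2(2)[OF t'(1) _ _ that] t'(2) \<kappa>(1) by (cases "t' = t") (auto simp: dist_norm)
    qed (use \<kappa> in auto)
    have "hs_b s (v t' - v t) (e/4 + (\<kappa> * R + 2 * (e/8)))"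
    proof (rule hs_b_add[OF 1 2])
      fix n
      have "(v t' - v t) n = cis (\<psi> t' n) * (u t' n - u t n) + (cis (\<psi> t' n) - cis (\<psi> t n)) * u t n"
        using v(1)[OF t] v(1)[OF t'(1)] by (simp add: algebra_simps)
      then have "cmod ((v t' - v t) n) \<le> cmod (cis (\<psi> t' n) * (u t' n - u t n)) + cmod ((cis (\<psi> t' n) - cis (\<psi> t n)) * u t n)"
        by (simp only: norm_triangle_ineq)
      then show "cmod ((v t' - v t) n) \<le> cmod (u t' n - u t n) + cmod ((cis (\<psi> t' n) - cis (\<psi> t n)) * u t n)"
        by (simp add: norm_mult)
    qed
    then have "hs_norm s (v t' - v t) \<le> e/4 + (\<kappa> * R + 2 * (e/8))" by (rule hs_b_imp_norm)
    then show "hs_norm s (v t' - v t) < e" using \<kappa>(2) e by simp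
  qed
qed

lemma wsol_C_Hs:
  assumes v: "wsol T R v0 v" and T: "T \<ge> 0"
  shows "C_Hs s T v"
proof -
  obtain G where G: "gsol T R (gauge v) G" using gauge_gsol[OF v T] .
  show ?thesis
  proof (rule C_Hs_phase[where u = "gauge v" and \<psi> = "total_phase v"])
    show "hs_b s (gauge v t) R" if "t \<in> {0..T}" for t using gsol_bound[OF G that] .
    show "\<exists>\<delta>>0. \<forall>t\<in>{0..T}. \<forall>t'\<in>{0..T}. \<bar>t' - t\<bar> < \<delta> \<longrightarrow> hs_b s (\<lambda>n. gauge v t' n - gauge v t n) e"
      if "e > 0" for e using gsol_continuous[OF G that] by metis
    show "continuous_on {0..T} (\<lambda>t. total_phase v t n)" for n
      unfolding total_phase_def by (intro continuous_intros continuous_gth(2)[OF v T])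
    show "v t n = cis (total_phase v t n) * gauge v t n" for t n by (rule gauge_inverse)
    show "real_valued (v t)" if "t \<in> {0..T}" for t using v that by (simp add: wsol_def)
  qed
qed

section \<open>Uniqueness and continuous dependence\<close>

lemma C_Hs_bounded:
  assumes v: "C_Hs s T v" and T: "T \<ge> 0"
  obtains R where "\<And>t. t \<in> {0..T} \<Longrightarrow> hs_b s (v t) R"
proof -
  have b: "hs_b s (v t) (hs_norm s (v t))" if "t \<in> {0..T}" for t
    using v that by (auto simp: C_Hs_def intro: Hs_hs_b)
  have tri: "hs_norm s (v t') \<le> hs_norm s (v t) + hs_norm s (v t' - v t)" if "t \<in> {0..T}" "t' \<in> {0..T}" for t t'
  proof -
    have "hs_b s (v t' - v t) (hs_norm s (v t') + hs_norm s (v t))"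
      using hs_b_diff[OF b[OF that(2)] b[OF that(1)]] by simp
    then have "hs_b s (v t' - v t) (hs_norm s (v t' - v t))" by (intro summable_imp_hs_b hs_b_imp_norm)
    from hs_b_triangle[OF b[OF that(1)] this] have "hs_b s (v t') (hs_norm s (v t) + hs_norm s (v t' - v t))" by simp
    then show ?thesis by (rule hs_b_imp_norm)
  qed
  have cont: "continuous_on {0..T} (\<lambda>t. hs_norm s (v t))"
    unfolding continuous_on_iff
  proof (intro ballI allI impI)
    fix t e :: real assume t: "t \<in> {0..T}" and e: "e > 0"
    then obtain \<delta> where \<delta>: "\<delta> > 0" "\<And>t'. t' \<in> {0..T} \<Longrightarrow> \<bar>t' - t\<bar> < \<delta> \<Longrightarrow> hs_norm s (v t' - v t) < e"
      using v unfolding C_Hs_def by meson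
    show "\<exists>d>0. \<forall>x'\<in>{0..T}. dist x' t < d \<longrightarrow> dist (hs_norm s (v x')) (hs_norm s (v t)) < e"
    proof (intro exI[of _ \<delta>] conjI ballI impI \<delta>(1))
      fix t' assume t': "t' \<in> {0..T}" "dist t' t < \<delta>"
      have "hs_norm s (v t' - v t) < e" using \<delta>(2) t' by (simp add: dist_real_def)
      moreover have "hs_norm s (v t - v t') = hs_norm s (v t' - v t)"
        by (simp add: hs_norm_def hs_weight_def norm_minus_commute)
      ultimately show "dist (hs_norm s (v t')) (hs_norm s (v t)) < e"
        using tri[OF t t'(1)] tri[OF t'(1) t] by (simp add: dist_real_def)
    qed
  qed
  have "compact ((\<lambda>t. hs_norm s (v t)) ` {0..T})" by (rule compact_continuous_image[OF cont compact_Icc])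
  then have "bounded ((\<lambda>t. hs_norm s (v t)) ` {0..T})" by (rule compact_imp_bounded)
  then obtain R where "\<forall>x\<in>(\<lambda>t. hs_norm s (v t)) ` {0..T}. norm x \<le> R" unfolding bounded_iff by blast
  then have R: "hs_norm s (v t) \<le> R" if "t \<in> {0..T}" for t
    using that by (metis abs_le_D1 imageI real_norm_def)
  show ?thesis by (rule that[of R]) (use l2b_weaken[OF b R] in auto)
qed

lemma wsol_mono: "wsol T R v0 v \<Longrightarrow> R \<le> R' \<Longrightarrow> wsol T R' v0 v"
  unfolding wsol_def using l2b_weaken by blast

lemma mK_solution_wsol:
  assumes "mK_solution \<beta> \<gamma> (12 * pi\<^sup>2 * c) s T v0 v" "T \<ge> 0"
  obtains R where "wsol T R v0 v"
proof -
  from assms have C: "C_Hs s T v" and d: "duhamel \<beta> \<gamma> (12 * pi\<^sup>2 * c) T v0 v" by (auto simp: mK_solution_def)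
  obtain R where "\<And>t. t \<in> {0..T} \<Longrightarrow> hs_b s (v t) R" using C_Hs_bounded[OF C assms(2)] by blast
  then show ?thesis using that[of R] C d by (auto simp: wsol_def C_Hs_def Hs_def)
qed

text \<open>The gauge depends on the solution, so equality of the gauged functions is not yet the
  claim. But gauging preserves moduli, hence the masses agree, then the angles, and the gauge can be
  undone identically.\<close>

lemma wsol_unique:
  assumes v: "wsol T R v0 v" and w: "wsol T R' v0 w" and t: "t \<in> {0..T}"
  shows "v t = w t"
proof -
  have T: "T \<ge> 0" using t by simp
  define B where "B = max R R'"
  have v': "wsol T B v0 v" and w': "wsol T B v0 w" using v w by (auto simp: B_def intro: wsol_mono)
  obtain G where G: "gsol T B (gauge v) G" using gauge_gsol[OF v' T] .
  obtain H where H: "gsol T B (gauge w) H" using gauge_gsol[OF w' T] .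
  obtain \<Lambda> where "\<Lambda> \<ge> 1" and L: "\<And>u G w H d t. gsol T B u G \<Longrightarrow> gsol T B w H \<Longrightarrow> hs_b s (\<lambda>n. u 0 n - w 0 n) d \<Longrightarrow> t \<in> {0..T}
      \<Longrightarrow> hs_b s (\<lambda>n. u t n - w t n) (\<Lambda> * d)" using gsol_lipschitz[of T B] by blast
  have eq: "gauge v \<tau> n = gauge w \<tau> n" if "\<tau> \<in> {0..T}" for \<tau> n
  proof -
    have "hs_b s (\<lambda>n. gauge v 0 n - gauge w 0 n) 0"
      using hs_b_zero by (simp add: gauge_initial[OF v T] gauge_initial[OF w T])
    from L[OF G H this that] have "hs_b s (\<lambda>n. gauge v \<tau> n - gauge w \<tau> n) 0" by simp
    from cmod_le[OF this, of n] show ?thesis by simp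
  qed
  have "mass (v \<tau>) = mass (w \<tau>)" if "\<tau> \<in> {0..T}" for \<tau>
    unfolding mass_def using eq[OF that] by (metis norm_gauge)
  then have "gauge_angle v t = gauge_angle w t" unfolding gauge_angle_def using t by (intro arg_cong2[where f = "(*)"] refl integral_cong) auto
  then have "total_phase v t n = total_phase w t n" for n by (simp add: total_phase_def)
  then have "v t n = w t n" for n using eq[OF t, of n] gauge_inverse[of v t n] gauge_inverse[of w t n] by simp
  then show ?thesis by auto
qed

text \<open>Strong continuity makes the trajectory compact: the tails at the finitely many times of
  a net control all others.\<close>

lemma gsol_uniform_tail:
  assumes u: "gsol T R u G" and e: "e > 0"
  obtains L where "\<And>t F. t \<in> {0..T} \<Longrightarrow> finite F \<Longrightarrow> F \<inter> {- int L..int L} = {} \<Longrightarrow> L2_set (\<lambda>n. W s n * cmod (u t n)) F \<le> e"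
proof -
  obtain \<delta> where \<delta>: "\<delta> > 0" "\<And>t t'. t \<in> {0..T} \<Longrightarrow> t' \<in> {0..T} \<Longrightarrow> \<bar>t' - t\<bar> < \<delta> \<Longrightarrow> hs_b s (\<lambda>n. u t' n - u t n) (e/2)"
    using gsol_continuous[OF u, of "e/2"] e by auto
  obtain D where D: "D \<subseteq> {0..T}" "finite D" "{0..T} \<subseteq> (\<Union>t\<in>D. ball t \<delta>)"
    by (rule compactE_image[OF compact_Icc, of "{0..T}" "\<lambda>t. ball t \<delta>"]) (use \<delta> in auto)
  have "\<exists>L. \<forall>F. finite F \<longrightarrow> F \<inter> {- int L..int L} = {} \<longrightarrow> L2_set (\<lambda>n. W s n * cmod (u t n)) F \<le> e/2" if "t \<in> D" for t
  proof -
    have "t \<in> {0..T}" using that D by auto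
    from hs_b_tail[OF gsol_bound[OF u this], of "e/2"] e show ?thesis by (metis half_gt_zero)
  qed
  then obtain Lf where Lf: "\<And>t F. t \<in> D \<Longrightarrow> finite F \<Longrightarrow> F \<inter> {- int (Lf t)..int (Lf t)} = {} \<Longrightarrow> L2_set (\<lambda>n. W s n * cmod (u t n)) F \<le> e/2"
    by metis
  define L where "L = Max (insert 0 (Lf ` D))"
  show ?thesis
  proof (rule that)
    fix t F assume t: "t \<in> {0..T}" and F: "finite F" "F \<inter> {- int L..int L} = {}"
    then obtain t0 where t0: "t0 \<in> D" "\<bar>t - t0\<bar> < \<delta>" using D(3) by (force simp: dist_real_def abs_minus_commute)
    have "Lf t0 \<le> L" unfolding L_def using D t0 by (intro Max_ge) auto
    then have 1: "L2_set (\<lambda>n. W s n * cmod (u t0 n)) F \<le> e/2" using F t0 by (intro Lf) auto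
    have 2: "L2_set (\<lambda>n. W s n * cmod (u t n - u t0 n)) F \<le> e/2"
      using t t0 D by (intro l2bD[OF \<delta>(2)] F) auto
    have "L2_set (\<lambda>n. W s n * cmod (u t n)) F \<le> L2_set (\<lambda>n. W s n * cmod (u t0 n) + W s n * cmod (u t n - u t0 n)) F"
      by (rule L2_set_mono) (auto simp: distrib_left[symmetric] intro!: mult_left_mono norm_triangle_sub)
    also have "\<dots> \<le> L2_set (\<lambda>n. W s n * cmod (u t0 n)) F + L2_set (\<lambda>n. W s n * cmod (u t n - u t0 n)) F"
      by (rule L2_set_triangle_ineq)
    finally show "L2_set (\<lambda>n. W s n * cmod (u t n)) F \<le> e" using 1 2 by simp
  qed
qed

lemma mass_le:
  assumes "hs_b s x R" "hs_b s y R" "hs_b s (\<lambda>n. x n - y n) d"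
  shows "mass x \<le> mass y + 2 * R * (l1_const * d)"
  unfolding mass_def[of x]
proof (rule infsum_le_finite_sums[OF sq_summable[OF assms(1)]])
  fix F :: "int set" assume F: "finite F"
  have R: "R \<ge> 0" using assms(1) by (rule l2b_nonneg)
  have "(\<Sum>k\<in>F. (cmod (x k))\<^sup>2) \<le> (\<Sum>k\<in>F. (cmod (y k))\<^sup>2 + 2 * R * cmod (x k - y k))"
  proof (rule sum_mono)
    fix k
    have "(cmod (x k))\<^sup>2 - (cmod (y k))\<^sup>2 = (cmod (x k) - cmod (y k)) * (cmod (x k) + cmod (y k))"
      by (simp add: power2_eq_square algebra_simps)
    also have "\<dots> \<le> cmod (x k - y k) * (R + R)"
      by (intro mult_mono add_mono cmod_le assms norm_triangle_ineq2) auto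
    finally show "(cmod (x k))\<^sup>2 \<le> (cmod (y k))\<^sup>2 + 2 * R * cmod (x k - y k)" by (simp add: mult_ac)
  qed
  also have "\<dots> = (\<Sum>k\<in>F. (cmod (y k))\<^sup>2) + 2 * R * (\<Sum>k\<in>F. cmod (x k - y k))"
    by (simp add: sum.distrib sum_distrib_left)
  also have "\<dots> \<le> mass y + 2 * R * (l1_const * d)"
    unfolding mass_def using R
    by (intro add_mono mult_left_mono l1_b[OF assms(3)] finite_sum_le_infsum sq_summable[OF assms(2)] F) auto
  finally show "(\<Sum>k\<in>F. (cmod (x k))\<^sup>2) \<le> mass y + 2 * R * (l1_const * d)" .
qed

lemma mass_diff:
  assumes "hs_b s x R" "hs_b s y R" "hs_b s (\<lambda>n. x n - y n) d"
  shows "\<bar>mass x - mass y\<bar> \<le> 2 * R * (l1_const * d)"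
proof -
  have "hs_b s (\<lambda>n. y n - x n) d" using assms(3) by (rule hs_b_mono) (simp add: norm_minus_commute)
  from mass_le[OF assms] mass_le[OF assms(2,1) this] show ?thesis by linarith
qed

text \<open>Gauged solutions are Lipschitz close, but undoing the gauge rotates coefficient
  \<open>n\<close> by \<open>n\<close> times the difference of the angles. The cut-off
  \<open>L\<close> comes from the tails of the reference solution and is chosen before
  \<open>\<delta>\<close>; the result is continuity without a Lipschitz rate.\<close>

lemma wsol_dependence:
  assumes v: "wsol T R v0 v" and T: "T \<ge> 0" and e: "e > 0"
  obtains \<delta> where "\<delta> > 0"
    "\<And>w0 w t. wsol T R w0 w \<Longrightarrow> hs_b s (\<lambda>n. w0 n - v0 n) \<delta> \<Longrightarrow> t \<in> {0..T} \<Longrightarrow> hs_b s (\<lambda>n. w t n - v t n) e"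
proof -
  obtain G where G: "gsol T R (gauge v) G" using gauge_gsol[OF v T] .
  obtain \<Lambda> where \<Lambda>: "\<Lambda> \<ge> 1" "\<And>u G w H d t. gsol T R u G \<Longrightarrow> gsol T R w H \<Longrightarrow> hs_b s (\<lambda>n. u 0 n - w 0 n) d \<Longrightarrow> t \<in> {0..T}
      \<Longrightarrow> hs_b s (\<lambda>n. u t n - w t n) (\<Lambda> * d)" using gsol_lipschitz[of T R] by blast
  obtain L where L: "\<And>t F. t \<in> {0..T} \<Longrightarrow> finite F \<Longrightarrow> F \<inter> {- int L..int L} = {} \<Longrightarrow> L2_set (\<lambda>n. W s n * cmod (gauge v t n)) F \<le> e/8"
    using gsol_uniform_tail[OF G, of "e/8"] e by auto
  have "0 \<in> {0..T}" using T by simp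
  then have R: "R \<ge> 0" using l2b_nonneg[OF gsol_bound[OF G]] by blast
  \<comment> \<open>\<open>Q * \<delta>\<close> bounds the difference of the two phases for
    frequencies up to \<open>L\<close>. The two entries of the minimum in \<open>\<delta>\<close>
    pay for the gauged difference and for this rotation.\<close>
  define Q where "Q = real L * (T * (3 * \<bar>c\<bar> * (2 * R * (l1_const * \<Lambda>))))"
  have Q: "Q \<ge> 0" unfolding Q_def using T R l1_const(1) \<Lambda>(1) by (intro mult_nonneg_nonneg) auto
  define \<delta> where "\<delta> = min (e / (4 * \<Lambda>)) (e / (4 * (Q * R + 1)))"
  have QR: "Q * R \<ge> 0" using Q R by simp
  have \<delta>: "\<delta> > 0" using e \<Lambda>(1) QR unfolding \<delta>_def by (auto intro!: divide_pos_pos add_nonneg_pos)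
  have \<delta>1: "\<Lambda> * \<delta> \<le> e/4"
  proof -
    have "\<Lambda> * \<delta> \<le> \<Lambda> * (e / (4 * \<Lambda>))" unfolding \<delta>_def using \<Lambda>(1) by (intro mult_left_mono) auto
    then show ?thesis using \<Lambda>(1) by simp
  qed
  have \<delta>2: "Q * \<delta> * R \<le> e/4"
  proof -
    have "(Q * R) * \<delta> \<le> (Q * R + 1) * (e / (4 * (Q * R + 1)))"
      using QR \<delta> unfolding \<delta>_def by (intro mult_mono) auto
    also have "\<dots> = e/4"
    proof -
      have "x * (e / (4 * x)) = e / 4" if "x > 0" for x :: real using that by simp
      from this[of "Q * R + 1"] QR show ?thesis by simp
    qed
    finally show ?thesis by (simp add: mult_ac)
  qed
  show ?thesis
  proof (rule that[OF \<delta>])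
    fix w0 w t assume w: "wsol T R w0 w" and d: "hs_b s (\<lambda>n. w0 n - v0 n) \<delta>" and t: "t \<in> {0..T}"
    obtain H where H: "gsol T R (gauge w) H" using gauge_gsol[OF w T] .
    have dif: "hs_b s (\<lambda>n. gauge w \<tau> n - gauge v \<tau> n) (\<Lambda> * \<delta>)" if "\<tau> \<in> {0..T}" for \<tau>
      by (rule \<Lambda>(2)[OF H G _ that]) (use d in \<open>simp add: gauge_initial[OF v T] gauge_initial[OF w T]\<close>)
    have mg: "mass (gauge x \<tau>) = mass (x \<tau>)" for x \<tau> by (simp add: mass_def)
    have "\<bar>mass (w \<tau>) - mass (v \<tau>)\<bar> \<le> 2 * R * (l1_const * (\<Lambda> * \<delta>))" if "\<tau> \<in> {0..T}" for \<tau>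
      using mass_diff[OF gsol_bound[OF H that] gsol_bound[OF G that] dif[OF that]] by (simp only: mg)
    note md = this
    have gd: "\<bar>gauge_angle w t - gauge_angle v t\<bar> \<le> T * (3 * \<bar>c\<bar> * (2 * R * (l1_const * (\<Lambda> * \<delta>))))"
    proof -
      have sub: "{0..t} \<subseteq> {0..T}" using t by auto
      have iw: "(\<lambda>\<tau>. mass (w \<tau>)) integrable_on {0..t}"
        by (rule integrable_continuous_real[OF continuous_on_subset[OF continuous_gth(3)[OF w T] sub]])
      have iv: "(\<lambda>\<tau>. mass (v \<tau>)) integrable_on {0..t}"
        by (rule integrable_continuous_real[OF continuous_on_subset[OF continuous_gth(3)[OF v T] sub]])
      have "norm (integral {0..t} (\<lambda>\<tau>. mass (w \<tau>) - mass (v \<tau>))) \<le> (2 * R * (l1_const * (\<Lambda> * \<delta>))) * (t - 0)"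
        by (rule integral_bound) (use t md sub continuous_on_subset[OF continuous_gth(3)[OF w T] sub] continuous_on_subset[OF continuous_gth(3)[OF v T] sub]
            in \<open>auto intro!: continuous_intros\<close>)
      then have 1: "\<bar>integral {0..t} (\<lambda>\<tau>. mass (w \<tau>) - mass (v \<tau>))\<bar> \<le> (2 * R * (l1_const * (\<Lambda> * \<delta>))) * T"
      proof -
        have "(2 * R * (l1_const * (\<Lambda> * \<delta>))) * (t - 0) \<le> (2 * R * (l1_const * (\<Lambda> * \<delta>))) * T"
          using t R l1_const(1) \<Lambda>(1) \<delta> by (intro mult_left_mono mult_nonneg_nonneg) auto
        moreover assume "norm (integral {0..t} (\<lambda>\<tau>. mass (w \<tau>) - mass (v \<tau>))) \<le> (2 * R * (l1_const * (\<Lambda> * \<delta>))) * (t - 0)"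
        ultimately show ?thesis by simp
      qed
      have "gauge_angle w t - gauge_angle v t = 3 * c * integral {0..t} (\<lambda>\<tau>. mass (w \<tau>) - mass (v \<tau>))"
        unfolding gauge_angle_def integral_diff[OF iw iv] by (simp add: algebra_simps)
      then have "\<bar>gauge_angle w t - gauge_angle v t\<bar> = 3 * \<bar>c\<bar> * \<bar>integral {0..t} (\<lambda>\<tau>. mass (w \<tau>) - mass (v \<tau>))\<bar>"
        by (simp add: abs_mult)
      also have "\<dots> \<le> 3 * \<bar>c\<bar> * ((2 * R * (l1_const * (\<Lambda> * \<delta>))) * T)" by (intro mult_left_mono 1) auto
      finally show ?thesis by (simp add: mult_ac)
    qed
    have 2: "hs_b s (\<lambda>n. (cis (total_phase w t n) - cis (total_phase v t n)) * gauge v t n) (Q * \<delta> * R + 2 * (e/8))"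
    proof (rule phase_perturbation[OF gsol_bound[OF G t] L[OF t]])
      show "cmod (cis (total_phase w t n) - cis (total_phase v t n)) \<le> 2" for n
        using norm_triangle_ineq4[of "cis (total_phase w t n)" "cis (total_phase v t n)"] by simp
      show "cmod (cis (total_phase w t n) - cis (total_phase v t n)) \<le> Q * \<delta>" if "n \<in> {- int L..int L}" for n
      proof -
        have "\<bar>real_of_int n\<bar> \<le> real L" using that by auto
        then have "\<bar>real_of_int n\<bar> * \<bar>gauge_angle w t - gauge_angle v t\<bar> \<le> real L * (T * (3 * \<bar>c\<bar> * (2 * R * (l1_const * (\<Lambda> * \<delta>)))))"
          by (intro mult_mono gd) auto
        also have "\<dots> = Q * \<delta>" by (simp add: Q_def)
        finally have "\<bar>real_of_int n\<bar> * \<bar>gauge_angle w t - gauge_angle v t\<bar> \<le> Q * \<delta>" .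
        moreover have "total_phase w t n - total_phase v t n = real_of_int n * (gauge_angle w t - gauge_angle v t)"
          by (simp add: total_phase_def algebra_simps)
        ultimately show ?thesis using cmod_cis_diff_le[of "total_phase w t n" "total_phase v t n"] by (simp add: abs_mult)
      qed
    qed (use Q \<delta> in auto)
    have "hs_b s (\<lambda>n. w t n - v t n) (\<Lambda> * \<delta> + (Q * \<delta> * R + 2 * (e/8)))"
    proof (rule hs_b_add[OF dif[OF t] 2])
      fix n
      have "w t n - v t n = cis (total_phase w t n) * (gauge w t n - gauge v t n) + (cis (total_phase w t n) - cis (total_phase v t n)) * gauge v t n"
        using gauge_inverse[of w t n] gauge_inverse[of v t n] by (simp add: algebra_simps)
      then have "cmod (w t n - v t n) \<le> cmod (cis (total_phase w t n) * (gauge w t n - gauge v t n)) + cmod ((cis (total_phase w t n) - cis (total_phase v t n)) * gauge v t n)"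
        by (simp only: norm_triangle_ineq)
      then show "cmod (w t n - v t n) \<le> cmod (gauge w t n - gauge v t n) + cmod ((cis (total_phase w t n) - cis (total_phase v t n)) * gauge v t n)"
        by (simp add: norm_mult)
    qed
    then show "hs_b s (\<lambda>n. w t n - v t n) e" by (rule l2b_weaken) (use \<delta>1 \<delta>2 e in simp)
  qed
qed

end

section \<open>Galerkin approximation\<close>

text \<open>The existing instance asks for a metric domain, which excludes \<open>int\<close>.\<close>

instance bcontfun :: (topological_space, complete_space) complete_space
proof
  fix f :: "nat \<Rightarrow> 'a \<Rightarrow>\<^sub>C 'b"
  assume C: "Cauchy f"
  have "\<exists>l. \<forall>e>0. \<exists>M. \<forall>k x. k \<ge> M \<longrightarrow> dist (apply_bcontfun (f k) x) (l x) < e"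
    using uniformly_convergent_eq_cauchy[of "\<lambda>_. True" "\<lambda>k. apply_bcontfun (f k)"] C dist_fun_lt_imp_dist_val_lt
    unfolding Cauchy_def by metis
  then obtain l where "uniform_limit UNIV (\<lambda>k. apply_bcontfun (f k)) l sequentially"
    unfolding uniform_limit_sequentially_iff by blast
  from uniform_limit_bcontfunE[OF this sequentially_bot] show "convergent f"
    unfolding convergent_def by metis
qed

instance bcontfun :: (topological_space, banach) banach ..

text \<open>The weight \<open>exp(- 2 L t)\<close> makes the Picard map a contraction on the whole interval.\<close>

lemma picard_global:
  fixes F :: "'a::banach \<Rightarrow> 'a"
  assumes lip: "\<And>x y. norm (F x - F y) \<le> L * norm (x - y)" and L: "L > 0" and T: "T \<ge> 0"
  obtains x where "x 0 = x0" "\<And>t. t \<in> {0..T} \<Longrightarrow> (x has_vector_derivative F (x t)) (at t within {0..T})"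
proof -
  have cF: "continuous_on UNIV F"
    by (rule lipschitz_on_continuous_on[of L], rule lipschitz_onI) (use lip L in \<open>auto simp: dist_norm\<close>)
  \<comment> \<open>Clamping time to [0,T] makes the Picard iterate a bounded continuous function on
    the whole line, where the fixed point theorem is applied.\<close>
  define cl where "cl t = max 0 (min T t)" for t
  have cl: "cl t \<in> {0..T}" "t \<in> {0..T} \<Longrightarrow> cl t = t" for t using T by (auto simp: cl_def)
  define g where "g y r = F (exp (2 * L * r) *\<^sub>R apply_bcontfun y r)" for y r
  have cg: "continuous_on S (g y)" for S y unfolding g_def
    by (rule continuous_on_compose2[OF cF]) (auto intro!: continuous_intros)
  define h where "h y t = exp (- (2 * L * t)) *\<^sub>R (x0 + integral {0..t} (g y))" for y t
  have ig: "g y integrable_on {0..t}" for y t by (rule integrable_continuous_real[OF cg])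
  have ch: "continuous_on {0..T} (h y)" for y
    unfolding h_def by (intro continuous_intros indefinite_integral_continuous_1 ig)
  have hb: "(\<lambda>t. h y (cl t)) \<in> bcontfun" for y
  proof -
    have "bounded (h y ` {0..T})" by (intro compact_imp_bounded compact_continuous_image ch compact_Icc)
    then obtain b where "\<forall>x\<in>h y ` {0..T}. norm x \<le> b" unfolding bounded_iff by blast
    then have b: "norm (h y t) \<le> b" if "t \<in> {0..T}" for t using that by blast
    show ?thesis
    proof (rule bcontfun_normI)
      show "continuous_on UNIV (\<lambda>t. h y (cl t))"
        by (rule continuous_on_compose2[OF ch]) (use cl in \<open>auto simp: cl_def intro!: continuous_intros\<close>)
      show "norm (h y (cl t)) \<le> b" for t by (rule b[OF cl(1)])
    qed
  qed
  define P where "P y = Bcontfun (\<lambda>t. h y (cl t))" for y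
  have P: "apply_bcontfun (P y) t = h y (cl t)" for y t
    unfolding P_def by (subst Bcontfun_inverse[OF hb]) simp
  have "dist (P y) (P z) \<le> 1/2 * dist y z" for y z
  proof (rule dist_bound)
    fix t'
    define t where "t = cl t'"
    have t: "t \<in> {0..T}" unfolding t_def by (rule cl)
    define D where "D = dist y z"
    have Iexp: "((\<lambda>r. L * D * exp (2 * L * r)) has_integral (D / 2 * exp (2 * L * t) - D / 2 * exp (2 * L * 0))) {0..t}"
      by (rule fundamental_theorem_of_calculus)
         (use t L in \<open>auto intro!: derivative_eq_intros simp: has_real_derivative_iff_has_vector_derivative[symmetric]\<close>)
    have "norm (integral {0..t} (g y) - integral {0..t} (g z)) = norm (integral {0..t} (\<lambda>r. g y r - g z r))"
      by (simp add: integral_diff ig)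
    also have "\<dots> \<le> integral {0..t} (\<lambda>r. L * D * exp (2 * L * r))"
    proof (rule integral_norm_bound_integral)
      show "(\<lambda>r. g y r - g z r) integrable_on {0..t}" by (intro integrable_diff ig)
      show "(\<lambda>r. L * D * exp (2 * L * r)) integrable_on {0..t}" using Iexp by blast
      fix r
      have "norm (g y r - g z r) \<le> L * norm (exp (2 * L * r) *\<^sub>R apply_bcontfun y r - exp (2 * L * r) *\<^sub>R apply_bcontfun z r)"
        unfolding g_def by (rule lip)
      also have "\<dots> = L * (exp (2 * L * r) * dist (apply_bcontfun y r) (apply_bcontfun z r))"
        by (simp add: scaleR_diff_right[symmetric] dist_norm)
      also have "\<dots> \<le> L * (exp (2 * L * r) * D)"
        unfolding D_def using L by (intro mult_left_mono dist_bounded) auto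
      finally show "norm (g y r - g z r) \<le> L * D * exp (2 * L * r)" by (simp add: mult_ac)
    qed
    also have "\<dots> = D / 2 * exp (2 * L * t) - D / 2" using integral_unique[OF Iexp] by simp
    also have "\<dots> \<le> D / 2 * exp (2 * L * t)" by (simp add: D_def)
    finally have le: "norm (integral {0..t} (g y) - integral {0..t} (g z)) \<le> D / 2 * exp (2 * L * t)" .
    have "dist (h y t) (h z t) = exp (- (2 * L * t)) * norm (integral {0..t} (g y) - integral {0..t} (g z))"
      by (simp add: h_def dist_norm scaleR_diff_right[symmetric])
    also have "\<dots> \<le> exp (- (2 * L * t)) * (D / 2 * exp (2 * L * t))" by (intro mult_left_mono le) simp
    also have "\<dots> = D / 2 * (exp (- (2 * L * t)) * exp (2 * L * t))" by (simp only: mult_ac)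
    also have "\<dots> = D / 2" by (simp add: exp_minus)
    finally show "dist (apply_bcontfun (P y) t') (apply_bcontfun (P z) t') \<le> 1/2 * dist y z"
      by (simp add: P t_def D_def)
  qed
  then obtain y where y: "P y = y" using banach_fix_type[of "1/2" P] by auto
  define x where "x t = exp (2 * L * t) *\<^sub>R apply_bcontfun y t" for t
  have eq: "x t = x0 + integral {0..t} (\<lambda>r. F (x r))" if "t \<in> {0..T}" for t
  proof -
    have "apply_bcontfun y t = h y t" using P[of y t] cl(2)[OF that] by (simp add: y)
    then have "x t = (exp (2 * L * t) * exp (- (2 * L * t))) *\<^sub>R (x0 + integral {0..t} (g y))"
      by (simp add: x_def h_def)
    also have "exp (2 * L * t) * exp (- (2 * L * t)) = 1" by (simp add: exp_minus)
    finally show ?thesis by (simp add: g_def[abs_def] x_def[abs_def])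
  qed
  show ?thesis
  proof (rule that)
    show "x 0 = x0" using eq[of 0] T by simp
    fix t assume t: "t \<in> {0..T}"
    have c: "continuous_on {0..T} (\<lambda>r. F (x r))" using cg[of "{0..T}" y] by (simp add: g_def[abs_def] x_def)
    have "((\<lambda>t. x0 + integral {0..t} (\<lambda>r. F (x r))) has_vector_derivative (0 + F (x t))) (at t within {0..T})"
      by (intro has_vector_derivative_add has_vector_derivative_const integral_has_vector_derivative c t)
    then have "(x has_vector_derivative (0 + F (x t))) (at t within {0..T})"
      by (rule has_vector_derivative_transform[OF t, rotated]) (rule eq)
    then show "(x has_vector_derivative F (x t)) (at t within {0..T})" by simp
  qed
qed

text \<open>Radial projection onto a ball. The constant 2 holds in every normed space; it turns the
  cubic vector field of the Galerkin system into a globally Lipschitz one.\<close>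

lemma radial_lipschitz:
  fixes x y :: "'a::real_normed_vector"
  assumes R: "R > 0"
  defines "l \<equiv> \<lambda>x::'a. if norm x \<le> R then 1 else R / norm x"
  shows "norm (l x *\<^sub>R x - l y *\<^sub>R y) \<le> 2 * norm (x - y)"
proof -
  have main: "norm (l x *\<^sub>R x - l y *\<^sub>R y) \<le> 2 * norm (x - y)" if le: "norm y \<le> norm x" for x y
  proof (cases "norm x \<le> R")
    case True then show ?thesis using le by (simp add: l_def)
  next
    case False
    then have x: "norm x > R" "norm x > 0" using R by auto
    have lx: "l x = R / norm x" "0 \<le> l x" "l x \<le> 1" using x R by (auto simp: l_def)
    have tri: "norm x - norm y \<le> norm (x - y)" by (rule norm_triangle_ineq2)
    have key: "(l y - l x) * norm y \<le> norm (x - y)" "l y - l x \<ge> 0"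
    proof -
      show "l y - l x \<ge> 0"
      proof (cases "norm y \<le> R")
        case True
        then have "l y = 1" by (simp add: l_def)
        then show ?thesis using lx(3) by simp
      next
        case False
        then have "norm y > 0" using R by linarith
        then have "R / norm x \<le> R / norm y" using le x R by (intro divide_left_mono) auto
        then show ?thesis using False lx(1) by (simp add: l_def)
      qed
      show "(l y - l x) * norm y \<le> norm (x - y)"
      proof (cases "norm y \<le> R")
        case True
        then have "(l y - l x) * norm y = (1 - R / norm x) * norm y" by (simp add: l_def lx[unfolded l_def])
        also have "\<dots> \<le> (1 - R / norm x) * R" using True x R by (intro mult_left_mono) auto
        also have "\<dots> = (norm x - R) * (R / norm x)" using x by (simp add: field_simps)
        also have "\<dots> \<le> (norm x - R) * 1" using x R by (intro mult_left_mono) auto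
        also have "\<dots> \<le> norm x - norm y" using True by simp
        finally show ?thesis using tri by simp
      next
        case False
        then have y: "norm y > 0" using R by linarith
        have "(l y - l x) * norm y = (norm x - norm y) * (R / norm x)"
          using False x y by (simp add: l_def field_simps)
        also have "\<dots> \<le> (norm x - norm y) * 1" using x R le by (intro mult_left_mono) auto
        finally show ?thesis using tri by simp
      qed
    qed
    have "l x *\<^sub>R x - l y *\<^sub>R y = l x *\<^sub>R (x - y) - (l y - l x) *\<^sub>R y" by (simp add: algebra_simps)
    then have "norm (l x *\<^sub>R x - l y *\<^sub>R y) \<le> norm (l x *\<^sub>R (x - y)) + norm ((l y - l x) *\<^sub>R y)"
      by (simp only: norm_triangle_ineq4)
    also have "\<dots> \<le> 1 * norm (x - y) + (l y - l x) * norm y"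
      unfolding norm_scaleR using lx(2,3) key(2) by (intro add_mono mult_right_mono) auto
    finally show ?thesis using key(1) by simp
  qed
  show ?thesis
  proof (cases "norm y \<le> norm x")
    case True then show ?thesis by (rule main)
  next
    case False
    then have "norm (l y *\<^sub>R y - l x *\<^sub>R x) \<le> 2 * norm (y - x)" by (intro main) simp
    then show ?thesis by (simp only: norm_minus_commute)
  qed
qed

lemma bounded_linear_apply_bcontfun: "bounded_linear (\<lambda>f. apply_bcontfun f n :: 'b::real_normed_vector)"
  by (rule bounded_linear_intro[where K = 1]) (auto simp: norm_bounded)

lemma norm_prod3_diff:
  fixes a b d :: complex
  assumes "cmod a \<le> R" "cmod b \<le> R" "cmod d \<le> R" "cmod a' \<le> R" "cmod b' \<le> R" "cmod d' \<le> R"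
    and "cmod (a - a') \<le> e" "cmod (b - b') \<le> e" "cmod (d - d') \<le> e"
  shows "cmod (a * b * d - a' * b' * d') \<le> 3 * R\<^sup>2 * e"
proof -
  have R: "R \<ge> 0" using order_trans[OF norm_ge_zero assms(1)] .
  have e: "e \<ge> 0" using order_trans[OF norm_ge_zero assms(7)] .
  have eq: "a * b * d - a' * b' * d' = (a - a') * b * d + a' * (b - b') * d + a' * b' * (d - d')"
    by (simp add: algebra_simps)
  have "cmod ((a - a') * b * d) \<le> e * R * R" "cmod (a' * (b - b') * d) \<le> R * e * R" "cmod (a' * b' * (d - d')) \<le> R * R * e"
    unfolding norm_mult using assms R e by (auto intro!: mult_mono)
  from norm_triangle_le[OF add_mono[OF norm_triangle_le[OF add_mono[OF this(1,2)]] this(3)]]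
  show ?thesis unfolding eq by (simp add: power2_eq_square mult_ac)
qed

text \<open>Conservation of mass for the truncated equation: the sum is invariant under permutations of
  the four frequencies, which add up to zero.\<close>

lemma quartic_sum_zero:
  assumes re: "real_valued x" and sup: "\<And>n. \<bar>n\<bar> > int N \<Longrightarrow> x n = 0"
  shows "(\<Sum>n\<in>{- int N..int N}. of_int n * cnj (x n) * (\<Sum>(k,j)\<in>{- int N..int N}\<times>{- int N..int N}. x k * x j * x (n-k-j))) = (0::complex)"
    (is "?S = 0")
proof -
  let ?I = "{- int N..int N}"
  define Q where "Q = {(a,b,d,e) \<in> ?I \<times> ?I \<times> ?I \<times> ?I. a + b + d + e = 0}"
  have Q: "finite Q" unfolding Q_def by (rule finite_subset[of _ "?I \<times> ?I \<times> ?I \<times> ?I"]) auto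
  define \<Theta> where "\<Theta> = (\<lambda>(a,b,d,e). x a * x b * x d * x e)"
  have xm: "cnj (x n) = x (- n)" for n using re by (simp add: real_valued_def)
  have "?S = (\<Sum>(n,k,j)\<in>?I \<times> ?I \<times> ?I. of_int n * x (- n) * (x k * x j * x (n-k-j)))"
    by (simp add: sum_distrib_left sum.cartesian_product case_prod_unfold xm)
  also have "\<dots> = (\<Sum>(a,b,d,e)\<in>Q. - of_int e * \<Theta> (a,b,d,e))"
  \<comment> \<open>The fourth frequency is e = -n. Triples whose last frequency leaves the range
    have no partner in \<open>Q\<close>; their terms vanish by the support of
    \<open>x\<close>.\<close>
  proof (rule sum.reindex_bij_witness_not_neutral[where S' = "{(n,k,j) \<in> ?I \<times> ?I \<times> ?I. n-k-j \<notin> ?I}" and T' = "{}"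
        and j = "\<lambda>(n,k,j). (k,j,n-k-j,-n)" and i = "\<lambda>(a,b,d,e). (-e,a,b)"])
    show "finite {(n,k,j) \<in> ?I \<times> ?I \<times> ?I. n-k-j \<notin> ?I}"
      by (rule finite_subset[of _ "?I \<times> ?I \<times> ?I"]) auto
  qed (auto simp: Q_def \<Theta>_def sup)
  finally have S: "?S = (\<Sum>(a,b,d,e)\<in>Q. - of_int e * \<Theta> (a,b,d,e))" .
  have 1: "(\<Sum>(a,b,d,e)\<in>Q. of_int a * \<Theta> (a,b,d,e)) = (\<Sum>(a,b,d,e)\<in>Q. of_int e * \<Theta> (a,b,d,e))"
    by (rule sum.reindex_bij_witness[where i = "\<lambda>(a,b,d,e). (e,b,d,a)" and j = "\<lambda>(a,b,d,e). (e,b,d,a)"])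
       (auto simp: Q_def \<Theta>_def)
  have 2: "(\<Sum>(a,b,d,e)\<in>Q. of_int b * \<Theta> (a,b,d,e)) = (\<Sum>(a,b,d,e)\<in>Q. of_int e * \<Theta> (a,b,d,e))"
    by (rule sum.reindex_bij_witness[where i = "\<lambda>(a,b,d,e). (a,e,d,b)" and j = "\<lambda>(a,b,d,e). (a,e,d,b)"])
       (auto simp: Q_def \<Theta>_def)
  have 3: "(\<Sum>(a,b,d,e)\<in>Q. of_int d * \<Theta> (a,b,d,e)) = (\<Sum>(a,b,d,e)\<in>Q. of_int e * \<Theta> (a,b,d,e))"
    by (rule sum.reindex_bij_witness[where i = "\<lambda>(a,b,d,e). (a,b,e,d)" and j = "\<lambda>(a,b,d,e). (a,b,e,d)"])
       (auto simp: Q_def \<Theta>_def)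
  have "(\<Sum>(a,b,d,e)\<in>Q. of_int a * \<Theta> (a,b,d,e)) + (\<Sum>(a,b,d,e)\<in>Q. of_int b * \<Theta> (a,b,d,e))
      + (\<Sum>(a,b,d,e)\<in>Q. of_int d * \<Theta> (a,b,d,e)) + (\<Sum>(a,b,d,e)\<in>Q. of_int e * \<Theta> (a,b,d,e)) = 0"
    unfolding sum.distrib[symmetric]
  proof (rule sum.neutral, clarify)
    fix a b d e assume "(a,b,d,e) \<in> Q"
    then have "a + b + d + e = 0" by (simp add: Q_def)
    then have "of_int a + of_int b + of_int d + of_int e = (0::complex)" by (metis of_int_0 of_int_add)
    then show "of_int a * \<Theta> (a,b,d,e) + of_int b * \<Theta> (a,b,d,e) + of_int d * \<Theta> (a,b,d,e) + of_int e * \<Theta> (a,b,d,e) = 0"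
      by (simp add: distrib_right[symmetric])
  qed
  then have "4 * (\<Sum>(a,b,d,e)\<in>Q. of_int e * \<Theta> (a,b,d,e)) = 0" unfolding 1 2 3 by simp
  then show ?thesis unfolding S by (simp add: sum_negf case_prod_unfold)
qed

context mkaw
begin

text \<open>Conservation of mass is part of the notion, as the a priori bound relies on it. Only
  \<open>k\<close> and \<open>j\<close> are restricted in the sum, since the support of
  \<open>v\<close> restricts the third frequency.\<close>

definition galsol :: "nat \<Rightarrow> real \<Rightarrow> (int \<Rightarrow> complex) \<Rightarrow> (real \<Rightarrow> int \<Rightarrow> complex) \<Rightarrow> bool" where
  "galsol N T v0 v \<longleftrightarrow> (\<forall>n. v 0 n = (if \<bar>n\<bar> \<le> int N then v0 n else 0)) \<and>
    (\<forall>t\<in>{0..T}. real_valued (v t) \<and> (\<forall>n. \<bar>n\<bar> > int N \<longrightarrow> v t n = 0) \<and>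
      (\<Sum>n\<in>{- int N..int N}. (cmod (v t n))\<^sup>2) = (\<Sum>n\<in>{- int N..int N}. (cmod (v0 n))\<^sup>2) \<and>
      (\<forall>n. \<bar>n\<bar> \<le> int N \<longrightarrow> ((\<lambda>t. v t n) has_vector_derivative
        (\<i> * of_real (phase \<beta> \<gamma> n) * v t n + \<i> * of_int n * of_real c * sum (cub1 (v t) n) (box N))) (at t within {0..T})))"

text \<open>The vector field is modified twice before \<open>picard_global\<close> applies: values
  are symmetrised, which forces real-valuedness, and the cubic part is cut off outside a ball. Mass
  is conserved for the modified equation too, keeps the solution inside the ball, and so shows that
  the cut-off never acts.\<close>

lemma galerkin_exists:
  assumes T: "T \<ge> 0" and re0: "real_valued v0"
  obtains v where "galsol N T v0 v"
proof -
  let ?I = "{- int N..int N}"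
  define m0 where "m0 = (\<Sum>n\<in>?I. (cmod (v0 n))\<^sup>2)"
  have m0: "m0 \<ge> 0" unfolding m0_def by (intro sum_nonneg) auto
  \<comment> \<open>The mass bounds the supremum norm by its root; the additional 1 keeps the radius
    positive for zero data.\<close>
  define R where "R = sqrt m0 + 1"
  have R: "R > 0" using m0 by (simp add: R_def add_nonneg_pos)
  define l where "l X = (if norm X \<le> R then 1 else R / norm X)" for X :: "int \<Rightarrow>\<^sub>C complex"
  \<comment> \<open>Projection onto sequences with the symmetry of a real function. The modified
    field has this symmetry at every argument, so the defect of the solution has zero
    derivative.\<close>
  define sy where "sy x n = (x n + cnj (x (- n))) / 2" for x :: "int \<Rightarrow> complex" and n
  define z where "z X n = of_real (l X) * sy (apply_bcontfun X) n" for X n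
  define rhs where "rhs X n = (if \<bar>n\<bar> \<le> int N then \<i> * of_real (phase \<beta> \<gamma> n) * sy (apply_bcontfun X) n
    + \<i> * of_int n * of_real c * sum (cub1 (z X) n) (box N) else 0)" for X n
  have rhs_b: "rhs X \<in> bcontfun" for X
  proof (rule bcontfun_normI)
    fix n show "norm (rhs X n) \<le> (\<Sum>n\<in>?I. norm (rhs X n))"
    proof (cases "n \<in> ?I")
      case True then show ?thesis by (intro member_le_sum) auto
    next
      case False
      then have "\<not> \<bar>n\<bar> \<le> int N" by auto
      then have "rhs X n = 0" by (simp only: rhs_def if_False)
      then show ?thesis by (simp add: sum_nonneg)
    qed
  qed simp
  define F where "F X = Bcontfun (rhs X)" for X
  have F: "apply_bcontfun (F X) n = rhs X n" for X n unfolding F_def by (subst Bcontfun_inverse[OF rhs_b]) simp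
  have sy_le: "cmod (sy (apply_bcontfun X) n) \<le> norm X" for X n
  proof -
    have "cmod (apply_bcontfun X n + cnj (apply_bcontfun X (- n))) \<le> norm X + norm X"
      by (rule norm_triangle_le, rule add_mono) (auto intro: norm_bounded)
    then show ?thesis by (simp add: sy_def norm_divide)
  qed
  have sy_diff: "sy (apply_bcontfun X) n - sy (apply_bcontfun Y) n = sy (apply_bcontfun (X - Y)) n" for X Y n
    by (simp add: sy_def diff_divide_distrib add_divide_distrib)
  have z_eq: "z X n = sy (apply_bcontfun (l X *\<^sub>R X)) n" for X n
    by (simp add: z_def sy_def scaleR_conv_of_real algebra_simps)
  have lX: "norm (l X *\<^sub>R X) \<le> R" for X using R by (auto simp: l_def)
  have z_le: "cmod (z X n) \<le> R" for X n unfolding z_eq using sy_le lX order_trans by blast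
  have z_diff: "cmod (z X n - z Y n) \<le> 2 * norm (X - Y)" for X Y n
    unfolding z_eq sy_diff
    by (rule order_trans[OF sy_le]) (use radial_lipschitz[OF R, of X Y] in \<open>simp add: l_def\<close>)
  define Lc where "Lc = (\<Sum>n\<in>?I. \<bar>phase \<beta> \<gamma> n\<bar>) + real N * \<bar>c\<bar> * (real (card (box N)) * (6 * R\<^sup>2)) + 1"
  have Lc: "Lc > 0" unfolding Lc_def by (intro add_nonneg_pos add_nonneg_nonneg sum_nonneg mult_nonneg_nonneg) auto
  have lip: "norm (F X - F Y) \<le> Lc * norm (X - Y)" for X Y
  proof (rule norm_bound)
    fix n
    show "norm (apply_bcontfun (F X - F Y) n) \<le> Lc * norm (X - Y)"
    proof (cases "\<bar>n\<bar> \<le> int N")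
      case False then show ?thesis using Lc by (simp add: F rhs_def)
    next
      case True
      let ?d = "sum (cub1 (z X) n) (box N) - sum (cub1 (z Y) n) (box N)"
      have d: "cmod ?d \<le> real (card (box N)) * (6 * R\<^sup>2 * norm (X - Y))"
        unfolding sum_subtractf[symmetric]
      proof (rule sum_norm_bound, clarify)
        fix k j
        have "cmod (z X k * z X j * z X (n-k-j) - z Y k * z Y j * z Y (n-k-j)) \<le> 3 * R\<^sup>2 * (2 * norm (X - Y))"
          by (intro norm_prod3_diff z_le z_diff)
        then show "cmod (cub1 (z X) n (k,j) - cub1 (z Y) n (k,j)) \<le> 6 * R\<^sup>2 * norm (X - Y)"
          by (simp add: cub_def)
      qed
      have "apply_bcontfun (F X - F Y) n = rhs X n - rhs Y n" by (simp only: minus_bcontfun.rep_eq F)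
      also have "\<dots> = \<i> * of_real (phase \<beta> \<gamma> n) * sy (apply_bcontfun (X - Y)) n
        + \<i> * of_int n * of_real c * ?d"
        using True by (simp only: rhs_def if_True sy_diff[symmetric]) (simp add: algebra_simps)
      finally have "norm (apply_bcontfun (F X - F Y) n) \<le> \<bar>phase \<beta> \<gamma> n\<bar> * cmod (sy (apply_bcontfun (X - Y)) n) + \<bar>real_of_int n\<bar> * \<bar>c\<bar> * cmod ?d"
        using norm_triangle_ineq[of "\<i> * of_real (phase \<beta> \<gamma> n) * sy (apply_bcontfun (X - Y)) n" "\<i> * of_int n * of_real c * ?d"]
        by (simp only: norm_mult norm_of_real norm_ii norm_of_int mult_1_left)
      also have "\<dots> \<le> (\<Sum>n\<in>?I. \<bar>phase \<beta> \<gamma> n\<bar>) * norm (X - Y) + real N * \<bar>c\<bar> * (real (card (box N)) * (6 * R\<^sup>2 * norm (X - Y)))"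
      proof (intro add_mono mult_mono d sy_le)
        show "\<bar>phase \<beta> \<gamma> n\<bar> \<le> (\<Sum>n\<in>?I. \<bar>phase \<beta> \<gamma> n\<bar>)" using True by (intro member_le_sum) auto
        show "\<bar>real_of_int n\<bar> \<le> real N" using True by linarith
      qed (auto intro: sum_nonneg)
      also have "\<dots> = ((\<Sum>n\<in>?I. \<bar>phase \<beta> \<gamma> n\<bar>) + real N * \<bar>c\<bar> * (real (card (box N)) * (6 * R\<^sup>2))) * norm (X - Y)"
        by (simp add: algebra_simps)
      also have "\<dots> \<le> Lc * norm (X - Y)" unfolding Lc_def by (intro mult_right_mono) auto
      finally show ?thesis .
    qed
  qed
  define init where "init n = (if \<bar>n\<bar> \<le> int N then v0 n else 0)" for n
  have init_b: "init \<in> bcontfun"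
  proof (rule bcontfun_normI)
    fix n show "norm (init n) \<le> (\<Sum>n\<in>?I. norm (v0 n))"
    proof (cases "n \<in> ?I")
      case True
      then have "init n = v0 n" by (auto simp: init_def)
      moreover have "norm (v0 n) \<le> (\<Sum>n\<in>?I. norm (v0 n))" using True by (intro member_le_sum) auto
      ultimately show ?thesis by simp
    next
      case False
      then have "init n = 0" by (auto simp: init_def)
      then show ?thesis by (simp add: sum_nonneg)
    qed
  qed simp
  obtain X where X0: "X 0 = Bcontfun init" and dX: "\<And>t. t \<in> {0..T} \<Longrightarrow> (X has_vector_derivative F (X t)) (at t within {0..T})"
    using picard_global[OF lip Lc T, of "Bcontfun init"] by blast
  define v where "v t n = apply_bcontfun (X t) n" for t n
  have v0: "v 0 n = init n" for n unfolding v_def X0 by (subst Bcontfun_inverse[OF init_b]) simp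
  have dv: "((\<lambda>t. v t n) has_vector_derivative rhs (X t) n) (at t within {0..T})" if "t \<in> {0..T}" for t n
    using bounded_linear.has_vector_derivative[OF bounded_linear_apply_bcontfun dX[OF that], of n]
    by (simp add: v_def[abs_def] F)
  have const: "f t = f 0" if d: "\<And>t. t \<in> {0..T} \<Longrightarrow> (f has_vector_derivative 0) (at t within {0..T})" and t: "t \<in> {0..T}"
    for f :: "real \<Rightarrow> 'z::real_normed_vector" and t
  proof -
    obtain k where k: "\<And>t. t \<in> {0..T} \<Longrightarrow> f t = k"
      by (rule has_vector_derivative_zero_constant[of "{0..T}" f]) (use d in auto)
    have "0 \<in> {0..T}" using T by simp
    then show ?thesis using k[OF t] k by metis
  qed
  have sup: "v t n = 0" if "t \<in> {0..T}" "\<bar>n\<bar> > int N" for t n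
  proof -
    have "v t n = v 0 n"
      by (rule const[of "\<lambda>t. v t n", OF _ that(1)]) (use dv[of _ n] that(2) in \<open>simp add: rhs_def\<close>)
    then show ?thesis using that(2) by (simp add: v0 init_def)
  qed
  have sy_m: "sy x (- n) = cnj (sy x n)" for x n by (simp add: sy_def add.commute)
  have ph_m: "phase \<beta> \<gamma> (- n) = - phase \<beta> \<gamma> n" for n by (simp add: phase_def)
  have rhs_m: "rhs Y (- n) = cnj (rhs Y n)" for Y n
  proof -
    have zm: "z Y (- n) = cnj (z Y n)" for n by (simp add: z_def sy_m)
    have "sum (cub1 (z Y) (- n)) (box N) = (\<Sum>p\<in>box N. cnj (cub1 (z Y) n p))"
    proof (rule sum.reindex_bij_witness[where i = "\<lambda>(k,j). (-k,-j)" and j = "\<lambda>(k,j). (-k,-j)"], goal_cases)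
      case (5 p)
      obtain k j where p: "p = (k,j)" by (cases p)
      have "- n - k - j = - (n - (-k) - (-j))" by simp
      then have "z Y (- n - k - j) = cnj (z Y (n - (-k) - (-j)))" by (metis zm)
      moreover have "z Y k = cnj (z Y (- k))" "z Y j = cnj (z Y (- j))" using zm[of "-k"] zm[of "-j"] by simp_all
      ultimately show ?case by (simp add: p cub_def)
    qed (auto simp: box_def)
    then show ?thesis by (simp add: rhs_def sy_m ph_m cnj_sum)
  qed
  have re: "v t (- n) = cnj (v t n)" if "t \<in> {0..T}" for t n
  proof -
    have "v t (- n) - cnj (v t n) = v 0 (- n) - cnj (v 0 n)"
    proof (rule const[of "\<lambda>t. v t (- n) - cnj (v t n)", OF _ that])
      fix t assume t: "t \<in> {0..T}"
      have "((\<lambda>t. v t (- n) - cnj (v t n)) has_vector_derivative (rhs (X t) (- n) - cnj (rhs (X t) n))) (at t within {0..T})"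
        by (intro has_vector_derivative_diff dv t bounded_linear.has_vector_derivative[OF bounded_linear_cnj])
      then show "((\<lambda>t. v t (- n) - cnj (v t n)) has_vector_derivative 0) (at t within {0..T})" by (simp add: rhs_m)
    qed
    then show ?thesis using re0 by (simp add: v0 init_def real_valued_def split: if_splits)
  qed
  have rev: "real_valued (v t)" if "t \<in> {0..T}" for t using re[OF that] by (simp add: real_valued_def)
  have sy_v: "sy (apply_bcontfun (X t)) n = v t n" if "t \<in> {0..T}" for t n
    using re[OF that, of n] by (simp add: sy_def v_def)
  have cub_z: "cub1 (z (X t)) n p = of_real (l (X t))^3 * cub1 (v t) n p" if "t \<in> {0..T}" for t n p
    by (cases p) (simp add: cub_def z_def sy_v[OF that] power3_eq_cube)
  have rhs_v: "rhs (X t) n = \<i> * of_real (phase \<beta> \<gamma> n) * v t n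
      + \<i> * of_int n * of_real c * (of_real (l (X t))^3 * sum (cub1 (v t) n) (box N))"
    if "t \<in> {0..T}" "\<bar>n\<bar> \<le> int N" for t n
    using that by (simp add: rhs_def sy_v cub_z sum_distrib_left[symmetric])
  \<comment> \<open>At this point the cut-off may still act. It multiplies the cubic term by a real
    number independent of \<open>n\<close>, which does not disturb the cancellation in
    \<open>quartic_sum_zero\<close>.\<close>
  have mass: "(\<Sum>n\<in>?I. (cmod (v t n))\<^sup>2) = m0" if t: "t \<in> {0..T}" for t
  proof -
    let ?m = "\<lambda>t. \<Sum>n\<in>?I. Re (cnj (v t n) * v t n)"
    have eqm: "?m t = (\<Sum>n\<in>?I. (cmod (v t n))\<^sup>2)" for t
      by (rule sum.cong) (simp_all add: cmod_power2, simp add: power2_eq_square)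
    have "?m t = ?m 0"
    proof (rule const[of ?m, OF _ t])
      fix t assume t: "t \<in> {0..T}"
      have d: "(?m has_vector_derivative (\<Sum>n\<in>?I. Re (cnj (v t n) * rhs (X t) n + cnj (rhs (X t) n) * v t n))) (at t within {0..T})"
        by (rule has_vector_derivative_sum, rule bounded_linear.has_vector_derivative[OF bounded_linear_Re],
            rule has_vector_derivative_mult, rule bounded_linear.has_vector_derivative[OF bounded_linear_cnj])
           (rule dv[OF t])+
      have "(\<Sum>n\<in>?I. Re (cnj (v t n) * rhs (X t) n + cnj (rhs (X t) n) * v t n)) = (\<Sum>n\<in>?I. 2 * Re (cnj (v t n) * rhs (X t) n))"
        by (rule sum.cong) (auto simp: algebra_simps)
      also have "\<dots> = (\<Sum>n\<in>?I. 2 * Re (\<i> * of_real (c * l (X t)^3) * (of_int n * cnj (v t n) * sum (cub1 (v t) n) (box N))))"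
      proof (rule sum.cong[OF refl])
        fix n assume "n \<in> ?I"
        then have n: "\<bar>n\<bar> \<le> int N" by auto
        have "cnj (v t n) * rhs (X t) n = \<i> * of_real (phase \<beta> \<gamma> n) * (v t n * cnj (v t n))
          + \<i> * of_real (c * l (X t)^3) * (of_int n * cnj (v t n) * sum (cub1 (v t) n) (box N))"
          unfolding rhs_v[OF t n] by (simp add: algebra_simps)
        then show "2 * Re (cnj (v t n) * rhs (X t) n) = 2 * Re (\<i> * of_real (c * l (X t)^3) * (of_int n * cnj (v t n) * sum (cub1 (v t) n) (box N)))"
          unfolding complex_norm_square[symmetric] by simp
      qed
      also have "\<dots> = 2 * Re (\<i> * of_real (c * l (X t)^3) * (\<Sum>n\<in>?I. of_int n * cnj (v t n) * sum (cub1 (v t) n) (box N)))"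
        unfolding sum_distrib_left Re_sum by simp
      also have "(\<Sum>n\<in>?I. of_int n * cnj (v t n) * sum (cub1 (v t) n) (box N)) = 0"
        using quartic_sum_zero[OF rev[OF t], of N] sup[OF t] by (simp add: cub_def box_def)
      finally show "(?m has_vector_derivative 0) (at t within {0..T})" using d by simp
    qed
    moreover have "(\<Sum>n\<in>?I. (cmod (v 0 n))\<^sup>2) = m0" unfolding m0_def by (rule sum.cong) (auto simp: v0 init_def)
    ultimately show ?thesis unfolding eqm by simp
  qed
  have l1: "l (X t) = 1" if t: "t \<in> {0..T}" for t
  proof -
    have "norm (X t) \<le> R"
    proof (rule norm_bound)
      fix n
      show "norm (apply_bcontfun (X t) n) \<le> R"
      proof (cases "\<bar>n\<bar> \<le> int N")
        case True
        then have "(cmod (v t n))\<^sup>2 \<le> (\<Sum>n\<in>?I. (cmod (v t n))\<^sup>2)" by (intro member_le_sum) auto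
        then have "(cmod (v t n))\<^sup>2 \<le> m0" by (simp add: mass[OF t])
        then have "cmod (v t n) \<le> sqrt m0" by (rule real_le_rsqrt)
        then show ?thesis by (simp add: R_def v_def)
      next
        case False
        then have "v t n = 0" using sup[OF t] by simp
        then show ?thesis using R by (simp add: v_def)
      qed
    qed
    then show ?thesis by (simp add: l_def)
  qed
  show ?thesis
  proof (rule that[of v])
    show "galsol N T v0 v"
      unfolding galsol_def
    proof (intro conjI ballI allI impI)
      fix t n assume t: "t \<in> {0..T}" and n: "\<bar>n\<bar> \<le> int N"
      show "((\<lambda>t. v t n) has_vector_derivative (\<i> * of_real (phase \<beta> \<gamma> n) * v t n
          + \<i> * of_int n * of_real c * sum (cub1 (v t) n) (box N))) (at t within {0..T})"
        using dv[OF t, of n] rhs_v[OF t n] l1[OF t] by simp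
    qed (use v0 rev sup mass in \<open>auto simp: init_def m0_def\<close>)
  qed
qed

end

section \<open>A priori bounds\<close>

lemma W_powr: "W p n = W 1 n powr p"
  by (simp add: W_def powr_powr)

text \<open>Split at a scale \<open>L\<close>: the first factor is of order E/L and the second of
  order L M, so the scale cancels in the product. That the result is exactly linear in the
  \<open>H^s\<close> energy is what keeps Gronwall's inequality linear.\<close>

lemma interpolation:
  assumes s: "s > 1/2"
  obtains C where "C \<ge> 0"
    "\<And>f F. finite F \<Longrightarrow> (\<Sum>n\<in>F. W (2 * s - 1) n * (f n)\<^sup>2) * (\<Sum>n\<in>F. \<bar>f n\<bar>)\<^sup>2
      \<le> C * (\<Sum>n\<in>F. (f n)\<^sup>2) * (\<Sum>n\<in>F. (W s n * f n)\<^sup>2)"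
proof -
  have p: "2 * s > 1" using s by simp
  from scaled_weight_sum[OF p] obtain C where C: "C \<ge> 1"
    "\<And>F L. finite F \<Longrightarrow> L \<ge> 1 \<Longrightarrow> (\<Sum>n\<in>F. 1 / (1 + (W 1 n / L) powr (2 * s))) \<le> C * L" by blast
  have "(\<Sum>n\<in>F. W (2 * s - 1) n * (f n)\<^sup>2) * (\<Sum>n\<in>F. \<bar>f n\<bar>)\<^sup>2 \<le> (4 * C) * (\<Sum>n\<in>F. (f n)\<^sup>2) * (\<Sum>n\<in>F. (W s n * f n)\<^sup>2)"
    if F: "finite F" for F and f :: "int \<Rightarrow> real"
  proof -
    define M where "M = (\<Sum>n\<in>F. (f n)\<^sup>2)"
    define E where "E = (\<Sum>n\<in>F. (W s n * f n)\<^sup>2)"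
    have Ws: "(W s n * f n)\<^sup>2 = W (2 * s) n * (f n)\<^sup>2" for n
      by (simp add: power_mult_distrib power2_eq_square[of "W s n"] W_mult)
    have M0: "M \<ge> 0" unfolding M_def by (intro sum_nonneg) auto
    have ME: "M \<le> E" unfolding M_def E_def
    proof (rule sum_mono)
      fix n show "(f n)\<^sup>2 \<le> (W s n * f n)\<^sup>2"
        unfolding Ws using mult_right_mono[OF W_ge_1[of "2 * s" n], of "(f n)\<^sup>2"] s by simp
    qed
    show ?thesis
    proof (cases "M = 0")
      case True
      then have "\<forall>n\<in>F. f n = 0" unfolding M_def using F by (subst (asm) sum_nonneg_eq_0_iff) auto
      then show ?thesis by simp
    next
      case False
      then have Mp: "M > 0" using M0 by simp
      \<comment> \<open>The scale at which energy and mass balance, L^(2s) M = E. It is at least 1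
        because the energy dominates the mass.\<close>
      define L where "L = (E / M) powr (1 / (2 * s))"
      have L1: "L \<ge> 1" unfolding L_def using Mp ME s by (intro ge_one_powr_ge_zero) auto
      have "L powr (2 * s) = (E / M) powr ((1 / (2 * s)) * (2 * s))" unfolding L_def powr_powr ..
      also have "\<dots> = E / M" using s Mp ME by simp
      finally have L2: "L powr (2 * s) * M = E" using Mp by simp
      have Lp: "L powr (2 * s) > 0" using L1 by simp
      define w where "w n = 1 + (W 1 n / L) powr (2 * s)" for n
      have w: "w n > 0" for n unfolding w_def by (simp add: add_pos_nonneg)
      have w_eq: "w n = 1 + W (2 * s) n / L powr (2 * s)" for n
        unfolding w_def using L1 by (subst powr_divide) (auto simp: W_powr[of "2 * s"])
      have "(\<Sum>n\<in>F. \<bar>f n\<bar>) = (\<Sum>n\<in>F. \<bar>1 / sqrt (w n)\<bar> * \<bar>sqrt (w n) * f n\<bar>)"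
        by (rule sum.cong) (use w in \<open>auto simp: abs_mult less_imp_le less_imp_neq[symmetric]\<close>)
      also have "\<dots> \<le> L2_set (\<lambda>n. 1 / sqrt (w n)) F * L2_set (\<lambda>n. sqrt (w n) * f n) F"
        by (rule L2_set_mult_ineq)
      finally have "(\<Sum>n\<in>F. \<bar>f n\<bar>)\<^sup>2 \<le> (L2_set (\<lambda>n. 1 / sqrt (w n)) F * L2_set (\<lambda>n. sqrt (w n) * f n) F)\<^sup>2"
        by (intro power_mono sum_nonneg) auto
      also have "\<dots> = (\<Sum>n\<in>F. 1 / w n) * (\<Sum>n\<in>F. w n * (f n)\<^sup>2)"
        using w by (simp add: L2_set_def power_mult_distrib power_divide sum_nonneg less_imp_le)
      also have "(\<Sum>n\<in>F. w n * (f n)\<^sup>2) = M + E / L powr (2 * s)"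
        unfolding w_eq M_def E_def Ws by (simp add: distrib_right sum.distrib sum_divide_distrib)
      also have "E / L powr (2 * s) = M" using L2 Lp by (simp add: field_simps)
      also have "(\<Sum>n\<in>F. 1 / w n) * (M + M) \<le> (C * L) * (M + M)"
        unfolding w_def using M0 by (intro mult_right_mono C(2) F L1) auto
      finally have l1: "(\<Sum>n\<in>F. \<bar>f n\<bar>)\<^sup>2 \<le> 2 * C * L * M" by simp
      have "(\<Sum>n\<in>F. W (2 * s - 1) n * (f n)\<^sup>2) \<le> (\<Sum>n\<in>F. (W (2 * s) n + L powr (2 * s)) / L * (f n)\<^sup>2)"
      proof (intro sum_mono mult_right_mono)
        fix n
        have W1: "W 1 n > 0" by (rule W_pos)
        show "W (2 * s - 1) n \<le> (W (2 * s) n + L powr (2 * s)) / L"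
        proof (cases "L \<le> W 1 n")
          case True
          have "W (2 * s - 1) n * L \<le> W (2 * s - 1) n * W 1 n" by (intro mult_left_mono True) simp
          also have "\<dots> = W (2 * s) n" by (simp add: W_mult)
          also have "\<dots> \<le> W (2 * s) n + L powr (2 * s)" by simp
          finally show ?thesis using L1 by (simp add: field_simps)
        next
          case False
          have "W (2 * s - 1) n \<le> L powr (2 * s - 1)"
            unfolding W_powr[of "2 * s - 1"] using False W1 s by (intro powr_mono2) auto
          also have "\<dots> = L powr (2 * s) / L" using L1 by (simp add: powr_diff)
          also have "\<dots> \<le> (W (2 * s) n + L powr (2 * s)) / L" using L1 by (intro divide_right_mono) auto
          finally show ?thesis .
        qed
      qed auto
      also have "\<dots> = (E + L powr (2 * s) * M) / L"
        unfolding E_def M_def Ws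
        by (simp add: sum_distrib_left sum.distrib[symmetric] sum_divide_distrib add_divide_distrib distrib_right)
      also have "\<dots> = 2 * E / L" unfolding L2 by simp
      finally have l2: "(\<Sum>n\<in>F. W (2 * s - 1) n * (f n)\<^sup>2) \<le> 2 * E / L" .
      have "(\<Sum>n\<in>F. W (2 * s - 1) n * (f n)\<^sup>2) * (\<Sum>n\<in>F. \<bar>f n\<bar>)\<^sup>2 \<le> (2 * E / L) * (2 * C * L * M)"
        using M0 ME L1 by (intro mult_mono l1 l2) auto
      also have "\<dots> = (4 * C) * M * E" using L1 by simp
      finally show ?thesis by (simp only: M_def E_def)
    qed
  qed
  then show ?thesis using that[of "4 * C"] C(1) by simp
qed

text \<open>With all three arguments equal to the moduli of the coefficients, this majorises the
  truncated cubic sum without its derivative.\<close>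

definition qbox :: "nat \<Rightarrow> (int \<Rightarrow> real) \<Rightarrow> (int \<Rightarrow> real) \<Rightarrow> (int \<Rightarrow> real) \<Rightarrow> int \<Rightarrow> real" where
  "qbox N f g h n = (\<Sum>(k,j)\<in>{- int N..int N} \<times> {- int N..int N}. f k * g j * h (n-k-j))"

lemma qbox_swap12: "qbox N f g h n = qbox N g f h n"
  unfolding qbox_def
  by (rule sum.reindex_bij_witness[where i = "\<lambda>(k,j). (j,k)" and j = "\<lambda>(k,j). (j,k)"])
     (auto simp: algebra_simps)

text \<open>The box restricts \<open>k\<close> and \<open>j\<close> but not the third frequency, so
  this exchange is legitimate only for functions supported in the range of the box.\<close>

lemma qbox_swap13:
  assumes "\<And>n. \<bar>n\<bar> > int N \<Longrightarrow> f n = 0" "\<And>n. \<bar>n\<bar> > int N \<Longrightarrow> h n = 0"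
  shows "qbox N f g h n = qbox N h g f n"
  unfolding qbox_def
proof (rule sum.reindex_bij_witness_not_neutral[where i = "\<lambda>(k,j). (n-k-j,j)" and j = "\<lambda>(k,j). (n-k-j,j)"
      and S' = "{(k,j) \<in> {- int N..int N} \<times> {- int N..int N}. n-k-j \<notin> {- int N..int N}}"
      and T' = "{(k,j) \<in> {- int N..int N} \<times> {- int N..int N}. n-k-j \<notin> {- int N..int N}}"])
  show "finite {(k,j) \<in> {- int N..int N} \<times> {- int N..int N}. n-k-j \<notin> {- int N..int N}}"
    "finite {(k,j) \<in> {- int N..int N} \<times> {- int N..int N}. n-k-j \<notin> {- int N..int N}}"
    by (rule finite_subset[of _ "{- int N..int N} \<times> {- int N..int N}"]; auto)+
qed (use assms in \<open>auto simp: algebra_simps\<close>)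

lemma l2b_shift: "l2b w D \<Longrightarrow> l2b (\<lambda>n. w (n - m)) D"
  unfolding l2b_def
proof (intro allI impI)
  fix F :: "int set" assume *: "\<forall>F. finite F \<longrightarrow> L2_set w F \<le> D" and F: "finite F"
  have "L2_set (\<lambda>n. w (n - m)) F = L2_set w ((\<lambda>n. n - m) ` F)"
    unfolding L2_set_def by (subst sum.reindex) (auto simp: inj_on_def)
  then show "L2_set (\<lambda>n. w (n - m)) F \<le> D" using * F by simp
qed

text \<open>Young's inequality with two factors in \<open>l^1\<close> and one in \<open>l^2\<close>,
  after \<open>W_add3\<close> has moved the weight onto one factor and symmetry has brought that
  factor to the last place.\<close>

lemma qbox_l2b:
  assumes sup: "\<And>n. \<bar>n\<bar> > int N \<Longrightarrow> f n = 0" and nn: "\<And>n. f n \<ge> 0" and \<sigma>: "\<sigma> \<ge> 0"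
    and D: "l2b (\<lambda>n. W \<sigma> n * f n) D"
  shows "l2b (\<lambda>n. W \<sigma> n * qbox N f f f n) (3 * 3 powr \<sigma> * D * (\<Sum>n\<in>{- int N..int N}. f n)\<^sup>2)"
proof -
  let ?I = "{- int N..int N}" and ?w = "\<lambda>n. W \<sigma> n * f n"
  have base: "l2b (qbox N f f ?w) (D * (\<Sum>n\<in>?I. f n)\<^sup>2)"
    unfolding l2b_def
  proof (intro allI impI)
    fix F :: "int set" assume F: "finite F"
    have "L2_set (qbox N f f ?w) F = L2_set (\<lambda>n. \<Sum>p\<in>?I \<times> ?I. f (fst p) * f (snd p) * ?w (n - (fst p + snd p))) F"
      by (rule L2_set_cong) (auto simp: qbox_def case_prod_unfold algebra_simps)
    also have "\<dots> \<le> (\<Sum>p\<in>?I \<times> ?I. L2_set (\<lambda>n. f (fst p) * f (snd p) * ?w (n - (fst p + snd p))) F)"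
      by (rule L2_set_sum_le) simp
    also have "\<dots> \<le> (\<Sum>p\<in>?I \<times> ?I. f (fst p) * f (snd p) * D)"
    proof (rule sum_mono)
      fix p
      have "L2_set (\<lambda>n. f (fst p) * f (snd p) * ?w (n - (fst p + snd p))) F = f (fst p) * f (snd p) * L2_set (\<lambda>n. ?w (n - (fst p + snd p))) F"
        by (rule L2_set_right_distrib[symmetric]) (simp add: nn)
      also have "\<dots> \<le> f (fst p) * f (snd p) * D"
        by (intro mult_left_mono l2bD[OF l2b_shift[OF D] F]) (simp add: nn)
      finally show "L2_set (\<lambda>n. f (fst p) * f (snd p) * ?w (n - (fst p + snd p))) F \<le> f (fst p) * f (snd p) * D" .
    qed
    also have "\<dots> = (\<Sum>p\<in>?I \<times> ?I. f (fst p) * f (snd p)) * D" by (simp add: sum_distrib_right)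
    also have "(\<Sum>p\<in>?I \<times> ?I. f (fst p) * f (snd p)) = (\<Sum>n\<in>?I. f n)\<^sup>2"
      by (simp add: power2_eq_square sum_product sum.cartesian_product case_prod_unfold)
    finally show "L2_set (qbox N f f ?w) F \<le> D * (\<Sum>n\<in>?I. f n)\<^sup>2" by (simp add: mult.commute)
  qed
  have "l2b (\<lambda>n. W \<sigma> n * qbox N f f f n) ((3 * 3 powr \<sigma>) * (D * (\<Sum>n\<in>?I. f n)\<^sup>2))"
  proof (rule l2b_cmult_le[OF base])
    fix n
    have q0: "qbox N f f f n \<ge> 0" unfolding qbox_def by (intro sum_nonneg) (auto simp: nn)
    have "W \<sigma> n * qbox N f f f n \<le> 3 powr \<sigma> * (qbox N ?w f f n + qbox N f ?w f n + qbox N f f ?w n)"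
      unfolding qbox_def sum_distrib_left sum.distrib[symmetric]
    proof (rule sum_mono, clarify)
      fix k j
      have "W \<sigma> n \<le> 3 powr \<sigma> * (W \<sigma> k + W \<sigma> j + W \<sigma> (n-k-j))"
        using W_add3[OF \<sigma>, of k j "n-k-j"] by simp
      from mult_right_mono[OF this, of "f k * f j * f (n-k-j)"]
      show "W \<sigma> n * (f k * f j * f (n-k-j)) \<le> 3 powr \<sigma> * (?w k * f j * f (n-k-j) + f k * ?w j * f (n-k-j) + f k * f j * ?w (n-k-j))"
        using nn by (simp add: algebra_simps)
    qed
    also have "qbox N ?w f f n = qbox N f f ?w n" by (rule qbox_swap13) (use sup in auto)
    also have "qbox N f ?w f n = qbox N f f ?w n"
      by (subst qbox_swap12, rule qbox_swap13) (use sup in auto)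
    finally have "W \<sigma> n * qbox N f f f n \<le> 3 * 3 powr \<sigma> * qbox N f f ?w n" by simp
    moreover have "qbox N f f ?w n \<ge> 0" unfolding qbox_def by (intro sum_nonneg) (auto simp: nn)
    ultimately show "\<bar>W \<sigma> n * qbox N f f f n\<bar> \<le> 3 * 3 powr \<sigma> * \<bar>qbox N f f ?w n\<bar>" using q0 by simp
  qed simp
  then show ?thesis by (simp add: mult_ac)
qed

section \<open>Multiplier bounds for the energy\<close>

context mkaw
begin

definition res_kernel :: "int \<Rightarrow> int \<Rightarrow> int \<Rightarrow> real" where
  "res_kernel a b d = sqrt (SS a b d) / \<bar>PP a b d\<bar>"

lemma res_kernel_nonneg: "res_kernel a b d \<ge> 0"
  by (simp add: res_kernel_def SS_nonneg)

text \<open>Up to the square summable \<open>res_kernel\<close>, the inverse resonance function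
  decays like \<open>SS\<close> to the power -3/2. The next two lemmas spend these three half
  powers.\<close>

lemma inverse_Phi_le:
  assumes "PP a b d \<noteq> 0"
  shows "1 / \<bar>Phi a b d\<bar> \<le> res_kernel a b d / (sqrt (SS a b d) * SS a b d)"
proof -
  have S: "real_of_int (SS a b d) \<ge> 1" using SS_ge_1[OF assms] by simp
  have P: "\<bar>real_of_int (PP a b d)\<bar> > 0" using assms by simp
  have "real_of_int (SS a b d) * \<bar>real_of_int (PP a b d)\<bar> \<le> 5/2 * real_of_int (SS a b d) * \<bar>real_of_int (PP a b d)\<bar>"
    using S P by (intro mult_right_mono) auto
  then have "real_of_int (SS a b d) * \<bar>real_of_int (PP a b d)\<bar> \<le> \<bar>Phi a b d\<bar>"
    using Phi_lower[of a b d] by linarith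
  then have "1 / \<bar>Phi a b d\<bar> \<le> 1 / (real_of_int (SS a b d) * \<bar>real_of_int (PP a b d)\<bar>)"
    using S P Phi_ge_SS(2)[OF assms] by (intro divide_left_mono mult_pos_pos) auto
  also have "\<dots> = res_kernel a b d / (sqrt (SS a b d) * SS a b d)" using S by (simp add: res_kernel_def)
  finally show ?thesis .
qed

text \<open>One half power pays for the derivative and a full power of \<open>SS\<close> gives
  1/K^2. Of the two output weights one stays and one moves to the inputs, so the other two inputs
  are measured in L^2 only.\<close>

lemma weight_small:
  assumes "PP a b d \<noteq> 0" "real_of_int (SS a b d) \<ge> K\<^sup>2" "K > 0"
  shows "(W s (a+b+d))\<^sup>2 * \<bar>real_of_int (a+b+d)\<bar> / \<bar>Phi a b d\<bar>
    \<le> 3 powr s / K\<^sup>2 * (res_kernel a b d * W s (a+b+d) * (W s a + W s b + W s d))"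
proof -
  let ?n = "a+b+d" let ?S = "real_of_int (SS a b d)"
  have S: "?S \<ge> 1" using SS_ge_1[OF assms(1)] by simp
  have "\<bar>real_of_int ?n\<bar> / \<bar>Phi a b d\<bar> \<le> sqrt ?S * (res_kernel a b d / (sqrt ?S * ?S))"
    unfolding divide_inverse[of "\<bar>real_of_int ?n\<bar>"] inverse_eq_divide
    using S by (intro mult_mono abs_le_sqrt_SS SS_ge_squares inverse_Phi_le assms(1)) auto
  also have "\<dots> = res_kernel a b d / ?S" using S by simp
  also have "\<dots> \<le> res_kernel a b d / K\<^sup>2" using assms S res_kernel_nonneg[of a b d] by (intro divide_left_mono) auto
  finally have 1: "\<bar>real_of_int ?n\<bar> / \<bar>Phi a b d\<bar> \<le> res_kernel a b d / K\<^sup>2" .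
  have "(W s ?n)\<^sup>2 * \<bar>real_of_int ?n\<bar> / \<bar>Phi a b d\<bar> = (W s ?n * W s ?n) * (\<bar>real_of_int ?n\<bar> / \<bar>Phi a b d\<bar>)"
    by (simp add: power2_eq_square)
  also have "\<dots> \<le> (W s ?n * (3 powr s * (W s a + W s b + W s d))) * (res_kernel a b d / K\<^sup>2)"
    using s by (intro mult_mono 1 W_add3 mult_nonneg_nonneg) (auto intro: add_nonneg_nonneg)
  also have "\<dots> = 3 powr s / K\<^sup>2 * (res_kernel a b d * W s ?n * (W s a + W s b + W s d))" by (simp add: mult_ac)
  finally show ?thesis .
qed

text \<open>Two half powers pay for the two derivatives; the third lowers the squared weight of
  order \<open>s\<close> to that of order \<open>s - 1/2\<close>, because \<open>W 1\<close> at the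
  output is at most twice the root of \<open>SS\<close>.\<close>

lemma weight_remainder:
  assumes "PP a b d \<noteq> 0" "m\<^sup>2 \<le> SS a b d"
  defines "\<sigma> \<equiv> s - 1/2"
  shows "(W s (a+b+d))\<^sup>2 * \<bar>real_of_int (a+b+d)\<bar> / \<bar>Phi a b d\<bar> * \<bar>real_of_int m\<bar>
    \<le> 2 * 3 powr \<sigma> * (res_kernel a b d * W \<sigma> (a+b+d) * (W \<sigma> a + W \<sigma> b + W \<sigma> d))"
proof -
  let ?n = "a+b+d" let ?S = "real_of_int (SS a b d)"
  have S: "?S \<ge> 1" using SS_ge_1[OF assms(1)] by simp
  have "W 1 ?n \<le> 2 * sqrt ?S"
  proof (rule power2_le_imp_le)
    have "?n\<^sup>2 \<le> SS a b d" by (rule SS_ge_squares)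
    then have "real_of_int (?n\<^sup>2) \<le> ?S" by (simp only: of_int_le_iff)
    then have "(real_of_int ?n)\<^sup>2 \<le> ?S" by (simp only: of_int_power)
    then have "1 + (real_of_int ?n)\<^sup>2 \<le> 4 * ?S" using S by linarith
    moreover have "(W 1 ?n)\<^sup>2 = 1 + (real_of_int ?n)\<^sup>2"
      unfolding W_sq using W_base[of ?n] by simp
    ultimately show "(W 1 ?n)\<^sup>2 \<le> (2 * sqrt ?S)\<^sup>2" using S by (simp add: power_mult_distrib)
  qed (use S in simp)
  then have W1: "W 1 ?n / sqrt ?S \<le> 2" using S by (simp add: field_simps)
  have "\<bar>real_of_int ?n\<bar> * \<bar>real_of_int m\<bar> * (1 / \<bar>Phi a b d\<bar>) \<le> (sqrt ?S * sqrt ?S) * (res_kernel a b d / (sqrt ?S * ?S))"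
    using S by (intro mult_mono abs_le_sqrt_SS SS_ge_squares inverse_Phi_le assms(1,2)) auto
  also have "\<dots> = res_kernel a b d / sqrt ?S" using S by simp
  finally have 1: "\<bar>real_of_int ?n\<bar> * \<bar>real_of_int m\<bar> * (1 / \<bar>Phi a b d\<bar>) \<le> res_kernel a b d / sqrt ?S" .
  have W2: "(W s ?n)\<^sup>2 = W \<sigma> ?n * W \<sigma> ?n * W 1 ?n"
    by (simp add: power2_eq_square W_mult \<sigma>_def)
  have "(W s ?n)\<^sup>2 * \<bar>real_of_int ?n\<bar> / \<bar>Phi a b d\<bar> * \<bar>real_of_int m\<bar>
      = (W s ?n)\<^sup>2 * (\<bar>real_of_int ?n\<bar> * \<bar>real_of_int m\<bar> * (1 / \<bar>Phi a b d\<bar>))" by simp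
  also have "\<dots> \<le> (W s ?n)\<^sup>2 * (res_kernel a b d / sqrt ?S)" by (intro mult_left_mono 1) simp
  also have "\<dots> = (W \<sigma> ?n * W \<sigma> ?n * res_kernel a b d) * (W 1 ?n / sqrt ?S)" unfolding W2 by simp
  also have "\<dots> \<le> (W \<sigma> ?n * W \<sigma> ?n * res_kernel a b d) * 2" by (intro mult_left_mono W1 mult_nonneg_nonneg res_kernel_nonneg) auto
  also have "\<dots> = 2 * res_kernel a b d * W \<sigma> ?n * W \<sigma> ?n" by simp
  also have "\<dots> \<le> 2 * res_kernel a b d * W \<sigma> ?n * (3 powr \<sigma> * (W \<sigma> a + W \<sigma> b + W \<sigma> d))"
    using s by (intro mult_left_mono W_add3 mult_nonneg_nonneg res_kernel_nonneg) (auto simp: \<sigma>_def)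
  finally show ?thesis by (simp add: mult_ac)
qed

lemma quad_res_kernel:
  assumes "kernel_bound res_kernel A2" "finite P" "l2b F f" "l2b G g" "l2b H h" "l2b Z z"
    and "\<And>n. F n \<ge> 0" "\<And>n. G n \<ge> 0" "\<And>n. H n \<ge> 0" "\<And>n. Z n \<ge> 0"
  shows "(\<Sum>(a,b,d)\<in>P. res_kernel a b d * F a * G b * H d * Z (a+b+d)) \<le> A2 * f * g * h * z"
  using quad_bound[OF assms(1-6)] assms(7-) by (simp add: res_kernel_nonneg)

text \<open>In the next two lemmas \<open>f\<close> has \<open>L\<^sup>2\<close> norm \<open>m\<close>, \<open>H\<^sup>s\<close> norm \<open>e\<close>, norm \<open>D\<close> in \<open>H\<close> of
  order \<open>s - 1/2\<close>, and its Fourier coefficients have \<open>l\<^sup>1\<close> norm \<open>l\<close>.\<close>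

lemma boundary_sum:
  assumes res_kernel: "kernel_bound res_kernel A2" and P: "finite P"
    and hi: "\<And>a b d. (a,b,d) \<in> P \<Longrightarrow> PP a b d \<noteq> 0 \<and> real_of_int (SS a b d) \<ge> K\<^sup>2" and K: "K > 0"
    and f: "\<And>n. f n \<ge> 0" "l2b f m" "l2b (\<lambda>n. W s n * f n) e"
  shows "(\<Sum>(a,b,d)\<in>P. (W s (a+b+d))\<^sup>2 * \<bar>real_of_int (a+b+d)\<bar> / \<bar>Phi a b d\<bar> * (f a * f b * f d * f (a+b+d)))
    \<le> 3 powr s / K\<^sup>2 * (3 * A2) * e\<^sup>2 * m\<^sup>2"
proof -
  let ?w = "\<lambda>n. W s n * f n"
  let ?t = "\<lambda>F G H a b d. res_kernel a b d * F a * G b * H d * ?w (a+b+d)"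
  let ?c = "\<lambda>a b d. (W s (a+b+d))\<^sup>2 * \<bar>real_of_int (a+b+d)\<bar> / \<bar>Phi a b d\<bar>"
  have "(\<Sum>(a,b,d)\<in>P. ?c a b d * (f a * f b * f d * f (a+b+d)))
    \<le> (\<Sum>(a,b,d)\<in>P. 3 powr s / K\<^sup>2 * (?t ?w f f a b d + ?t f ?w f a b d + ?t f f ?w a b d))"
  proof (rule sum_mono, clarify)
    fix a b d assume "(a,b,d) \<in> P"
    then have p: "PP a b d \<noteq> 0" "real_of_int (SS a b d) \<ge> K\<^sup>2" using hi by auto
    from mult_right_mono[OF weight_small[OF p K], of "f a * f b * f d * f (a+b+d)"]
    show "?c a b d * (f a * f b * f d * f (a+b+d))
      \<le> 3 powr s / K\<^sup>2 * (?t ?w f f a b d + ?t f ?w f a b d + ?t f f ?w a b d)"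
      using f(1) by (simp add: algebra_simps)
  qed
  also have "\<dots> = 3 powr s / K\<^sup>2 * ((\<Sum>(a,b,d)\<in>P. ?t ?w f f a b d)
      + (\<Sum>(a,b,d)\<in>P. ?t f ?w f a b d) + (\<Sum>(a,b,d)\<in>P. ?t f f ?w a b d))"
    unfolding sum.distrib[symmetric] sum_distrib_left by (rule sum.cong) (auto simp: case_prod_unfold)
  also have "\<dots> \<le> 3 powr s / K\<^sup>2 * (A2 * e * m * m * e + A2 * m * e * m * e + A2 * m * m * e * e)"
    by (intro mult_left_mono add_mono quad_res_kernel[OF res_kernel P] f(2,3)) (auto simp: f(1))
  finally show ?thesis by (simp add: power2_eq_square mult_ac)
qed

lemma remainder_sum:
  assumes res_kernel: "kernel_bound res_kernel A2" and P: "finite P" and hi: "\<And>a b d. (a,b,d) \<in> P \<Longrightarrow> PP a b d \<noteq> 0"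
    and f: "\<And>n. f n \<ge> 0" "\<And>n. \<bar>n\<bar> > int N \<Longrightarrow> f n = 0" "l2b f m" "l2b (\<lambda>n. W (s - 1/2) n * f n) D"
  defines "Q \<equiv> qbox N f f f" and "l \<equiv> (\<Sum>n\<in>{- int N..int N}. f n)"
  shows "(\<Sum>(a,b,d)\<in>P. (W s (a+b+d))\<^sup>2 * \<bar>real_of_int (a+b+d)\<bar> / \<bar>Phi a b d\<bar> *
      (\<bar>real_of_int a\<bar> * Q a * f b * f d * f (a+b+d) + f a * (\<bar>real_of_int b\<bar> * Q b) * f d * f (a+b+d)
      + f a * f b * (\<bar>real_of_int d\<bar> * Q d) * f (a+b+d) + f a * f b * f d * (\<bar>real_of_int (a+b+d)\<bar> * Q (a+b+d))))
    \<le> 72 * 9 powr (s - 1/2) * A2 * D\<^sup>2 * l\<^sup>2 * m\<^sup>2"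
proof -
  define \<sigma> where "\<sigma> = s - 1/2"
  have \<sigma>: "\<sigma> > 0" using s by (simp add: \<sigma>_def)
  let ?u = "\<lambda>n. W \<sigma> n * f n" and ?v = "\<lambda>n. W \<sigma> n * Q n"
  have D: "l2b ?u D" using f(4) by (simp add: \<sigma>_def)
  have Qn: "Q n \<ge> 0" for n unfolding Q_def qbox_def by (intro sum_nonneg) (auto simp: f(1))
  define B where "B = 3 * 3 powr \<sigma> * D * l\<^sup>2"
  have vB: "l2b ?v B" unfolding Q_def B_def l_def
    by (rule qbox_l2b) (use f(1,2) D \<sigma> in auto)
  have "l2b (\<lambda>n. W 0 n * qbox N f f f n) (3 * 3 powr 0 * m * (\<Sum>n\<in>{- int N..int N}. f n)\<^sup>2)"
    by (rule qbox_l2b) (use f(1,2,3) in auto)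
  then have QB: "l2b Q (3 * m * l\<^sup>2)" by (simp add: Q_def[symmetric] l_def[symmetric])
  note wr = weight_remainder[folded \<sigma>_def]
  let ?c = "\<lambda>a b d. (W s (a+b+d))\<^sup>2 * \<bar>real_of_int (a+b+d)\<bar> / \<bar>Phi a b d\<bar>"
  let ?g = "\<lambda>a b d. \<bar>real_of_int a\<bar> * Q a * f b * f d * f (a+b+d) + f a * (\<bar>real_of_int b\<bar> * Q b) * f d * f (a+b+d)
      + f a * f b * (\<bar>real_of_int d\<bar> * Q d) * f (a+b+d) + f a * f b * f d * (\<bar>real_of_int (a+b+d)\<bar> * Q (a+b+d))"
  let ?t = "\<lambda>F G H Z a b d. res_kernel a b d * F a * G b * H d * Z (a+b+d)"
  let ?T = "\<lambda>F G H Z. \<Sum>(a,b,d)\<in>P. ?t F G H Z a b d"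
  \<comment> \<open>The row tells which of the four slots carries the cubic factor, the column which
    input receives the moved weight; the output slot is weighted in every term.\<close>
  let ?r = "\<lambda>a b d. 2 * 3 powr \<sigma> *
       ((?t ?v f f ?u a b d + ?t Q ?u f ?u a b d + ?t Q f ?u ?u a b d)
      + (?t ?u Q f ?u a b d + ?t f ?v f ?u a b d + ?t f Q ?u ?u a b d)
      + (?t ?u f Q ?u a b d + ?t f ?u Q ?u a b d + ?t f f ?v ?u a b d)
      + (?t ?u f f ?v a b d + ?t f ?u f ?v a b d + ?t f f ?u ?v a b d))"
  have "(\<Sum>(a,b,d)\<in>P. ?c a b d * ?g a b d) \<le> (\<Sum>(a,b,d)\<in>P. ?r a b d)"
  proof (rule sum_mono, clarify)
    fix a b d assume "(a,b,d) \<in> P"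
    then have p: "PP a b d \<noteq> 0" using hi by auto
    let ?C = "2 * 3 powr \<sigma> * (res_kernel a b d * W \<sigma> (a+b+d) * (W \<sigma> a + W \<sigma> b + W \<sigma> d))"
    have 1: "?c a b d * \<bar>real_of_int i\<bar> * y \<le> ?C * y" if "i\<^sup>2 \<le> SS a b d" "y \<ge> 0" for i y
      using mult_right_mono[OF wr[OF p that(1)] that(2)] by (simp add: mult_ac)
    have "?c a b d * ?g a b d
      = ?c a b d * \<bar>real_of_int a\<bar> * (Q a * f b * f d * f (a+b+d)) + ?c a b d * \<bar>real_of_int b\<bar> * (f a * Q b * f d * f (a+b+d))
      + ?c a b d * \<bar>real_of_int d\<bar> * (f a * f b * Q d * f (a+b+d)) + ?c a b d * \<bar>real_of_int (a+b+d)\<bar> * (f a * f b * f d * Q (a+b+d))"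
      by (simp only: distrib_left mult_ac)
    also have "\<dots> \<le> ?C * (Q a * f b * f d * f (a+b+d)) + ?C * (f a * Q b * f d * f (a+b+d))
      + ?C * (f a * f b * Q d * f (a+b+d)) + ?C * (f a * f b * f d * Q (a+b+d))"
      by (intro add_mono 1 SS_ge_squares mult_nonneg_nonneg f(1) Qn)
    also have "\<dots> = ?r a b d" by (simp only: distrib_left distrib_right mult_ac add_ac)
    finally show "?c a b d * ?g a b d \<le> ?r a b d" .
  qed
  also have "\<dots> = 2 * 3 powr \<sigma> *
       ((?T ?v f f ?u + ?T Q ?u f ?u + ?T Q f ?u ?u) + (?T ?u Q f ?u + ?T f ?v f ?u + ?T f Q ?u ?u)
      + (?T ?u f Q ?u + ?T f ?u Q ?u + ?T f f ?v ?u) + (?T ?u f f ?v + ?T f ?u f ?v + ?T f f ?u ?v))"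
    unfolding sum.distrib[symmetric] sum_distrib_left by (rule sum.cong) (auto simp: case_prod_unfold)
  also have "\<dots> \<le> 2 * 3 powr \<sigma> *
       ((A2 * B * m * m * D + A2 * (3*m*l\<^sup>2) * D * m * D + A2 * (3*m*l\<^sup>2) * m * D * D)
      + (A2 * D * (3*m*l\<^sup>2) * m * D + A2 * m * B * m * D + A2 * m * (3*m*l\<^sup>2) * D * D)
      + (A2 * D * m * (3*m*l\<^sup>2) * D + A2 * m * D * (3*m*l\<^sup>2) * D + A2 * m * m * B * D)
      + (A2 * D * m * m * B + A2 * m * D * m * B + A2 * m * m * D * B))"
    by (intro mult_left_mono add_mono quad_res_kernel[OF res_kernel P] f(3) D vB QB) (auto simp: f(1) Qn)
  \<comment> \<open>In six of the twelve terms weight and cubic factor meet, giving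
    \<open>B\<close>; the other six contain 3 m l^2.\<close>
  also have "\<dots> = 36 * 3 powr \<sigma> * (3 powr \<sigma> + 1) * (A2 * D\<^sup>2 * l\<^sup>2 * m\<^sup>2)"
    unfolding B_def by (simp add: algebra_simps power2_eq_square)
  also have "\<dots> \<le> 36 * 3 powr \<sigma> * (3 powr \<sigma> + 3 powr \<sigma>) * (A2 * D\<^sup>2 * l\<^sup>2 * m\<^sup>2)"
    using res_kernel \<sigma> by (intro mult_right_mono mult_left_mono add_mono) (auto simp: kernel_bound_def ge_one_powr_ge_zero)
  also have "\<dots> = 72 * (3 powr \<sigma> * 3 powr \<sigma>) * (A2 * D\<^sup>2 * l\<^sup>2 * m\<^sup>2)" by simp
  also have "3 powr \<sigma> * 3 powr \<sigma> = 9 powr \<sigma>" by (simp add: powr_mult[symmetric])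
  finally show ?thesis by (simp add: \<sigma>_def mult_ac)
qed

end


lemma l2b_L2_set:
  assumes "finite I" "\<And>n. n \<notin> I \<Longrightarrow> f n = 0"
  shows "l2b f (L2_set f I)"
  unfolding l2b_def
proof (intro allI impI)
  fix F :: "int set" assume F: "finite F"
  have "(\<Sum>n\<in>F. (f n)\<^sup>2) = (\<Sum>n\<in>F \<inter> I. (f n)\<^sup>2)" by (rule sum.mono_neutral_right) (use F assms in auto)
  also have "\<dots> \<le> (\<Sum>n\<in>I. (f n)\<^sup>2)" by (rule sum_mono2) (use assms in auto)
  finally show "L2_set f F \<le> L2_set f I" unfolding L2_set_def by simp
qed

text \<open>With integrating factor exp(-bt) the function y + C is nonincreasing, since b \<ge> 1
  allows the constant to be absorbed as C \<le> b C.\<close>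

lemma exp_gronwall:
  fixes y :: "real \<Rightarrow> real"
  assumes d: "\<And>t. t \<in> {0..T} \<Longrightarrow> (y has_vector_derivative y' t) (at t within {0..T})"
    and le: "\<And>t. t \<in> {0..T} \<Longrightarrow> y' t \<le> C + b * y t" "\<And>t. t \<in> {0..T} \<Longrightarrow> 0 \<le> y t"
    and b: "b \<ge> 1" "C \<ge> 0" and t: "t \<in> {0..T}"
  shows "y t \<le> exp (b * T) * (y 0 + C)"
proof -
  define z where "z r = exp (- (b * r)) * (y r + C)" for r
  define z' where "z' r = exp (- (b * r)) * y' r - b * exp (- (b * r)) * (y r + C)" for r
  have dz: "(z has_derivative (\<lambda>h. h * z' r)) (at r within {0..t})" if r: "0 \<le> r" "r \<le> t" for r
  proof -
    have rT: "r \<in> {0..T}" using r t by auto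
    have "((\<lambda>r. exp (- (b * r))) has_vector_derivative (- b * exp (- (b * r)))) (at r within {0..T})"
      unfolding has_real_derivative_iff_has_vector_derivative[symmetric]
      by (auto intro!: derivative_eq_intros)
    from has_vector_derivative_mult[OF this has_vector_derivative_add[OF d[OF rT] has_vector_derivative_const[of C]]]
    have "(z has_vector_derivative z' r) (at r within {0..T})"
      unfolding z_def[abs_def] by (rule has_vector_derivative_eq_rhs) (simp add: z'_def)
    then have "(z has_vector_derivative z' r) (at r within {0..t})"
      by (rule has_vector_derivative_within_subset) (use t in auto)
    then show ?thesis by (simp add: has_vector_derivative_def)
  qed
  have t0: "0 \<le> t" "t \<le> T" using t by auto
  obtain r where r: "r \<in> {0..t}" "z t - z 0 = (t - 0) * z' r" using mvt_very_simple[OF t0(1) dz] by auto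
  have rT: "r \<in> {0..T}" using r t by auto
  have "y' r \<le> b * (y r + C)"
    using le(1)[OF rT] mult_right_mono[OF b(1) b(2)] by (simp add: algebra_simps)
  then have "exp (- (b * r)) * y' r \<le> exp (- (b * r)) * (b * (y r + C))" by (intro mult_left_mono) auto
  then have "z' r \<le> 0" by (simp add: z'_def mult_ac)
  from r(2) mult_nonneg_nonpos[OF t0(1) this] have "z t \<le> z 0" by simp
  then have "exp (b * t) * (exp (- (b * t)) * (y t + C)) \<le> exp (b * t) * (y 0 + C)"
    by (intro mult_left_mono) (auto simp: z_def)
  then have "y t + C \<le> exp (b * t) * (y 0 + C)" by (simp add: mult.assoc[symmetric] exp_add[symmetric])
  also have "\<dots> \<le> exp (b * T) * (y 0 + C)"
  proof (rule mult_right_mono)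
    show "exp (b * t) \<le> exp (b * T)" using t0 b by simp
    have "0 \<in> {0..T}" using t0 by simp
    from le(2)[OF this] b show "0 \<le> y 0 + C" by simp
  qed
  finally show ?thesis using b by simp
qed

section \<open>The modified energy\<close>

context mkaw
begin

definition inter :: "(real \<Rightarrow> int \<Rightarrow> complex) \<Rightarrow> real \<Rightarrow> int \<Rightarrow> complex" where
  "inter v t n = cis (- (t * phase \<beta> \<gamma> n)) * v t n"

lemma norm_inter [simp]: "cmod (inter v t n) = cmod (v t n)"
  by (simp add: inter_def norm_mult)

lemma cub_inter: "cub (osc t) (inter v t) n p = cis (- (t * phase \<beta> \<gamma> n)) * cub1 (v t) n p"
proof (cases p)
  case (Pair k j)
  let ?l = "n - k - j"
  have "- (t * Phi k j ?l) + - (t * phase \<beta> \<gamma> k) + - (t * phase \<beta> \<gamma> j) + - (t * phase \<beta> \<gamma> ?l) = - (t * phase \<beta> \<gamma> n)"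
    by (simp add: Phi_def algebra_simps)
  then have "osc t k j ?l * cis (- (t * phase \<beta> \<gamma> k)) * cis (- (t * phase \<beta> \<gamma> j)) * cis (- (t * phase \<beta> \<gamma> ?l)) = cis (- (t * phase \<beta> \<gamma> n))"
    by (simp only: osc_def cis_mult)
  then have "cis (- (t * phase \<beta> \<gamma> n)) * (v t k * v t j * v t ?l)
    = (osc t k j ?l * cis (- (t * phase \<beta> \<gamma> k)) * cis (- (t * phase \<beta> \<gamma> j)) * cis (- (t * phase \<beta> \<gamma> ?l))) * (v t k * v t j * v t ?l)" by simp
  then show ?thesis unfolding Pair cub_def inter_def prod.case by (simp only: mult_ac mult_1_left)
qed

definition gal_rhs :: "nat \<Rightarrow> (int \<Rightarrow> complex) \<Rightarrow> real \<Rightarrow> int \<Rightarrow> complex" where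
  "gal_rhs N x t n = (if \<bar>n\<bar> \<le> int N then \<i> * of_int n * of_real c * sum (cub (osc t) x n) (box N) else 0)"

lemma inter_derivative:
  assumes g: "galsol N T v0 v" and t: "t \<in> {0..T}"
  shows "((\<lambda>t. inter v t n) has_vector_derivative gal_rhs N (inter v t) t n) (at t within {0..T})"
proof (cases "\<bar>n\<bar> \<le> int N")
  case True
  let ?p = "phase \<beta> \<gamma> n"
  have "((\<lambda>t. v t n) has_vector_derivative
     (\<i> * of_real ?p * v t n + \<i> * of_int n * of_real c * sum (cub1 (v t) n) (box N))) (at t within {0..T})"
    using g t True by (auto simp: galsol_def)
  from has_vector_derivative_mult[OF has_vector_derivative_cis this]
  show ?thesis unfolding inter_def
  proof (rule has_vector_derivative_eq_rhs)
    have "sum (cub (osc t) (\<lambda>n. cis (- (t * phase \<beta> \<gamma> n)) * v t n) n) (box N) = cis (- (t * ?p)) * sum (cub1 (v t) n) (box N)"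
      unfolding inter_def[symmetric] cub_inter sum_distrib_left ..
    then show "cis (- (t * ?p)) * (\<i> * of_real ?p * v t n + \<i> * of_int n * of_real c * sum (cub1 (v t) n) (box N))
        + - \<i> * of_real ?p * cis (- (t * ?p)) * v t n = gal_rhs N (\<lambda>n. cis (- (t * phase \<beta> \<gamma> n)) * v t n) t n"
      using True by (simp add: gal_rhs_def algebra_simps)
  qed
next
  case False
  have "((\<lambda>t. 0) has_vector_derivative 0) (at t within {0..T})" by simp
  then have "((\<lambda>t. inter v t n) has_vector_derivative 0) (at t within {0..T})"
    by (rule has_vector_derivative_transform[OF t, rotated]) (use g False in \<open>auto simp: galsol_def inter_def\<close>)
  then show ?thesis using False by (simp add: gal_rhs_def)
qed

lemma inter_real: "real_valued (v t) \<Longrightarrow> inter v t (- n) = cnj (inter v t n)"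
proof -
  assume "real_valued (v t)"
  moreover have "phase \<beta> \<gamma> (- n) = - phase \<beta> \<gamma> n" by (simp add: phase_def)
  ultimately show ?thesis by (simp add: real_valued_def inter_def cis_cnj)
qed

lemma gal_rhs_norm: "cmod (gal_rhs N x t n) \<le> \<bar>c\<bar> * (\<bar>real_of_int n\<bar> * qbox N (\<lambda>n. cmod (x n)) (\<lambda>n. cmod (x n)) (\<lambda>n. cmod (x n)) n)"
proof -
  let ?f = "\<lambda>n. cmod (x n)"
  have q: "qbox N ?f ?f ?f n \<ge> 0" unfolding qbox_def by (intro sum_nonneg) auto
  have "cmod (sum (cub (osc t) x n) (box N)) \<le> (\<Sum>(k,j)\<in>box N. ?f k * ?f j * ?f (n-k-j))"
    by (rule sum_norm_le) (use cub_norm_le[where M = "osc t"] in auto)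
  then have "cmod (sum (cub (osc t) x n) (box N)) \<le> qbox N ?f ?f ?f n" by (simp add: qbox_def box_def)
  then have "\<bar>real_of_int n\<bar> * \<bar>c\<bar> * cmod (sum (cub (osc t) x n) (box N)) \<le> \<bar>real_of_int n\<bar> * \<bar>c\<bar> * qbox N ?f ?f ?f n"
    by (intro mult_left_mono) auto
  then show ?thesis using q by (auto simp: gal_rhs_def norm_mult mult_ac)
qed

definition quart :: "(int \<Rightarrow> complex) \<Rightarrow> real \<Rightarrow> int \<times> int \<times> int \<Rightarrow> complex" where
  "quart x t = (\<lambda>(a,b,d). osc t a b d * x a * x b * x d * cnj (x (a+b+d)))"

definition quart_rem :: "(int \<Rightarrow> complex) \<Rightarrow> (int \<Rightarrow> complex) \<Rightarrow> real \<Rightarrow> int \<times> int \<times> int \<Rightarrow> complex" where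
  "quart_rem x y t = (\<lambda>(a,b,d). osc t a b d * y a * x b * x d * cnj (x (a+b+d)) + osc t a b d * x a * y b * x d * cnj (x (a+b+d))
    + osc t a b d * x a * x b * y d * cnj (x (a+b+d)) + osc t a b d * x a * x b * x d * cnj (y (a+b+d)))"

lemma quart_derivative:
  assumes "\<And>n. ((\<lambda>t. x t n) has_vector_derivative y n) (at t within S)"
  shows "((\<lambda>t. quart (x t) t (a,b,d)) has_vector_derivative
    (- \<i> * of_real (Phi a b d) * quart (x t) t (a,b,d) + quart_rem (x t) y t (a,b,d))) (at t within S)"
proof -
  from has_vector_derivative_mult[OF has_vector_derivative_term[where C = 1 and \<phi> = "Phi a b d", OF assms[of a] assms[of b] assms[of d]]
      bounded_linear.has_vector_derivative[OF bounded_linear_cnj assms[of "a+b+d"]]]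
  show ?thesis unfolding quart_def prod.case osc_def mult_1_left
    by (rule has_vector_derivative_eq_rhs) (simp add: quart_rem_def osc_def algebra_simps)
qed

definition P_all :: "nat \<Rightarrow> (int \<times> int \<times> int) set" where
  "P_all N = {(a,b,d) \<in> {- int N..int N} \<times> {- int N..int N} \<times> {- int N..int N}. \<bar>a+b+d\<bar> \<le> int N}"

definition P_low :: "nat \<Rightarrow> real \<Rightarrow> (int \<times> int \<times> int) set" where
  "P_low N K = {(a,b,d) \<in> P_all N. PP a b d \<noteq> 0 \<and> real_of_int (SS a b d) < K\<^sup>2}"

definition P_high :: "nat \<Rightarrow> real \<Rightarrow> (int \<times> int \<times> int) set" where
  "P_high N K = {(a,b,d) \<in> P_all N. PP a b d \<noteq> 0 \<and> real_of_int (SS a b d) \<ge> K\<^sup>2}"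

lemma finite_P_all [simp]: "finite (P_all N)" "finite (P_low N K)" "finite (P_high N K)"
proof -
  show f: "finite (P_all N)"
    by (rule finite_subset[of _ "{- int N..int N} \<times> {- int N..int N} \<times> {- int N..int N}"]) (auto simp: P_all_def)
  show "finite (P_low N K)" "finite (P_high N K)"
    by (rule finite_subset[OF _ f]; auto simp: P_low_def P_high_def)+
qed

definition wt :: "int \<times> int \<times> int \<Rightarrow> real" where
  "wt = (\<lambda>(a,b,d). c * real_of_int (a+b+d) * (W s (a+b+d))\<^sup>2)"

definition energy :: "nat \<Rightarrow> (int \<Rightarrow> complex) \<Rightarrow> real" where
  "energy N x = (\<Sum>n\<in>{- int N..int N}. (W s n)\<^sup>2 * Re (cnj (x n) * x n))"

lemma energy_eq: "energy N x = (\<Sum>n\<in>{- int N..int N}. (W s n * cmod (x n))\<^sup>2)"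
  unfolding energy_def
proof (rule sum.cong[OF refl])
  fix n
  have "cnj (x n) * x n = of_real ((cmod (x n))\<^sup>2)" unfolding complex_norm_square by simp
  then show "(W s n)\<^sup>2 * Re (cnj (x n) * x n) = (W s n * cmod (x n))\<^sup>2" by (simp add: power_mult_distrib)
qed

text \<open>The correction is the energy counterpart of \<open>BL\<close>: differentiating the
  oscillation in it produces \<open>- \<i> wt\<close> times \<open>quart\<close>, which cancels the
  high nonresonant part of the derivative of the energy.\<close>

definition menergy :: "nat \<Rightarrow> real \<Rightarrow> (int \<Rightarrow> complex) \<Rightarrow> real \<Rightarrow> real" where
  "menergy N K x t = energy N x + 2 * Re (\<Sum>(a,b,d)\<in>P_high N K. of_real (wt (a,b,d) / Phi a b d) * quart x t (a,b,d))"

text \<open>The derivative of the energy is a sum over frequency quartets with purely imaginary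
  coefficients. Resonant quartets are real and contribute nothing, low ones are kept, and high ones
  are exchanged for the product rule terms in \<open>quart_rem\<close>.\<close>

lemma menergy_derivative:
  assumes g: "galsol N T v0 v" and t: "t \<in> {0..T}"
  defines "x \<equiv> inter v"
  shows "((\<lambda>t. menergy N K (x t) t) has_vector_derivative
    (2 * Re (\<Sum>p\<in>P_low N K. \<i> * of_real (wt p) * quart (x t) t p)
     + 2 * Re (\<Sum>(a,b,d)\<in>P_high N K. of_real (wt (a,b,d) / Phi a b d) * quart_rem (x t) (gal_rhs N (x t) t) t (a,b,d)))) (at t within {0..T})"
proof -
  let ?I = "{- int N..int N}"
  let ?D = "gal_rhs N (x t) t"
  have dx: "((\<lambda>t. x t n) has_vector_derivative ?D n) (at t within {0..T})" for n
    unfolding x_def by (rule inter_derivative[OF g t])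
  have re: "x t (- n) = cnj (x t n)" for n
    unfolding x_def by (rule inter_real) (use g t in \<open>simp add: galsol_def\<close>)
  have sup: "x t n = 0" if "\<bar>n\<bar> > int N" for n
    using g t that by (auto simp: galsol_def x_def inter_def)
  have dE: "((\<lambda>t. energy N (x t)) has_vector_derivative
     (\<Sum>n\<in>?I. (W s n)\<^sup>2 * Re (cnj (x t n) * ?D n + cnj (?D n) * x t n))) (at t within {0..T})"
    unfolding energy_def
    by (rule has_vector_derivative_sum, rule has_vector_derivative_mult_right,
        rule bounded_linear.has_vector_derivative[OF bounded_linear_Re],
        rule has_vector_derivative_mult, rule bounded_linear.has_vector_derivative[OF bounded_linear_cnj]) (rule dx)+
  define G where "G n k j = 2 * Re (\<i> * of_real (c * real_of_int n * (W s n)\<^sup>2) * (cub (osc t) (x t) n (k,j) * cnj (x t n)))" for n k j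
  define H where "H p = 2 * Re (\<i> * of_real (wt p) * quart (x t) t p)" for p
  have G0: "G n k j = 0" if "n-k-j \<notin> ?I" for n k j
  proof -
    have "\<bar>n-k-j\<bar> > int N" using that by auto
    then have "x t (n-k-j) = 0" by (rule sup)
    then show ?thesis by (simp add: G_def cub_def)
  qed
  have GH: "H (k,j,n-k-j) = G n k j" for n k j
  proof -
    have "quart (x t) t (k,j,n-k-j) = cub (osc t) (x t) n (k,j) * cnj (x t n)" by (simp add: quart_def cub_def)
    moreover have "wt (k,j,n-k-j) = c * real_of_int n * (W s n)\<^sup>2" by (simp add: wt_def)
    ultimately show ?thesis by (simp only: G_def H_def)
  qed
  have "(\<Sum>n\<in>?I. (W s n)\<^sup>2 * Re (cnj (x t n) * ?D n + cnj (?D n) * x t n))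
      = (\<Sum>n\<in>?I. \<Sum>(k,j)\<in>?I \<times> ?I. 2 * Re (\<i> * of_real (c * real_of_int n * (W s n)\<^sup>2) * (cub (osc t) (x t) n (k,j) * cnj (x t n))))"
  proof (rule sum.cong[OF refl])
    fix n assume "n \<in> ?I"
    then have n: "\<bar>n\<bar> \<le> int N" by auto
    have "(W s n)\<^sup>2 * Re (cnj (x t n) * ?D n + cnj (?D n) * x t n) = 2 * Re (of_real ((W s n)\<^sup>2) * (?D n * cnj (x t n)))"
      by (simp add: algebra_simps)
    also have "of_real ((W s n)\<^sup>2) * (?D n * cnj (x t n)) = (\<Sum>p\<in>?I \<times> ?I. \<i> * of_real (c * real_of_int n * (W s n)\<^sup>2) * (cub (osc t) (x t) n p * cnj (x t n)))"
      using n by (simp add: gal_rhs_def box_def sum_distrib_left sum_distrib_right mult_ac)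
    finally show "(W s n)\<^sup>2 * Re (cnj (x t n) * ?D n + cnj (?D n) * x t n)
      = (\<Sum>(k,j)\<in>?I \<times> ?I. 2 * Re (\<i> * of_real (c * real_of_int n * (W s n)\<^sup>2) * (cub (osc t) (x t) n (k,j) * cnj (x t n))))"
      unfolding Re_sum sum_distrib_left by (simp add: case_prod_unfold)
  qed
  also have "\<dots> = (\<Sum>(n,k,j)\<in>?I \<times> ?I \<times> ?I. G n k j)"
    by (simp add: G_def sum.cartesian_product case_prod_unfold)
  also have "\<dots> = (\<Sum>p\<in>P_all N. H p)"
  \<comment> \<open>From output and pair to triples of inputs; terms whose third input leaves the
    range vanish by the support of \<open>x\<close>.\<close>
  proof (rule sum.reindex_bij_witness_not_neutral[where S' = "{(n,k,j) \<in> ?I \<times> ?I \<times> ?I. n-k-j \<notin> ?I}" and T' = "{}"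
        and j = "\<lambda>(n,k,j). (k,j,n-k-j)" and i = "\<lambda>(a,b,d). (a+b+d,a,b)"])
    show "finite {(n,k,j) \<in> ?I \<times> ?I \<times> ?I. n-k-j \<notin> ?I}"
      by (rule finite_subset[of _ "?I \<times> ?I \<times> ?I"]) auto
  qed (auto simp: P_all_def G0 GH)
  also have "\<dots> = (\<Sum>p\<in>P_all N. 2 * Re (\<i> * of_real (wt p) * quart (x t) t p))" by (simp only: H_def)
  also have "\<dots> = (\<Sum>p\<in>P_low N K \<union> P_high N K. 2 * Re (\<i> * of_real (wt p) * quart (x t) t p))"
  proof (rule sum.mono_neutral_right)
    show "\<forall>p\<in>P_all N - (P_low N K \<union> P_high N K). 2 * Re (\<i> * of_real (wt p) * quart (x t) t p) = 0"
    proof (rule ballI)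
      fix p assume p: "p \<in> P_all N - (P_low N K \<union> P_high N K)"
      obtain a b d where abd: "p = (a,b,d)" by (cases p)
      have "PP a b d = 0" using p by (auto simp: abd P_low_def P_high_def)
      \<comment> \<open>Without oscillation, and with two inputs opposite to each other,
        \<open>quart\<close> is a product of two squared moduli. It is real, so its product with
        \<open>\<i> wt\<close> has no real part.\<close>
      then have o: "osc t a b d = 1" by (simp add: osc_def Phi_factor)
      have sq: "x t m * cnj (x t m) = of_real ((cmod (x t m))\<^sup>2)" for m by (rule complex_norm_square[symmetric])
      have "\<exists>r. quart (x t) t p = of_real r"
      proof -
        from \<open>PP a b d = 0\<close> consider "b = - a" | "d = - b" | "d = - a" unfolding PP_def by force
        then show ?thesis
        proof cases
          case 1
          have "quart (x t) t p = (x t a * cnj (x t a)) * (x t d * cnj (x t d))"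
            unfolding abd quart_def prod.case by (simp add: o[unfolded 1] 1 re)
          then show ?thesis unfolding sq of_real_mult[symmetric] by blast
        next
          case 2
          have "quart (x t) t p = (x t a * cnj (x t a)) * (x t b * cnj (x t b))"
            unfolding abd quart_def prod.case by (simp add: o[unfolded 2] 2 re mult_ac)
          then show ?thesis unfolding sq of_real_mult[symmetric] by blast
        next
          case 3
          have "quart (x t) t p = (x t a * cnj (x t a)) * (x t b * cnj (x t b))"
            unfolding abd quart_def prod.case by (simp add: o[unfolded 3] 3 re mult_ac)
          then show ?thesis unfolding sq of_real_mult[symmetric] by blast
        qed
      qed
      then obtain r where "quart (x t) t p = of_real r" by blast
      then show "2 * Re (\<i> * of_real (wt p) * quart (x t) t p) = 0" by simp
    qed
  qed (auto simp: P_low_def P_high_def)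
  also have "\<dots> = (\<Sum>p\<in>P_low N K. 2 * Re (\<i> * of_real (wt p) * quart (x t) t p)) + (\<Sum>p\<in>P_high N K. 2 * Re (\<i> * of_real (wt p) * quart (x t) t p))"
    by (rule sum.union_disjoint, simp, simp, auto simp: P_low_def P_high_def)
  finally have E': "(\<Sum>n\<in>?I. (W s n)\<^sup>2 * Re (cnj (x t n) * ?D n + cnj (?D n) * x t n))
    = (\<Sum>p\<in>P_low N K. 2 * Re (\<i> * of_real (wt p) * quart (x t) t p)) + (\<Sum>p\<in>P_high N K. 2 * Re (\<i> * of_real (wt p) * quart (x t) t p))" .
  have dB: "((\<lambda>t. 2 * Re (\<Sum>(a,b,d)\<in>P_high N K. of_real (wt (a,b,d) / Phi a b d) * quart (x t) t (a,b,d))) has_vector_derivative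
     (2 * Re (\<Sum>(a,b,d)\<in>P_high N K. of_real (wt (a,b,d) / Phi a b d) *
        (- \<i> * of_real (Phi a b d) * quart (x t) t (a,b,d) + quart_rem (x t) ?D t (a,b,d))))) (at t within {0..T})"
    unfolding case_prod_unfold
    by (rule has_vector_derivative_mult_right, rule bounded_linear.has_vector_derivative[OF bounded_linear_Re],
        rule has_vector_derivative_sum, rule has_vector_derivative_mult_right, rule quart_derivative) (rule dx)
  have B': "(\<Sum>(a,b,d)\<in>P_high N K. of_real (wt (a,b,d) / Phi a b d) *
        (- \<i> * of_real (Phi a b d) * quart (x t) t (a,b,d) + quart_rem (x t) ?D t (a,b,d)))
     = - (\<Sum>p\<in>P_high N K. \<i> * of_real (wt p) * quart (x t) t p)
       + (\<Sum>(a,b,d)\<in>P_high N K. of_real (wt (a,b,d) / Phi a b d) * quart_rem (x t) ?D t (a,b,d))"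
    unfolding sum_negf[symmetric] sum.distrib[symmetric]
  proof (rule sum.cong[OF refl], clarify)
    fix a b d assume "(a,b,d) \<in> P_high N K"
    then have "Phi a b d \<noteq> 0" using Phi_ge_SS(2)[of a b d] by (auto simp: P_high_def)
    then show "of_real (wt (a,b,d) / Phi a b d) * (- \<i> * of_real (Phi a b d) * quart (x t) t (a,b,d) + quart_rem (x t) ?D t (a,b,d))
      = - (\<i> * of_real (wt (a,b,d)) * quart (x t) t (a,b,d)) + of_real (wt (a,b,d) / Phi a b d) * quart_rem (x t) ?D t (a,b,d)"
      by (simp add: algebra_simps)
  qed
  from has_vector_derivative_add[OF dE dB]
  show ?thesis unfolding menergy_def
  proof (rule has_vector_derivative_eq_rhs)
    have cancel: "2 * p + 2 * q + 2 * (- q + r) = 2 * p + 2 * r" for p q r :: real by simp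
    show "(\<Sum>n\<in>?I. (W s n)\<^sup>2 * Re (cnj (x t n) * ?D n + cnj (?D n) * x t n))
      + 2 * Re (\<Sum>(a,b,d)\<in>P_high N K. of_real (wt (a,b,d) / Phi a b d) *
        (- \<i> * of_real (Phi a b d) * quart (x t) t (a,b,d) + quart_rem (x t) ?D t (a,b,d)))
      = 2 * Re (\<Sum>p\<in>P_low N K. \<i> * of_real (wt p) * quart (x t) t p)
     + 2 * Re (\<Sum>(a,b,d)\<in>P_high N K. of_real (wt (a,b,d) / Phi a b d) * quart_rem (x t) ?D t (a,b,d))"
      unfolding E' B' sum_distrib_left[symmetric] Re_sum[symmetric]
      by (simp only: plus_complex.sel uminus_complex.sel) (rule cancel)
  qed
qed


lemma quart_norm: "cmod (quart x t (a,b,d)) = cmod (x a) * cmod (x b) * cmod (x d) * cmod (x (a+b+d))"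
  by (simp add: quart_def norm_mult)

lemma quart_rem_norm:
  assumes "\<And>n. cmod (y n) \<le> C * g n"
  shows "cmod (quart_rem x y t (a,b,d)) \<le> C * (g a * cmod (x b) * cmod (x d) * cmod (x (a+b+d))
      + cmod (x a) * g b * cmod (x d) * cmod (x (a+b+d)) + cmod (x a) * cmod (x b) * g d * cmod (x (a+b+d))
      + cmod (x a) * cmod (x b) * cmod (x d) * g (a+b+d))"
proof -
  have "cmod (quart_rem x y t (a,b,d)) \<le> cmod (y a) * cmod (x b) * cmod (x d) * cmod (x (a+b+d))
      + cmod (x a) * cmod (y b) * cmod (x d) * cmod (x (a+b+d)) + cmod (x a) * cmod (x b) * cmod (y d) * cmod (x (a+b+d))
      + cmod (x a) * cmod (x b) * cmod (x d) * cmod (y (a+b+d))"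
    unfolding quart_rem_def prod.case
    by (intro norm_triangle_le add_mono) (auto simp: norm_mult)
  also have "\<dots> \<le> (C * g a) * cmod (x b) * cmod (x d) * cmod (x (a+b+d))
      + cmod (x a) * (C * g b) * cmod (x d) * cmod (x (a+b+d)) + cmod (x a) * cmod (x b) * (C * g d) * cmod (x (a+b+d))
      + cmod (x a) * cmod (x b) * cmod (x d) * (C * g (a+b+d))"
    by (intro add_mono mult_right_mono mult_left_mono assms) auto
  finally show ?thesis by (simp add: algebra_simps)
qed

text \<open>\<open>SS < K^2\<close> confines all frequencies to a box independent of
  \<open>N\<close>, so the crude bound uses nothing but the conserved mass.\<close>

lemma low_sum:
  assumes K: "K > 0" and f: "\<And>n. cmod (x n) \<le> R"
  shows "cmod (\<Sum>p\<in>P_low N K. \<i> * of_real (wt p) * quart x t p)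
    \<le> real ((2 * nat \<lceil>K\<rceil> + 1)^3) * (\<bar>c\<bar> * K * (1 + K\<^sup>2) powr s * R^4)"
proof -
  let ?J = "{- \<lceil>K\<rceil>..\<lceil>K\<rceil>}"
  have R: "R \<ge> 0" using order_trans[OF norm_ge_zero f[of 0]] .
  have small: "\<bar>real_of_int m\<bar> \<le> K" if "m\<^sup>2 \<le> SS a b d" "real_of_int (SS a b d) < K\<^sup>2" for m a b d
  proof -
    have "\<bar>real_of_int m\<bar> \<le> sqrt (SS a b d)" by (rule abs_le_sqrt_SS[OF that(1)])
    also have "\<dots> \<le> K" using that(2) K by (intro real_le_lsqrt) auto
    finally show ?thesis .
  qed
  have sub: "P_low N K \<subseteq> ?J \<times> ?J \<times> ?J"
  proof
    fix p assume "p \<in> P_low N K"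
    then obtain a b d where p: "p = (a,b,d)" and l: "real_of_int (SS a b d) < K\<^sup>2" by (auto simp: P_low_def)
    have "\<bar>real_of_int a\<bar> \<le> K" "\<bar>real_of_int b\<bar> \<le> K" "\<bar>real_of_int d\<bar> \<le> K"
      by (rule small[OF _ l]; rule SS_ge_squares)+
    then show "p \<in> ?J \<times> ?J \<times> ?J" unfolding p by (auto simp: abs_le_iff) linarith+
  qed
  have cJ: "card ?J = 2 * nat \<lceil>K\<rceil> + 1"
  proof -
    have "\<lceil>K\<rceil> \<ge> 0" using K by simp
    then show ?thesis by (simp add: nat_add_distrib nat_mult_distrib)
  qed
  have "card (P_low N K) \<le> card (?J \<times> ?J \<times> ?J)" by (rule card_mono[OF _ sub]) simp
  also have "\<dots> = (2 * nat \<lceil>K\<rceil> + 1)^3" unfolding card_cartesian_product cJ by (simp add: power3_eq_cube)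
  finally have card: "card (P_low N K) \<le> (2 * nat \<lceil>K\<rceil> + 1)^3" .
  have "cmod (\<Sum>p\<in>P_low N K. \<i> * of_real (wt p) * quart x t p) \<le> real (card (P_low N K)) * (\<bar>c\<bar> * K * (1 + K\<^sup>2) powr s * R^4)"
  proof (rule sum_norm_bound)
    fix p assume "p \<in> P_low N K"
    then obtain a b d where p: "p = (a,b,d)" and l: "real_of_int (SS a b d) < K\<^sup>2" by (auto simp: P_low_def)
    have n: "\<bar>real_of_int (a+b+d)\<bar> \<le> K" by (rule small[OF _ l]) (rule SS_ge_squares)
    then have "(real_of_int (a+b+d))\<^sup>2 \<le> K\<^sup>2"
      using power_mono[OF n abs_ge_zero, of 2] by (simp del: of_int_add)
    then have w: "(W s (a+b+d))\<^sup>2 \<le> (1 + K\<^sup>2) powr s" unfolding W_sq using s by (intro powr_mono2) auto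
    have q: "cmod (quart x t p) \<le> R^4"
    proof -
      have "cmod (quart x t p) \<le> R * R * R * R" unfolding p quart_norm using R by (intro mult_mono f) auto
      then show ?thesis by (simp add: eval_nat_numeral mult_ac)
    qed
    have "cmod (\<i> * of_real (wt p) * quart x t p) = \<bar>c\<bar> * \<bar>real_of_int (a+b+d)\<bar> * (W s (a+b+d))\<^sup>2 * cmod (quart x t p)"
      by (simp only: p wt_def prod.case norm_mult norm_ii norm_of_real abs_mult) simp
    also have "\<dots> \<le> \<bar>c\<bar> * K * (1 + K\<^sup>2) powr s * R^4"
      using K by (intro mult_mono n w q mult_nonneg_nonneg) auto
    finally show "cmod (\<i> * of_real (wt p) * quart x t p) \<le> \<bar>c\<bar> * K * (1 + K\<^sup>2) powr s * R^4" .
  qed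
  also have "\<dots> \<le> real ((2 * nat \<lceil>K\<rceil> + 1)^3) * (\<bar>c\<bar> * K * (1 + K\<^sup>2) powr s * R^4)"
    using card K R by (intro mult_right_mono mult_nonneg_nonneg) (auto simp only: of_nat_le_iff abs_ge_zero powr_ge_zero zero_le_power less_imp_le)
  finally show ?thesis .
qed

lemma wt_div: "cmod (of_real (wt (a,b,d) / Phi a b d)) = \<bar>c\<bar> * ((W s (a+b+d))\<^sup>2 * \<bar>real_of_int (a+b+d)\<bar> / \<bar>Phi a b d\<bar>)"
  by (simp only: wt_def prod.case norm_of_real abs_mult abs_divide) (simp add: mult_ac)

text \<open>The bound is uniform in \<open>N\<close> and in the data within radius
  \<open>R0\<close>. The modified energy is comparable to the energy at all times, and its
  derivative is at most a constant plus a multiple of itself.\<close>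

lemma a_priori_bound:
  assumes T: "T \<ge> 0" and R0: "R0 \<ge> 0"
  obtains Rb where "\<And>N v0 v t. galsol N T v0 v \<Longrightarrow> hs_b s v0 R0 \<Longrightarrow> t \<in> {0..T} \<Longrightarrow> hs_b s (v t) Rb"
proof -
  obtain A2 where "kernel_bound (\<lambda>a b d. sqrt (SS a b d) / \<bar>PP a b d\<bar>) A2" using kernel_PP .
  moreover have "res_kernel = (\<lambda>a b d. sqrt (SS a b d) / \<bar>PP a b d\<bar>)" by (intro ext) (simp add: res_kernel_def)
  ultimately have A2: "kernel_bound res_kernel A2" by simp
  then have A20: "A2 \<ge> 0" by (simp add: kernel_bound_def)
  obtain C where C: "C \<ge> 0" "\<And>f F. finite F \<Longrightarrow> (\<Sum>n\<in>F. W (2 * s - 1) n * (f n)\<^sup>2) * (\<Sum>n\<in>F. \<bar>f n\<bar>)\<^sup>2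
      \<le> C * (\<Sum>n\<in>F. (f n)\<^sup>2) * (\<Sum>n\<in>F. (W s n * f n)\<^sup>2)" using interpolation[OF s] by blast
  \<comment> \<open>Since K \<le> K^2, the factor 12 makes the correction sum at most a quarter of
    the energy; doubled in \<open>menergy\<close>, it leaves Y between E/2 and 3E/2. Only
    \<open>R0\<close> enters, through the mass.\<close>
  define K where "K = 1 + 12 * \<bar>c\<bar> * 3 powr s * A2 * R0\<^sup>2"
  have K1: "K \<ge> 1" unfolding K_def using A20 by simp
  define C1 where "C1 = 2 * (real ((2 * nat \<lceil>K\<rceil> + 1)^3) * (\<bar>c\<bar> * K * (1 + K\<^sup>2) powr s * R0^4))"
  define C2 where "C2 = 2 * (\<bar>c\<bar> * (\<bar>c\<bar> * (72 * 9 powr (s - 1/2) * A2 * (C * R0\<^sup>2) * R0\<^sup>2)))"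
  have C10: "C1 \<ge> 0" unfolding C1_def using K1 R0 by (intro mult_nonneg_nonneg) auto
  have C20: "C2 \<ge> 0" unfolding C2_def using A20 C(1) by (intro mult_nonneg_nonneg) auto
  \<comment> \<open>The 2 converts E into Y; the 1 satisfies the requirement b \<ge> 1 of
    \<open>exp_gronwall\<close>.\<close>
  define b where "b = 1 + 2 * C2"
  define Rb where "Rb = sqrt (2 * (exp (b * T) * (3/2 * R0\<^sup>2 + C1)))"
  have "hs_b s (v t) Rb" if g: "galsol N T v0 v" and v0: "hs_b s v0 R0" and t: "t \<in> {0..T}" for N v0 v t
  proof -
    let ?I = "{- int N..int N}"
    define x where "x = inter v"
    define f where "f t n = cmod (x t n)" for t n
    define Y where "Y t = menergy N K (x t) t" for t
    define E where "E t = energy N (x t)" for t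
    have xv: "f t n = cmod (v t n)" for t n by (simp add: f_def x_def)
    have sup: "f t n = 0" if "t \<in> {0..T}" "\<bar>n\<bar> > int N" for t n
      using g that by (auto simp: galsol_def xv)
    have f0: "f t n \<ge> 0" for t n by (simp add: f_def)
    have fm2: "(\<Sum>n\<in>?I. (f t n)\<^sup>2) \<le> R0\<^sup>2" if "t \<in> {0..T}" for t
    proof -
      have "(\<Sum>n\<in>?I. (f t n)\<^sup>2) = (\<Sum>n\<in>?I. (cmod (v0 n))\<^sup>2)" using g that by (auto simp: galsol_def xv)
      also have "\<dots> \<le> R0\<^sup>2" by (rule sq_sum_le[OF v0]) simp
      finally show ?thesis .
    qed
    have fm: "l2b (f t) R0" if "t \<in> {0..T}" for t
    proof (rule l2b_weaken)
      show "l2b (f t) (L2_set (f t) ?I)" by (rule l2b_L2_set) (use sup[OF that] in auto)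
      show "L2_set (f t) ?I \<le> R0" unfolding L2_set_def using fm2[OF that] R0 by (intro real_le_lsqrt) (auto intro: sum_nonneg)
    qed
    have E_eq: "E t = (\<Sum>n\<in>?I. (W s n * f t n)\<^sup>2)" for t by (simp add: E_def energy_eq f_def)
    have E0: "E t \<ge> 0" for t unfolding E_eq by (intro sum_nonneg) auto
    have fe: "l2b (\<lambda>n. W s n * f t n) (sqrt (E t))" if "t \<in> {0..T}" for t
      unfolding E_eq L2_set_def[symmetric] by (rule l2b_L2_set) (use sup[OF that] in auto)
    have Bsmall: "cmod (\<Sum>(a,b,d)\<in>P_high N K. of_real (wt (a,b,d) / Phi a b d) * quart (x t) t (a,b,d)) \<le> E t / 4"
      if t: "t \<in> {0..T}" for t
    proof -
      have "cmod (\<Sum>(a,b,d)\<in>P_high N K. of_real (wt (a,b,d) / Phi a b d) * quart (x t) t (a,b,d))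
        \<le> (\<Sum>(a,b,d)\<in>P_high N K. \<bar>c\<bar> * ((W s (a+b+d))\<^sup>2 * \<bar>real_of_int (a+b+d)\<bar> / \<bar>Phi a b d\<bar> * (f t a * f t b * f t d * f t (a+b+d))))"
        by (rule sum_norm_le, clarify) (simp only: norm_mult wt_div quart_norm f_def mult_ac order_refl)
      also have "\<dots> = \<bar>c\<bar> * (\<Sum>(a,b,d)\<in>P_high N K. (W s (a+b+d))\<^sup>2 * \<bar>real_of_int (a+b+d)\<bar> / \<bar>Phi a b d\<bar> * (f t a * f t b * f t d * f t (a+b+d)))"
        unfolding sum_distrib_left by (rule sum.cong) auto
      also have "\<dots> \<le> \<bar>c\<bar> * (3 powr s / K\<^sup>2 * (3 * A2) * (sqrt (E t))\<^sup>2 * R0\<^sup>2)"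
        by (intro mult_left_mono boundary_sum[OF A2 finite_P_all(3)] f0 fm[OF t] fe[OF t]) (use K1 in \<open>auto simp: P_high_def\<close>)
      also have "\<dots> = (3 * \<bar>c\<bar> * 3 powr s * A2 * R0\<^sup>2) / K\<^sup>2 * E t" using E0[of t] by simp
      also have "\<dots> \<le> 1/4 * E t"
      proof (rule mult_right_mono[OF _ E0])
        have "12 * \<bar>c\<bar> * 3 powr s * A2 * R0\<^sup>2 \<le> K" by (simp add: K_def)
        also have "\<dots> \<le> K\<^sup>2" using K1 by (simp add: power2_eq_square)
        finally have "3 * \<bar>c\<bar> * 3 powr s * A2 * R0\<^sup>2 \<le> 1/4 * K\<^sup>2" by simp
        moreover have "K\<^sup>2 > 0" using K1 by simp
        ultimately show "(3 * \<bar>c\<bar> * 3 powr s * A2 * R0\<^sup>2) / K\<^sup>2 \<le> 1/4" by (simp only: divide_le_eq if_True)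
      qed
      finally show ?thesis by simp
    qed
    have YE: "E t / 2 \<le> Y t" "Y t \<le> 3/2 * E t" if t: "t \<in> {0..T}" for t
      using Bsmall[OF t] abs_Re_le_cmod[of "\<Sum>(a,b,d)\<in>P_high N K. of_real (wt (a,b,d) / Phi a b d) * quart (x t) t (a,b,d)"]
      unfolding Y_def menergy_def E_def[symmetric] by linarith+
    define Y' where "Y' t = 2 * Re (\<Sum>p\<in>P_low N K. \<i> * of_real (wt p) * quart (x t) t p)
     + 2 * Re (\<Sum>(a,b,d)\<in>P_high N K. of_real (wt (a,b,d) / Phi a b d) * quart_rem (x t) (gal_rhs N (x t) t) t (a,b,d))" for t
    have dY: "(Y has_vector_derivative Y' t) (at t within {0..T})" if "t \<in> {0..T}" for t
      unfolding Y_def[abs_def] Y'_def x_def by (rule menergy_derivative[OF g that])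
    have Y'le: "Y' t \<le> C1 + b * Y t" if t: "t \<in> {0..T}" for t
    proof -
      let ?Q = "qbox N (f t) (f t) (f t)" and ?l = "\<Sum>n\<in>?I. f t n"
      define D where "D = L2_set (\<lambda>n. W (s - 1/2) n * f t n) ?I"
      have D: "l2b (\<lambda>n. W (s - 1/2) n * f t n) D"
        unfolding D_def by (rule l2b_L2_set) (use sup[OF t] in auto)
      have "D\<^sup>2 = (\<Sum>n\<in>?I. W (2 * s - 1) n * (f t n)\<^sup>2)"
        unfolding D_def L2_set_def
        by (simp add: sum_nonneg power_mult_distrib power2_eq_square[of "W (s - 1/2) _"] W_mult)
      moreover have "?l = (\<Sum>n\<in>?I. \<bar>f t n\<bar>)" by (simp add: f0)
      ultimately have "D\<^sup>2 * ?l\<^sup>2 \<le> C * (\<Sum>n\<in>?I. (f t n)\<^sup>2) * E t" using C(2)[of ?I "f t"] by (simp add: E_eq)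
      also have "\<dots> \<le> C * R0\<^sup>2 * E t" by (intro mult_right_mono mult_left_mono fm2[OF t] C(1) E0)
      finally have Dl: "D\<^sup>2 * ?l\<^sup>2 \<le> C * R0\<^sup>2 * E t" .
      have lo: "cmod (\<Sum>p\<in>P_low N K. \<i> * of_real (wt p) * quart (x t) t p) \<le> C1 / 2"
      proof -
        have "cmod (x t n) \<le> R0" for n using l2b_abs_le[OF fm[OF t], of n] by (simp add: f_def)
        then show ?thesis using low_sum[where K = K and x = "x t" and R = R0 and N = N and t = t] K1 by (simp add: C1_def)
      qed
      let ?G = "\<lambda>a b d. (W s (a+b+d))\<^sup>2 * \<bar>real_of_int (a+b+d)\<bar> / \<bar>Phi a b d\<bar> *
          (\<bar>real_of_int a\<bar> * ?Q a * f t b * f t d * f t (a+b+d) + f t a * (\<bar>real_of_int b\<bar> * ?Q b) * f t d * f t (a+b+d)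
          + f t a * f t b * (\<bar>real_of_int d\<bar> * ?Q d) * f t (a+b+d) + f t a * f t b * f t d * (\<bar>real_of_int (a+b+d)\<bar> * ?Q (a+b+d)))"
      have Dgn: "cmod (gal_rhs N (x t) t n) \<le> \<bar>c\<bar> * (\<bar>real_of_int n\<bar> * ?Q n)" for n
      proof -
        have "f t = (\<lambda>n. cmod (x t n))" by (simp add: f_def fun_eq_iff)
        then show ?thesis using gal_rhs_norm[of N "x t" t n] by simp
      qed
      have "cmod (\<Sum>(a,b,d)\<in>P_high N K. of_real (wt (a,b,d) / Phi a b d) * quart_rem (x t) (gal_rhs N (x t) t) t (a,b,d))
        \<le> (\<Sum>(a,b,d)\<in>P_high N K. \<bar>c\<bar> * (\<bar>c\<bar> * ?G a b d))"
      proof (rule sum_norm_le, clarify)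
        fix a b d
        from mult_left_mono[OF quart_rem_norm[where y = "gal_rhs N (x t) t" and C = "\<bar>c\<bar>" and g = "\<lambda>n. \<bar>real_of_int n\<bar> * ?Q n"
            and x = "x t" and t = t and a = a and b = b and d = d, OF Dgn] norm_ge_zero[of "complex_of_real (wt (a,b,d) / Phi a b d)"]]
        show "cmod (of_real (wt (a,b,d) / Phi a b d) * quart_rem (x t) (gal_rhs N (x t) t) t (a,b,d)) \<le> \<bar>c\<bar> * (\<bar>c\<bar> * ?G a b d)"
          unfolding norm_mult wt_div f_def[symmetric] by (simp only: mult_ac)
      qed
      also have "\<dots> = \<bar>c\<bar> * (\<bar>c\<bar> * (\<Sum>(a,b,d)\<in>P_high N K. ?G a b d))"
        unfolding sum_distrib_left by (rule sum.cong) auto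
      also have "\<dots> \<le> \<bar>c\<bar> * (\<bar>c\<bar> * (72 * 9 powr (s - 1/2) * A2 * D\<^sup>2 * ?l\<^sup>2 * R0\<^sup>2))"
        by (intro mult_left_mono remainder_sum[OF A2 finite_P_all(3) _ f0 sup[OF t] fm[OF t] D]) (auto simp: P_high_def)
      also have "\<dots> = \<bar>c\<bar> * (\<bar>c\<bar> * (72 * 9 powr (s - 1/2) * A2 * (D\<^sup>2 * ?l\<^sup>2) * R0\<^sup>2))" by (simp only: mult.assoc)
      also have "\<dots> \<le> \<bar>c\<bar> * (\<bar>c\<bar> * (72 * 9 powr (s - 1/2) * A2 * (C * R0\<^sup>2 * E t) * R0\<^sup>2))"
        using A20 by (intro mult_left_mono mult_right_mono Dl mult_nonneg_nonneg) auto
      also have "\<dots> = C2 / 2 * E t" by (simp add: C2_def)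
      finally have hi: "cmod (\<Sum>(a,b,d)\<in>P_high N K. of_real (wt (a,b,d) / Phi a b d) * quart_rem (x t) (gal_rhs N (x t) t) t (a,b,d)) \<le> C2 / 2 * E t" .
      have "Y' t \<le> 2 * (C1 / 2) + 2 * (C2 / 2 * E t)"
        unfolding Y'_def using order_trans[OF complex_Re_le_cmod lo] order_trans[OF complex_Re_le_cmod hi]
        by (intro add_mono mult_left_mono) auto
      also have "\<dots> = C1 + C2 * E t" by simp
      also have "\<dots> \<le> C1 + C2 * (2 * Y t)" using YE[OF t] C20 by (intro add_left_mono mult_left_mono) auto
      also have "\<dots> \<le> C1 + b * Y t" using YE[OF t] E0[of t] by (simp add: b_def algebra_simps)
      finally show ?thesis .
    qed
    have Y0: "0 \<le> Y t" if "t \<in> {0..T}" for t using YE(1)[OF that] E0[of t] by simp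
    have "Y t \<le> exp (b * T) * (Y 0 + C1)"
      by (rule exp_gronwall[OF dY Y'le Y0]) (use C20 C10 t in \<open>auto simp: b_def\<close>)
    also have "\<dots> \<le> exp (b * T) * (3/2 * R0\<^sup>2 + C1)"
    proof (intro mult_left_mono add_right_mono)
      have z: "0 \<in> {0..T}" using T by simp
      have "E 0 \<le> R0\<^sup>2"
      proof -
        have "E 0 = (\<Sum>n\<in>?I. (W s n * cmod (v0 n))\<^sup>2)"
          unfolding E_eq by (rule sum.cong) (use g in \<open>auto simp: galsol_def xv\<close>)
        also have "\<dots> \<le> R0\<^sup>2" by (rule l2b_sum_sq[OF v0]) simp
        finally show ?thesis .
      qed
      then show "Y 0 \<le> 3/2 * R0\<^sup>2" using YE(2)[OF z] by simp
    qed simp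
    finally have "E t \<le> 2 * (exp (b * T) * (3/2 * R0\<^sup>2 + C1))" using YE(1)[OF t] by simp
    then have "sqrt (E t) \<le> Rb" unfolding Rb_def by (rule real_sqrt_le_mono)
    from l2b_weaken[OF fe[OF t] this] show ?thesis by (simp add: xv)
  qed
  then show ?thesis by (rule that)
qed

section \<open>Global existence and the main theorem\<close>

lemma norm_4_le: "cmod (- a + b + d - e) \<le> cmod a + cmod b + cmod d + cmod e"
  using norm_triangle_ineq4[of "- a + b + d" e] norm_triangle_ineq[of "- a + b" d] norm_triangle_ineq[of "- a" b]
  by simp

text \<open>Coefficientwise convergence suffices because the tails are uniformly small: all sums are
  compared with those over one fixed box, where finitely many coefficients occur.\<close>

lemma cub_limit:
  assumes b: "\<And>i. hs_b s (y i) R" and l: "\<And>n. (\<lambda>i. y i n) \<longlonglongrightarrow> z n" and M: "\<And>a b d. cmod (M a b d) \<le> 1"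
    and N: "filterlim N at_top sequentially"
  shows "(\<lambda>i. sum (cub M (y i) n) (box (N i))) \<longlonglongrightarrow> infsum (cub M z n) UNIV"
proof (rule LIMSEQ_I)
  fix e :: real assume e: "e > 0"
  let ?S = "\<lambda>x L. sum (cub M x n) (box L)" and ?I = "\<lambda>x. infsum (cub M x n) UNIV"
  let ?r = "\<lambda>L. tail_rate L * (l1_const * R)^3"
  have zb: "hs_b s z R" by (rule hs_b_lim[OF l b])
  have tail: "cmod (?I x - ?S x L) \<le> ?r L" if "hs_b s x R" for x L
    using cub_infsum_tail[where M = M and Z = UNIV and L = L and n = n, OF that M] by simp
  have "?r \<longlonglongrightarrow> 0 * (l1_const * R)^3" by (intro tendsto_intros tail_rate_lim)
  then have "\<forall>\<^sub>F L in sequentially. ?r L < e / 4" using e by (auto dest: order_tendstoD(2)[of _ _ _ "e/4"])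
  then obtain L where L: "\<And>L'. L' \<ge> L \<Longrightarrow> ?r L' < e / 4" by (auto simp: eventually_sequentially)
  have "(\<lambda>i. ?S (y i) L) \<longlonglongrightarrow> ?S z L"
    by (intro tendsto_sum) (auto simp: cub_def intro!: tendsto_intros l)
  then have "\<forall>\<^sub>F i in sequentially. dist (?S (y i) L) (?S z L) < e / 4" using e by (intro tendstoD) auto
  moreover have "\<forall>\<^sub>F i in sequentially. N i \<ge> L" using N by (simp add: filterlim_at_top)
  ultimately have "\<forall>\<^sub>F i in sequentially. norm (?S (y i) (N i) - ?I z) < e"
  proof eventually_elim
    case (elim i)
    have 1: "cmod (?I (y i) - ?S (y i) (N i)) < e / 4" using tail[OF b, of i "N i"] L[OF elim(2)] by simp
    have 2: "cmod (?I (y i) - ?S (y i) L) < e / 4" using tail[OF b, of i L] L[of L] by simp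
    have 3: "cmod (?I z - ?S z L) < e / 4" using tail[OF zb, of L] L[of L] by simp
    have 4: "cmod (?S (y i) L - ?S z L) < e / 4" using elim(1) by (simp add: dist_norm)
    have "?S (y i) (N i) - ?I z = - (?I (y i) - ?S (y i) (N i)) + (?I (y i) - ?S (y i) L) + (?S (y i) L - ?S z L) - (?I z - ?S z L)"
      by simp
    then have "cmod (?S (y i) (N i) - ?I z) \<le> cmod (?I (y i) - ?S (y i) (N i)) + cmod (?I (y i) - ?S (y i) L) + cmod (?S (y i) L - ?S z L) + cmod (?I z - ?S z L)"
      using norm_4_le by (simp only:)
    then show ?case using 1 2 3 4 by linarith
  qed
  then show "\<exists>no. \<forall>i\<ge>no. norm (?S (y i) (N i) - ?I z) < e" by (simp add: eventually_sequentially)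
qed

lemma rational_near:
  assumes "T > 0" "t \<in> {0..T}" "\<delta> > 0"
  obtains r :: real where "r \<in> \<rat>" "r \<in> {0..T}" "\<bar>t - r\<bar> < \<delta>"
proof -
  have "max 0 (t - \<delta>) < min T (t + \<delta>)" using assms by auto
  from Rats_dense_in_real[OF this] obtain r where "r \<in> \<rat>" "max 0 (t - \<delta>) < r" "r < min T (t + \<delta>)" by blast
  then show ?thesis using that[of r] by auto
qed

text \<open>An Arzela-Ascoli argument coefficient by coefficient: in the interaction variable each
  coefficient is Lipschitz in time with a constant that depends on \<open>n\<close> but not on
  \<open>N\<close>. Duhamel's formula passes to the limit by dominated convergence.\<close>

lemma global_existence:
  assumes T: "T > 0" and re0: "real_valued v0"
    and bound: "\<And>N v t. galsol N T v0 v \<Longrightarrow> t \<in> {0..T} \<Longrightarrow> hs_b s (v t) R"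
  obtains v where "wsol T R v0 v"
proof -
  have T0: "T \<ge> 0" using T by simp
  have "\<forall>N. \<exists>v. galsol N T v0 v" using galerkin_exists[OF T0 re0] by metis
  then obtain V where V: "\<And>N. galsol N T v0 (V N)" by metis
  define q where "q N = inter (V N)" for N
  have qb: "hs_b s (q N t) R" if "t \<in> {0..T}" for N t
    using bound[OF V that] by (simp add: q_def)
  have R: "R \<ge> 0" using l2b_nonneg[OF qb[of 0 0]] T by simp
  have dq: "((\<lambda>t. q N t n) has_vector_derivative gal_rhs N (q N t) t n) (at t within {0..T})" if "t \<in> {0..T}" for N t n
    unfolding q_def by (rule inter_derivative[OF V that])
  define Mn where "Mn n = \<bar>real_of_int n\<bar> * \<bar>c\<bar> * (l1_const * R)^3" for n
  have Mn0: "Mn n \<ge> 0" for n unfolding Mn_def using R l1_const(1) by (intro mult_nonneg_nonneg) auto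
  have cb: "cmod (sum (cub (osc t) (q N t) n) (box N)) \<le> (l1_const * R)^3" if "t \<in> {0..T}" for N t n
    by (rule order_trans[OF norm_sum], rule cub_sum_le[OF qb[OF that]]) auto
  have Dgb: "cmod (gal_rhs N (q N t) t n) \<le> Mn n" if "t \<in> {0..T}" for N t n
    unfolding gal_rhs_def Mn_def using cb[OF that, of N n] R l1_const(1)
    by (auto simp: norm_mult mult.assoc intro!: mult_left_mono mult_nonneg_nonneg)
  have lip: "cmod (q N t' n - q N t n) \<le> \<bar>t' - t\<bar> * Mn n" if t: "t \<in> {0..T}" "t' \<in> {0..T}" for N t t' n
  proof -
    have main: "cmod (q N b n - q N a n) \<le> (b - a) * Mn n" if ab: "a \<in> {0..T}" "b \<in> {0..T}" "a \<le> b" for a b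
    proof -
      have "L2_set (\<lambda>n. 1 * cmod (q N b n - q N a n)) {n} \<le> (b - a) * Mn n"
      proof (rule l2_mean_value[where f' = "\<lambda>t. gal_rhs N (q N t) t"])
        fix m t assume t: "t \<in> {a..b}"
        then have tT: "t \<in> {0..T}" using ab by auto
        show "((\<lambda>t. q N t m) has_vector_derivative gal_rhs N (q N t) t m) (at t within {a..b})"
          by (rule has_vector_derivative_within_subset[OF dq[OF tT]]) (use ab in auto)
        show "L2_set (\<lambda>n. 1 * cmod (gal_rhs N (q N t) t n)) {n} \<le> Mn n"
          using Dgb[OF tT] by (simp add: L2_set_def)
      qed (use ab in auto)
      then show ?thesis by (simp add: L2_set_def)
    qed
    show ?thesis
    proof (cases "t \<le> t'")
      case True then show ?thesis using main[OF t(1,2)] by simp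
    next
      case False then show ?thesis using main[OF t(2,1)] by (simp add: norm_minus_commute)
    qed
  qed
  \<comment> \<open>A diagonal subsequence converges for all frequencies at rational times; the
    Lipschitz bounds extend this to every time.\<close>
  have "countable ((UNIV :: int set) \<times> ({0..T} \<inter> \<rat>))"
    by (intro countable_SIGMA countable_Int2 countable_rat) auto
  moreover have "cmod ((\<lambda>N (n,r). q N r n) N x) \<le> R" if "x \<in> (UNIV :: int set) \<times> ({0..T} \<inter> \<rat>)" for N x
    using that cmod_le[OF qb] by auto
  ultimately obtain k where k: "strict_mono (k :: nat \<Rightarrow> nat)"
    and kr: "\<And>x. x \<in> (UNIV :: int set) \<times> ({0..T} \<inter> \<rat>) \<Longrightarrow> \<exists>l. (\<lambda>i. (\<lambda>N (n,r). q N r n) (k i) x) \<longlonglongrightarrow> l"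
    using function_convergent_subsequence[of "(UNIV :: int set) \<times> ({0..T} \<inter> \<rat>)" "\<lambda>N (n,r). q N r n" R] by metis
  have conv: "convergent (\<lambda>i. q (k i) t n)" if t: "t \<in> {0..T}" for t n
  proof -
    have "Cauchy (\<lambda>i. q (k i) t n)"
    proof (rule metric_CauchyI)
      fix e :: real assume e: "e > 0"
      define \<delta> where "\<delta> = e / (3 * (Mn n + 1))"
      have \<delta>: "\<delta> > 0" unfolding \<delta>_def using e Mn0[of n] by (intro divide_pos_pos) auto
      obtain r where r: "r \<in> \<rat>" "r \<in> {0..T}" "\<bar>t - r\<bar> < \<delta>" using rational_near[OF T t \<delta>] .
      have close: "cmod (q N t n - q N r n) < e / 3" for N
      proof -
        have "cmod (q N t n - q N r n) \<le> \<bar>t - r\<bar> * Mn n" by (rule lip[OF r(2) t])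
        also have "\<dots> \<le> \<delta> * Mn n" using r Mn0[of n] by (intro mult_right_mono) auto
        also have "\<dots> < \<delta> * (Mn n + 1)" using \<delta> by simp
        also have "\<dots> = e / 3" unfolding \<delta>_def using Mn0[of n] by (simp add: field_simps)
        finally show ?thesis .
      qed
      have "Cauchy (\<lambda>i. q (k i) r n)" using kr[of "(n,r)"] r by (auto intro: LIMSEQ_imp_Cauchy)
      from metric_CauchyD[OF this, of "e/3"] e obtain M where M: "\<And>i j. i \<ge> M \<Longrightarrow> j \<ge> M \<Longrightarrow> dist (q (k i) r n) (q (k j) r n) < e/3"
        by auto
      have "dist (q (k i) t n) (q (k j) t n) < e" if "i \<ge> M" "j \<ge> M" for i j
      proof -
        have "q (k i) t n - q (k j) t n = (q (k i) t n - q (k i) r n) + (q (k i) r n - q (k j) r n) - (q (k j) t n - q (k j) r n)" by simp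
        then have "cmod (q (k i) t n - q (k j) t n) \<le> cmod (q (k i) t n - q (k i) r n) + cmod (q (k i) r n - q (k j) r n) + cmod (q (k j) t n - q (k j) r n)"
          using norm_4_le[of 0 "q (k i) t n - q (k i) r n" "q (k i) r n - q (k j) r n" "q (k j) t n - q (k j) r n"]
          by (simp del: diff_add_cancel)
        then show ?thesis using close[of "k i"] close[of "k j"] M[OF that] unfolding dist_norm by linarith
      qed
      then show "\<exists>M. \<forall>i\<ge>M. \<forall>j\<ge>M. dist (q (k i) t n) (q (k j) t n) < e" by blast
    qed
    then show ?thesis by (simp add: Cauchy_convergent_iff)
  qed
  define Q where "Q t n = lim (\<lambda>i. q (k i) t n)" for t n
  have Q: "(\<lambda>i. q (k i) t n) \<longlonglongrightarrow> Q t n" if "t \<in> {0..T}" for t n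
    unfolding Q_def using conv[OF that] by (simp add: convergent_LIMSEQ_iff)
  have Qb: "hs_b s (Q t) R" if "t \<in> {0..T}" for t
    by (rule hs_b_lim[OF Q[OF that] qb[OF that]])
  define v where "v t n = cis (t * phase \<beta> \<gamma> n) * Q t n" for t n
  have iv: "inter v t n = Q t n" for t n
    by (simp add: inter_def v_def cis_mult mult.assoc[symmetric])
  have vb: "hs_b s (v t) R" if "t \<in> {0..T}" for t
    using Qb[OF that] by (rule hs_b_mono) (simp add: v_def norm_mult)
  have rev: "real_valued (v t)" if t: "t \<in> {0..T}" for t
    unfolding real_valued_def
  proof
    fix n
    have "q (k i) t (- n) = cnj (q (k i) t n)" for i
      unfolding q_def by (rule inter_real) (use V t in \<open>auto simp: galsol_def\<close>)
    then have "(\<lambda>i. q (k i) t (- n)) \<longlonglongrightarrow> cnj (Q t n)" using tendsto_cnj[OF Q[OF t, of n]] by simp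
    then have "Q t (- n) = cnj (Q t n)" using Q[OF t, of "- n"] LIMSEQ_unique by blast
    moreover have "phase \<beta> \<gamma> (- n) = - phase \<beta> \<gamma> n" by (simp add: phase_def)
    ultimately show "v t (- n) = cnj (v t n)" by (simp add: v_def cis_cnj)
  qed
  have kN: "filterlim k at_top sequentially" by (rule filterlim_subseq[OF k])
  define f where "f n i \<tau> = \<i> * of_int n * sum (cub (osc \<tau>) (q (k i) \<tau>) n) (box (k i))" for n i \<tau>
  define h where "h n \<tau> = \<i> * of_int n * infsum (cub (osc \<tau>) (Q \<tau>) n) UNIV" for n \<tau>
  have duh: "h n integrable_on {0..t} \<and> Q t n = v0 n + of_real c * integral {0..t} (h n)" if t: "t \<in> {0..T}" for t n
  proof -
    have sub: "\<tau> \<in> {0..T}" if "\<tau> \<in> {0..t}" for \<tau> using that t by auto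
    have cont: "continuous_on {0..t} (f n i)" for i
    proof -
      have cq: "continuous_on {0..t} (\<lambda>\<tau>. q (k i) \<tau> m)" for m
      proof -
        have "continuous_on {0..T} (\<lambda>\<tau>. q (k i) \<tau> m)"
          unfolding continuous_on_eq_continuous_within using dq has_vector_derivative_continuous by blast
        then show ?thesis by (rule continuous_on_subset) (use t in auto)
      qed
      show ?thesis unfolding f_def cub_def osc_def case_prod_unfold by (intro continuous_intros cq)
    qed
    have dc: "h n integrable_on {0..t}" "(\<lambda>i. integral {0..t} (f n i)) \<longlonglongrightarrow> integral {0..t} (h n)"
    proof -
      have 1: "f n i integrable_on {0..t}" for i by (rule integrable_continuous_real[OF cont])
      have 2: "(\<lambda>\<tau>. \<bar>real_of_int n\<bar> * (l1_const * R)^3) integrable_on {0..t}" by (rule integrable_const_ivl)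
      have 3: "norm (f n i \<tau>) \<le> \<bar>real_of_int n\<bar> * (l1_const * R)^3" if "\<tau> \<in> {0..t}" for i \<tau>
        using cb[OF sub[OF that], of "k i" n] by (simp add: f_def norm_mult mult_left_mono)
      have 4: "(\<lambda>i. f n i \<tau>) \<longlonglongrightarrow> h n \<tau>" if "\<tau> \<in> {0..t}" for \<tau>
        unfolding f_def h_def
        by (intro tendsto_mult_left cub_limit[OF qb Q _ kN]) (use sub[OF that] in auto)
      show "h n integrable_on {0..t}" by (rule dominated_convergence(1)[OF 1 2 3 4])
      show "(\<lambda>i. integral {0..t} (f n i)) \<longlonglongrightarrow> integral {0..t} (h n)" by (rule dominated_convergence(2)[OF 1 2 3 4])
    qed
    have ev: "q (k i) t n = v0 n + of_real c * integral {0..t} (f n i)" if i: "\<bar>n\<bar> \<le> int (k i)" for i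
    proof -
      have "((\<lambda>\<tau>. gal_rhs (k i) (q (k i) \<tau>) \<tau> n) has_integral (q (k i) t n - q (k i) 0 n)) {0..t}"
      proof (rule fundamental_theorem_of_calculus)
        show "0 \<le> t" using t by simp
        fix \<tau> assume "\<tau> \<in> {0..t}"
        then show "((\<lambda>\<tau>. q (k i) \<tau> n) has_vector_derivative gal_rhs (k i) (q (k i) \<tau>) \<tau> n) (at \<tau> within {0..t})"
          by (intro has_vector_derivative_within_subset[OF dq[OF sub]]) (use t in auto)
      qed
      moreover have "gal_rhs (k i) (q (k i) \<tau>) \<tau> n = of_real c * f n i \<tau>" for \<tau> using i by (simp add: gal_rhs_def f_def)
      moreover have "q (k i) 0 n = v0 n" using V[of "k i"] i by (simp add: galsol_def q_def inter_def)
      ultimately have "((\<lambda>\<tau>. of_real c * f n i \<tau>) has_integral (q (k i) t n - v0 n)) {0..t}" by simp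
      moreover have "((\<lambda>\<tau>. of_real c * f n i \<tau>) has_integral (of_real c * integral {0..t} (f n i))) {0..t}"
        by (intro has_integral_mult_right integrable_integral integrable_continuous_real cont)
      ultimately have "q (k i) t n - v0 n = of_real c * integral {0..t} (f n i)" by (rule has_integral_unique)
      then show ?thesis by (simp add: algebra_simps)
    qed
    have "\<forall>\<^sub>F i in sequentially. nat \<bar>n\<bar> \<le> k i" using kN by (simp add: filterlim_at_top)
    then have "\<forall>\<^sub>F i in sequentially. v0 n + of_real c * integral {0..t} (f n i) = q (k i) t n"
      by eventually_elim (use ev in force)
    moreover have "(\<lambda>i. v0 n + of_real c * integral {0..t} (f n i)) \<longlonglongrightarrow> v0 n + of_real c * integral {0..t} (h n)"
      by (intro tendsto_intros dc(2))
    ultimately have "(\<lambda>i. q (k i) t n) \<longlonglongrightarrow> v0 n + of_real c * integral {0..t} (h n)"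
      by (rule Lim_transform_eventually[rotated])
    then have "Q t n = v0 n + of_real c * integral {0..t} (h n)" using Q[OF t, of n] LIMSEQ_unique by blast
    then show ?thesis using dc(1) by simp
  qed
  have "duhamel \<beta> \<gamma> (12 * pi\<^sup>2 * c) T v0 v"
    unfolding duhamel_def
  proof (intro ballI allI)
    fix t n assume t: "t \<in> {0..T}"
    let ?p = "phase \<beta> \<gamma> n"
    \<comment> \<open>The linear flow is put back, and 1/(4 pi^2) is the normalisation of the double
      convolution in \<open>fcube\<close>.\<close>
    let ?C = "cis (t * ?p) * of_real (1 / (4 * pi\<^sup>2))"
    have ex: "exp (\<i> * complex_of_real x) = cis x" for x by (simp add: cis_conv_exp)
    have "((\<lambda>\<tau>. ?C * h n \<tau>) has_integral (?C * integral {0..t} (h n))) {0..t}"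
      by (intro has_integral_mult_right integrable_integral) (use duh[OF t] in auto)
    then have I: "((\<lambda>\<tau>. exp (\<i> * complex_of_real ((t - \<tau>) * ?p)) * (\<i> * of_int n) * fcube (v \<tau>) n) has_integral (?C * integral {0..t} (h n))) {0..t}"
    proof (rule has_integral_eq[rotated])
      fix \<tau> assume "\<tau> \<in> {0..t}"
      then have \<tau>: "\<tau> \<in> {0..T}" using t by auto
      have Qi: "Q \<tau> = inter v \<tau>" by (simp add: iv fun_eq_iff)
      have "cub (osc \<tau>) (Q \<tau>) n = (\<lambda>p. cis (- (\<tau> * ?p)) * cub1 (v \<tau>) n p)"
        unfolding Qi by (rule ext) (rule cub_inter)
      then have "h n \<tau> = \<i> * of_int n * (cis (- (\<tau> * ?p)) * infsum (cub1 (v \<tau>) n) UNIV)"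
        by (simp add: h_def infsum_cmult_right')
      moreover have "cis (t * ?p) * cis (- (\<tau> * ?p)) = cis ((t - \<tau>) * ?p)" by (simp add: cis_mult algebra_simps)
      moreover have "?C * (\<i> * of_int n * (cis (- (\<tau> * ?p)) * X))
        = (cis (t * ?p) * cis (- (\<tau> * ?p))) * (\<i> * of_int n) * (of_real (1 / (4 * pi\<^sup>2)) * X)" for X
        by (simp only: mult_ac)
      ultimately have "?C * h n \<tau> = cis ((t - \<tau>) * ?p) * (\<i> * of_int n) * (of_real (1 / (4 * pi\<^sup>2)) * infsum (cub1 (v \<tau>) n) UNIV)"
        by (simp only:)
      then show "?C * h n \<tau> = exp (\<i> * complex_of_real ((t - \<tau>) * ?p)) * (\<i> * of_int n) * fcube (v \<tau>) n"
        unfolding ex fcube_eq_infsum[OF vb[OF \<tau>]] .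
    qed
    have "v t n = exp (\<i> * complex_of_real (t * ?p)) * v0 n + complex_of_real (12 * pi\<^sup>2 * c / 3) * (?C * integral {0..t} (h n))"
    proof -
      have "complex_of_real (12 * pi\<^sup>2 * c / 3) * of_real (1 / (4 * pi\<^sup>2)) = of_real c"
        unfolding of_real_mult[symmetric] by simp
      moreover have "complex_of_real (12 * pi\<^sup>2 * c / 3) * (?C * integral {0..t} (h n))
        = cis (t * ?p) * ((complex_of_real (12 * pi\<^sup>2 * c / 3) * of_real (1 / (4 * pi\<^sup>2))) * integral {0..t} (h n))"
        by (simp only: mult_ac)
      ultimately have "complex_of_real (12 * pi\<^sup>2 * c / 3) * (?C * integral {0..t} (h n)) = cis (t * ?p) * (of_real c * integral {0..t} (h n))"
        by (simp only:)
      moreover have "Q t n = v0 n + of_real c * integral {0..t} (h n)" using duh[OF t] by simp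
      ultimately show ?thesis unfolding ex v_def by (simp only: distrib_left)
    qed
    with I show "\<exists>I. ((\<lambda>\<tau>. exp (\<i> * complex_of_real ((t - \<tau>) * ?p)) * (\<i> * of_int n) * fcube (v \<tau>) n) has_integral I) {0..t} \<and>
      v t n = exp (\<i> * complex_of_real (t * ?p)) * v0 n + complex_of_real (12 * pi\<^sup>2 * c / 3) * I" by blast
  qed
  then have "wsol T R v0 v" using vb rev by (simp add: wsol_def)
  then show ?thesis by (rule that)
qed

text \<open>One \<open>R\<close> for a whole ball of data: \<open>wsol_dependence\<close> needs a
  common bound for the reference solution and all its neighbours.\<close>

lemma bounded_global_existence:
  assumes T: "T > 0" and R0: "R0 \<ge> 0"
  obtains R where "\<And>v0. real_valued v0 \<Longrightarrow> hs_b s v0 R0 \<Longrightarrow> \<exists>v. wsol T R v0 v"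
proof -
  obtain R where R: "\<And>N v0 v t. galsol N T v0 v \<Longrightarrow> hs_b s v0 R0 \<Longrightarrow> t \<in> {0..T} \<Longrightarrow> hs_b s (v t) R"
    using a_priori_bound[OF less_imp_le[OF T] R0] by blast
  show ?thesis
  proof (rule that)
    fix v0 assume "real_valued v0" "hs_b s v0 R0"
    then show "\<exists>v. wsol T R v0 v" using global_existence[OF T, of v0 R] R by metis
  qed
qed

lemma wsol_mK_solution: "wsol T R v0 v \<Longrightarrow> T \<ge> 0 \<Longrightarrow> mK_solution \<beta> \<gamma> (12 * pi\<^sup>2 * c) s T v0 v"
  using wsol_C_Hs by (simp add: mK_solution_def wsol_def)

text \<open>Continuous dependence quantifies over arbitrary solutions in C([0,T];H^s), which come
  without a common bound. Uniqueness replaces them by the constructed ones, which have it.\<close>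

lemma well_posed: "uncond_global_wp \<beta> \<gamma> (12 * pi\<^sup>2 * c) s"
  unfolding uncond_global_wp_def
proof (intro allI impI conjI ballI)
  fix T :: real and v0 assume T: "T > 0" and v0: "v0 \<in> Hs s"
  have re: "real_valued v0" and b: "hs_b s v0 (hs_norm s v0)" using v0 Hs_hs_b by (auto simp: Hs_def)
  obtain R where "\<And>v0'. real_valued v0' \<Longrightarrow> hs_b s v0' (hs_norm s v0) \<Longrightarrow> \<exists>v. wsol T R v0' v"
    using bounded_global_existence[OF T l2b_nonneg[OF b]] by metis
  then obtain v where "wsol T R v0 v" using re b by blast
  then show "\<exists>v. mK_solution \<beta> \<gamma> (12 * pi\<^sup>2 * c) s T v0 v" using wsol_mK_solution T less_imp_le by blast
next
  fix T :: real and v0 v w t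
  assume T: "T > 0" and *: "mK_solution \<beta> \<gamma> (12 * pi\<^sup>2 * c) s T v0 v \<and> mK_solution \<beta> \<gamma> (12 * pi\<^sup>2 * c) s T v0 w"
    and t: "t \<in> {0..T}"
  obtain R where "wsol T R v0 v" using mK_solution_wsol * T by (metis less_imp_le)
  moreover obtain R' where "wsol T R' v0 w" using mK_solution_wsol * T by (metis less_imp_le)
  ultimately show "v t = w t" using wsol_unique[OF _ _ t] by blast
next
  fix T :: real and v0 and \<epsilon> :: real assume T: "T > 0" and v0: "v0 \<in> Hs s" and \<epsilon>: "\<epsilon> > 0"
  have T0: "T \<ge> 0" using T by simp
  have re: "real_valued v0" and b: "hs_b s v0 (hs_norm s v0)" using v0 Hs_hs_b by (auto simp: Hs_def)
  \<comment> \<open>Data at distance less than 1 from \<open>v0\<close> stay in this ball; hence the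
    minimum with 1 in the choice of \<open>\<delta>\<close> below.\<close>
  define R0 where "R0 = hs_norm s v0 + 1"
  have R0: "R0 \<ge> 0" using l2b_nonneg[OF b] by (simp add: R0_def)
  obtain R where R: "\<And>v0. real_valued v0 \<Longrightarrow> hs_b s v0 R0 \<Longrightarrow> \<exists>v. wsol T R v0 v"
    using bounded_global_existence[OF T R0] by metis
  have "hs_b s v0 R0" using b by (rule l2b_weaken) (simp add: R0_def)
  with R re obtain v' where v': "wsol T R v0 v'" by blast
  obtain \<delta> where \<delta>: "\<delta> > 0"
    "\<And>w0 w t. wsol T R w0 w \<Longrightarrow> hs_b s (\<lambda>n. w0 n - v0 n) \<delta> \<Longrightarrow> t \<in> {0..T} \<Longrightarrow> hs_b s (\<lambda>n. w t n - v' t n) (\<epsilon>/2)"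
    using wsol_dependence[OF v' T0 half_gt_zero[OF \<epsilon>]] by blast
  show "\<exists>\<delta>>0. \<forall>w0\<in>Hs s. \<forall>v w. hs_norm s (w0 - v0) < \<delta> \<and> mK_solution \<beta> \<gamma> (12 * pi\<^sup>2 * c) s T v0 v
      \<and> mK_solution \<beta> \<gamma> (12 * pi\<^sup>2 * c) s T w0 w \<longrightarrow> (\<forall>t\<in>{0..T}. hs_norm s (w t - v t) < \<epsilon>)"
  proof (intro exI[of _ "min \<delta> 1"] conjI ballI allI impI)
    show "0 < min \<delta> 1" using \<delta>(1) by simp
    fix w0 v w t assume w0: "w0 \<in> Hs s" and *: "hs_norm s (w0 - v0) < min \<delta> 1 \<and> mK_solution \<beta> \<gamma> (12 * pi\<^sup>2 * c) s T v0 v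
      \<and> mK_solution \<beta> \<gamma> (12 * pi\<^sup>2 * c) s T w0 w" and t: "t \<in> {0..T}"
    have rw: "real_valued w0" using w0 by (simp add: Hs_def)
    have "hs_b s (w0 - v0) (hs_norm s w0 + hs_norm s v0)"
      using hs_b_diff[OF Hs_hs_b[OF w0] b] by simp
    then have d: "hs_b s (w0 - v0) (hs_norm s (w0 - v0))" by (intro summable_imp_hs_b hs_b_imp_norm)
    have "hs_b s w0 (hs_norm s v0 + hs_norm s (w0 - v0))" using hs_b_triangle[OF b d] by simp
    then have "hs_b s w0 R0" by (rule l2b_weaken) (use * in \<open>simp add: R0_def\<close>)
    with R rw obtain w' where w': "wsol T R w0 w'" by blast
    obtain Rv where "wsol T Rv v0 v" using mK_solution_wsol * T0 by blast
    then have vv: "v t = v' t" using wsol_unique[OF _ v' t] by blast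
    obtain Rw where "wsol T Rw w0 w" using mK_solution_wsol * T0 by blast
    then have ww: "w t = w' t" using wsol_unique[OF _ w' t] by blast
    have "hs_b s (\<lambda>n. w0 n - v0 n) \<delta>" using l2b_weaken[OF d, of \<delta>] * by simp
    from \<delta>(2)[OF w' this t] have "hs_b s (w t - v t) (\<epsilon>/2)" by (simp add: vv ww)
    then have "hs_norm s (w t - v t) \<le> \<epsilon>/2" by (rule hs_b_imp_norm)
    then show "hs_norm s (w t - v t) < \<epsilon>" using \<epsilon> by simp
  qed
qed

end

theorem theorem1p5:
  fixes \<beta> \<gamma> \<mu> s :: real
  assumes "\<beta> \<ge> 0" and "\<mu> = 1 \<or> \<mu> = -1" and "s > 1/2"
  shows "uncond_global_wp \<beta> \<gamma> \<mu> s"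
proof -
  obtain A where "kernel_bound (\<lambda>a b d. W s (a+b+d) / (W s a * W s b * W s d)) A"
    using kernel_W[OF assms(3)] .
  \<comment> \<open>With this \<open>c\<close> the factor \<open>12 * pi\<^sup>2 * c\<close> of
    \<open>well_posed\<close> is \<mu>.\<close>
  then interpret mkaw \<beta> \<gamma> "\<mu> / (12 * pi\<^sup>2)" s A
    using assms by unfold_locales
  show ?thesis using well_posed by simp
qed

end
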